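(* Fix $d\ge 3$. Every nontrivial group endomorphism of $\mathrm{SL}_d(\mathbf{Z})$ is an automorphism. Moreover, every automorphism of $\mathrm{SL}_d(\mathbf{Z})$ agrees, up to postcomposition with conjugation by an element of $\mathrm{GL}_d(\mathbf{Z})$, with either the identity or the inverse-transpose automorphism $A\mapsto (A^{-1})^{t}$. *)

theory Defs
  imports "Jordan_Normal_Form.Determinant" "HOL-Algebra.Group"
begin

definition GL :: "nat \<Rightarrow> int mat monoid" where
  "GL d = units_of (ring_mat TYPE(int) d ())"

definition SL :: "nat \<Rightarrow> int mat monoid" where
  "SL d = \<lparr>carrier = {A \<in> carrier_mat d d. det A = 1}, mult = (*), one = 1\<^sub>m d\<rparr>"

definition GL_conj :: "nat \<Rightarrow> int mat \<Rightarrow> int mat \<Rightarrow> int mat" where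
  "GL_conj d P A = P * A * inv\<^bsub>GL d\<^esub> P"

definition inv_transpose :: "nat \<Rightarrow> int mat \<Rightarrow> int mat" where
  "inv_transpose d A = transpose_mat (inv\<^bsub>SL d\<^esub> A)"

lemma SL_simps [simp]:
  "carrier (SL d) = {A \<in> carrier_mat d d. det A = 1}"
  "mult (SL d) = (*)" "one (SL d) = 1\<^sub>m d"
  by (simp_all add: SL_def)

lemma carrier_GL:
  "carrier (GL d) = {P \<in> carrier_mat d d. \<exists>Q \<in> carrier_mat d d. Q * P = 1\<^sub>m d \<and> P * Q = 1\<^sub>m d}"
  by (auto simp: GL_def units_of_def Units_def ring_mat_simps)

lemma GL_simps [simp]: "mult (GL d) = (*)" "one (GL d) = 1\<^sub>m d"
  by (simp_all add: GL_def units_of_def ring_mat_simps)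

lemma group_GL: "group (GL d)"
proof -
  interpret ring "ring_mat TYPE(int) d ()" by (rule ring_mat)
  show ?thesis unfolding GL_def by (rule units_group)
qed

lemma SL_inverse_exists:
  assumes "A \<in> carrier (SL d)"
  shows "adj_mat A \<in> carrier (SL d)" "adj_mat A * A = 1\<^sub>m d" "A * adj_mat A = 1\<^sub>m d"
proof -
  from assms have A: "A \<in> carrier_mat d d" and dA: "det A = 1" by auto
  note adj = adj_mat[OF A]
  show 1: "adj_mat A * A = 1\<^sub>m d" and "A * adj_mat A = 1\<^sub>m d"
    using adj dA A by auto
  from arg_cong[OF 1, of det] det_mult[OF adj(1) A] dA
  show "adj_mat A \<in> carrier (SL d)" using adj(1) by simp
qed

lemma group_SL: "group (SL d)"
proof (rule groupI)
  fix A assume "A \<in> carrier (SL d)"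
  then show "\<exists>B \<in> carrier (SL d). B \<otimes>\<^bsub>SL d\<^esub> A = \<one>\<^bsub>SL d\<^esub>"
    using SL_inverse_exists(1,2) by (metis SL_simps(2,3))
qed (auto simp: det_mult assoc_mult_mat)

lemma inv_transpose_hom: "inv_transpose d \<in> hom (SL d) (SL d)"
proof (rule homI)
  interpret group "SL d" by (rule group_SL)
  fix A B assume A: "A \<in> carrier (SL d)" and B: "B \<in> carrier (SL d)"
  note iA = inv_closed[OF A] and iB = inv_closed[OF B]
  from iA show "inv_transpose d A \<in> carrier (SL d)"
    by (auto simp: inv_transpose_def det_transpose)
  have "inv_transpose d (A \<otimes>\<^bsub>SL d\<^esub> B) = transpose_mat (inv\<^bsub>SL d\<^esub> B * inv\<^bsub>SL d\<^esub> A)"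
    using inv_mult_group[OF A B] by (simp add: inv_transpose_def)
  also have "\<dots> = inv_transpose d A \<otimes>\<^bsub>SL d\<^esub> inv_transpose d B"
    using iA iB transpose_mult[of "inv\<^bsub>SL d\<^esub> B" d d "inv\<^bsub>SL d\<^esub> A" d]
    by (simp add: inv_transpose_def)
  finally show "inv_transpose d (A \<otimes>\<^bsub>SL d\<^esub> B) = inv_transpose d A \<otimes>\<^bsub>SL d\<^esub> inv_transpose d B" .
qed

lemma inv_transpose_involution:
  assumes A: "A \<in> carrier (SL d)"
  shows "inv_transpose d (inv_transpose d A) = A"
proof -
  interpret group "SL d" by (rule group_SL)
  let ?B = "inv\<^bsub>SL d\<^esub> A"
  have B: "?B \<in> carrier (SL d)" using A by (rule inv_closed)
  have tA: "transpose_mat A \<in> carrier (SL d)" "transpose_mat ?B \<in> carrier (SL d)"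
    using A B by (auto simp: det_transpose)
  have "transpose_mat A \<otimes>\<^bsub>SL d\<^esub> transpose_mat ?B = transpose_mat (?B * A)"
    using A B transpose_mult[of ?B d d A d] by simp
  also have "?B * A = 1\<^sub>m d" using l_inv[OF A] by simp
  finally have "inv\<^bsub>SL d\<^esub> (transpose_mat ?B) = transpose_mat A"
    using inv_equality[OF _ tA(2,1)] by simp
  then show ?thesis by (simp add: inv_transpose_def)
qed

lemma inv_transpose_iso: "inv_transpose d \<in> iso (SL d) (SL d)"
proof (rule isoI[OF inv_transpose_hom])
  have "inv_transpose d A \<in> carrier (SL d)" if "A \<in> carrier (SL d)" for A
    using inv_transpose_hom that by (rule hom_in_carrier)
  then show "bij_betw (inv_transpose d) (carrier (SL d)) (carrier (SL d))"
    by (intro bij_betw_byWitness[where f' = "inv_transpose d"])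
       (auto simp: inv_transpose_involution simp del: SL_simps)
qed

end

theory Submission
  imports Defs
begin

text \<open>
  A nontrivial endomorphism \<open>f\<close> is studied through the involutions \<open>t\<^sub>i\<^sub>j\<close>, diagonal with
  entries \<open>-1\<close> exactly at \<open>i\<close> and \<open>j\<close>, acting via \<open>f\<close> on \<open>\<int>\<^sup>d\<close>. Joint eigenvectors with distinct
  characters are independent, so at most \<open>d\<close> characters occur, whereas the monomial matrices move
  any character around its orbit.

  If \<open>f\<close> kills the \<open>t\<^sub>i\<^sub>j\<close>, then all \<open>f(e\<^sub>i\<^sub>j)\<close> are involutions and every nontrivial character of
  the elementary abelian group \<open>\<langle>f(e\<^sub>0\<^sub>1), \<dots>, f(e\<^sub>0\<^sub>,\<^sub>d\<^sub>-\<^sub>1)\<rangle>\<close> occurs, which is too many unless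
  \<open>d = 3\<close>; there \<open>f\<close> would be a rational three-dimensional representation of \<open>SL\<^sub>3(\<bbbF>\<^sub>2)\<close>, and these
  need \<open>sqrt (-7)\<close>. Otherwise the orbit count forces the weights of the \<open>t\<^sub>i\<^sub>j\<close> to be those of the
  standard representation, apart from weights indexed by pairs for \<open>d = 4\<close>, which would put a
  noncentral quaternion unit into the kernel.

  In a basis of weight vectors the commutation relations make each \<open>f(e\<^sub>i\<^sub>j)\<close> a transvection
  \<open>1 + b\<^sub>i\<^sub>j E\<^sub>i\<^sub>j\<close>, after composing with the inverse transpose if necessary, and \<open>b\<close> is a coboundary.
  Rescaling the basis gives an integer matrix \<open>Q\<close> with \<open>f(A) Q = Q A\<close>; with coprime entries it is
  unimodular.
\<close>

section \<open>Elementary, monomial and diagonal sign matrices\<close>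

text \<open>Both halves of the theorem come from one statement: every nontrivial \<open>f\<close> is
  conjugation by some \<open>P\<close> in \<open>GL d\<close>, possibly after the inverse transpose.
  Such maps are bijective, so surjectivity of \<open>f\<close> is never attacked directly, and for a
  given automorphism injectivity serves only to show that it is nontrivial. Sign matrices are a good
  torus here because commuting involutions have joint eigenvectors with integer entries:
  \<open>v + A v\<close> does the averaging without dividing by 2. Counting characters then takes
  the place of decomposing into irreducibles. The counts are sharp in low dimension, which is what
  shapes the proof. The number \<open>2^(d-1) - 1\<close> of nontrivial characters exceeds
  \<open>d\<close> only from \<open>d = 4\<close> on, and \<open>k * (d - k)\<close> with
  \<open>k = 2\<close> exceeds \<open>d\<close> only from \<open>d = 5\<close> on. So
  \<open>d = 3\<close> and \<open>d = 4\<close> need arithmetic instead of counting: certain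
  rational squares (\<open>3\<close>, or a sum of two squares that would be negative) do not exist.
  A weight basis spans only a sublattice in general, so the intertwiner is at first merely rational;
  integrality of all \<open>f(A)\<close> forces it to be unimodular after scaling.\<close>

abbreviation elem :: "nat \<Rightarrow> nat \<Rightarrow> nat \<Rightarrow> int \<Rightarrow> int mat" where
  "elem d i j a \<equiv> addrow_mat d a i j"

text \<open>The usual lift of the transposition of \<open>i\<close> and \<open>j\<close>: a signed
  permutation matrix with \<open>1\<close> at \<open>(i,j)\<close> and \<open>-1\<close> at
  \<open>(j,i)\<close>. As a product of elementary matrices it has determinant 1; its square is
  \<open>flip d i j\<close>, not the identity.\<close>

definition weyl :: "nat \<Rightarrow> nat \<Rightarrow> nat \<Rightarrow> int mat" where
  "weyl d i j = elem d i j 1 * (elem d j i (-1) * elem d i j 1)"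

definition diag_of :: "nat \<Rightarrow> (nat \<Rightarrow> int) \<Rightarrow> int mat" where
  "diag_of d \<epsilon> = mat d d (\<lambda>(r,c). if r = c then \<epsilon> r else 0)"

definition sgn_on :: "nat set \<Rightarrow> nat \<Rightarrow> int" where
  "sgn_on S r = (if r \<in> S then -1 else 1)"

definition flip :: "nat \<Rightarrow> nat \<Rightarrow> nat \<Rightarrow> int mat" where
  "flip d i j = diag_of d (sgn_on {i,j})"

lemma elem_mult:
  "M \<in> carrier_mat d d \<Longrightarrow> j < d \<Longrightarrow> elem d i j a * M = addrow a i j M"
  by (simp add: addrow_mat)

text \<open>Left factors act by row operations. With every left product available as an explicit
  matrix, the relations below reduce to comparing entries.\<close>

lemma weyl_mult:
  assumes "M \<in> carrier_mat d d" "i < d" "j < d" "i \<noteq> j"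
  shows "weyl d i j * M =
    mat d d (\<lambda>(r,c). if r = i then M $$ (j,c) else if r = j then - M $$ (i,c) else M $$ (r,c))"
proof -
  have "weyl d i j * M = elem d i j 1 * (elem d j i (-1) * (elem d i j 1 * M))"
    unfolding weyl_def using assms
    by (simp add: assoc_mult_mat[of _ d d _ d _ d] mult_carrier_mat[of _ d d _ d])
  also have "\<dots> = addrow 1 i j (addrow (-1) j i (addrow 1 i j M))"
    using assms by (simp add: elem_mult)
  also have "\<dots> = mat d d (\<lambda>(r,c). if r = i then M $$ (j,c) else if r = j then - M $$ (i,c) else M $$ (r,c))"
    by (rule eq_matI) (use assms in auto)
  finally show ?thesis .
qed

lemma weyl_carrier [simp]: "weyl d i j \<in> carrier_mat d d"
  unfolding weyl_def by (intro mult_carrier_mat[of _ d d _ d]) auto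

lemma diag_of_carrier [simp]: "diag_of d \<epsilon> \<in> carrier_mat d d"
  unfolding diag_of_def by auto

lemma flip_carrier [simp]: "flip d i j \<in> carrier_mat d d"
  unfolding flip_def by auto

lemma sgn_on_simps [simp]: "sgn_on S r * sgn_on S r = 1" "sgn_on S r * (sgn_on S r * a) = a" "sgn_on {} r = 1"
  by (auto simp: sgn_on_def)

lemma sgn_on_cases: "sgn_on S r = 1 \<or> sgn_on S r = -1"
  by (auto simp: sgn_on_def)

lemma weyl_index:
  assumes "i < d" "j < d" "i \<noteq> j"
  shows "weyl d i j = mat d d (\<lambda>(r,c). if r = i then (if c = j then 1 else 0)
     else if r = j then (if c = i then -1 else 0) else if r = c then 1 else 0)"
  using weyl_mult[of "1\<^sub>m d" d i j] assms
  by (auto simp: right_mult_one_mat[of _ d] intro!: eq_matI)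

lemma diag_of_mult:
  assumes M: "M \<in> carrier_mat d d"
  shows "diag_of d \<epsilon> * M = mat d d (\<lambda>(r,c). \<epsilon> r * M $$ (r,c))"
proof (rule eq_matI)
  fix r c assume "r < dim_row (mat d d (\<lambda>(r,c). \<epsilon> r * M $$ (r,c)))"
    "c < dim_col (mat d d (\<lambda>(r,c). \<epsilon> r * M $$ (r,c)))"
  then have rc: "r < d" "c < d" by auto
  have "(diag_of d \<epsilon> * M) $$ (r,c) = (\<Sum>k\<in>{0..<d}. (if r = k then \<epsilon> r else 0) * M $$ (k,c))"
    using rc M by (simp add: diag_of_def scalar_prod_def)
  also have "\<dots> = (\<Sum>k\<in>{r}. (if r = k then \<epsilon> r else 0) * M $$ (k,c))"
    by (rule sum.mono_neutral_right) (use rc in auto)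
  finally show "(diag_of d \<epsilon> * M) $$ (r,c) = mat d d (\<lambda>(r,c). \<epsilon> r * M $$ (r,c)) $$ (r,c)"
    using rc by simp
qed (use M in \<open>auto simp: diag_of_def\<close>)

lemma elem_SL [simp]: "i \<noteq> j \<Longrightarrow> elem d i j a \<in> carrier (SL d)"
  by (simp add: det_addrow_mat)

lemma SL_mult_closed:
  "A \<in> carrier (SL d) \<Longrightarrow> B \<in> carrier (SL d) \<Longrightarrow> A * B \<in> carrier (SL d)"
  using monoid.m_closed[OF group.is_monoid[OF group_SL], of A d B] by simp

lemma weyl_SL: "i \<noteq> j \<Longrightarrow> weyl d i j \<in> carrier (SL d)"
  unfolding weyl_def by (intro SL_mult_closed elem_SL) auto

lemma weyl_sq:
  assumes "i < d" "j < d" "i \<noteq> j"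
  shows "weyl d i j * weyl d i j = flip d i j"
  unfolding weyl_mult[OF weyl_carrier assms]
  by (rule eq_matI) (use assms in \<open>auto simp: weyl_index flip_def diag_of_def sgn_on_def\<close>)

lemma flip_SL: "i < d \<Longrightarrow> j < d \<Longrightarrow> i \<noteq> j \<Longrightarrow> flip d i j \<in> carrier (SL d)"
  unfolding weyl_sq[symmetric] by (intro SL_mult_closed weyl_SL)

lemma elem_add:
  assumes "i < d" "j < d" "i \<noteq> j"
  shows "elem d i j a * elem d i j b = elem d i j (a + b)"
  by (subst elem_mult) (use assms in \<open>auto intro!: eq_matI\<close>)

lemma elem_comm:
  assumes "i < d" "j < d" "k < d" "l < d" "i \<noteq> j" "k \<noteq> l" "j \<noteq> k" "i \<noteq> l"
  shows "elem d i j a * elem d k l b = elem d k l b * elem d i j a"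
  by (subst elem_mult, (use assms in simp_all)[2], subst elem_mult, (use assms in simp_all)[2],
      rule eq_matI) (use assms in auto)

text \<open>The Steinberg relation \<open>[e_ij(a), e_jk(b)] = e_ik(a b)\<close> with the inverses
  moved across, so that \<open>f\<close> carries it to an identity between plain products.\<close>

lemma elem_commutator:
  assumes "i < d" "j < d" "k < d" "i \<noteq> j" "j \<noteq> k" "i \<noteq> k"
  shows "elem d i j a * elem d j k b = elem d i k (a * b) * (elem d j k b * elem d i j a)"
  using assms
  by (simp add: elem_mult mult_carrier_mat[of _ d d _ d]) (rule eq_matI, auto)

lemmas left_mult_simps = elem_mult weyl_mult diag_of_mult

lemma diag_of_elem:
  assumes "i < d" "j < d" "i \<noteq> j" "\<And>r. \<epsilon> r * \<epsilon> r = 1"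
  shows "diag_of d \<epsilon> * elem d i j a = elem d i j (\<epsilon> i * \<epsilon> j * a) * diag_of d \<epsilon>"
proof -
  have *: "\<epsilon> i * \<epsilon> j * a * \<epsilon> j = \<epsilon> i * a"
    using assms(4)[of j] by (metis mult.assoc mult.commute mult_1)
  show ?thesis
    using assms(1-3) * by (simp add: left_mult_simps) (rule eq_matI, auto simp: diag_of_def)
qed

lemma weyl_diag_of:
  assumes "i < d" "j < d" "i \<noteq> j"
  shows "weyl d i j * diag_of d \<epsilon> = diag_of d (\<epsilon> \<circ> transpose i j) * weyl d i j"
  using assms by (simp add: left_mult_simps) (rule eq_matI, auto simp: weyl_index diag_of_def transpose_def)

lemma diag_of_diag_of: "diag_of d \<epsilon> * diag_of d \<delta> = diag_of d (\<lambda>r. \<epsilon> r * \<delta> r)"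
  by (simp add: left_mult_simps) (rule eq_matI, auto simp: diag_of_def)

lemma flip_elem:
  assumes "i < d" "j < d" "i \<noteq> j"
  shows "flip d k l * elem d i j a = elem d i j (sgn_on {k,l} i * sgn_on {k,l} j * a) * flip d k l"
  unfolding flip_def by (rule diag_of_elem) (use assms in auto)

lemma weyl_elem_row:
  assumes "i < d" "j < d" "k < d" "i \<noteq> j" "j \<noteq> k" "i \<noteq> k"
  shows "weyl d k i * elem d i j a = elem d k j a * weyl d k i"
  using assms by (simp add: left_mult_simps) (rule eq_matI, auto simp: weyl_index)

lemma weyl_elem_col:
  assumes "i < d" "j < d" "k < d" "i \<noteq> j" "j \<noteq> k" "i \<noteq> k"
  shows "weyl d k j * elem d i j a = elem d i k a * weyl d k j"
  using assms by (simp add: left_mult_simps) (rule eq_matI, auto simp: weyl_index)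

lemma weyl_elem_flip:
  assumes "i < d" "j < d" "i \<noteq> j"
  shows "weyl d i j * elem d i j a = elem d j i (-a) * weyl d i j"
  using assms by (simp add: left_mult_simps) (rule eq_matI, auto simp: weyl_index)

lemma mult_commutes:
  fixes A B C X :: "int mat"
  assumes "A \<in> carrier_mat d d" "B \<in> carrier_mat d d" "X \<in> carrier_mat d d"
    and "A * X = X * A" "B * X = X * B"
  shows "(A * B) * X = X * (A * B)"
proof -
  have "(A * B) * X = A * (B * X)" using assms(1-3) by (rule assoc_mult_mat)
  also have "\<dots> = (A * X) * B" using assms(1-3) by (simp add: assms(5) assoc_mult_mat[of _ d d _ d _ d])
  also have "\<dots> = X * (A * B)" unfolding assms(4) using assms(3,1,2) by (rule assoc_mult_mat)
  finally show ?thesis .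
qed

lemma weyl_elem_comm:
  assumes "i < d" "j < d" "k < d" "l < d" "i \<noteq> j" "k \<noteq> l" "{i,j} \<inter> {k,l} = {}"
  shows "weyl d k l * elem d i j a = elem d i j a * weyl d k l"
  unfolding weyl_def
  by (intro mult_commutes[where d = d] mult_carrier_mat[of _ d d _ d] elem_comm) (use assms in auto)

lemma weyl_comm:
  assumes "i < d" "j < d" "k < d" "l < d" "i \<noteq> j" "k \<noteq> l" "{i,j} \<inter> {k,l} = {}"
  shows "weyl d k l * weyl d i j = weyl d i j * weyl d k l"
  unfolding weyl_def[of d k l]
  by (intro mult_commutes[where d = d] mult_carrier_mat[of _ d d _ d] weyl_elem_comm[symmetric]) (use assms in auto)

lemma weyl_flip:
  assumes "i < d" "j < d" "i \<noteq> j"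
  shows "weyl d i j * flip d k l = flip d (transpose i j k) (transpose i j l) * weyl d i j"
proof -
  have "sgn_on {k,l} \<circ> transpose i j = sgn_on {transpose i j k, transpose i j l}"
  proof
    fix r
    have "transpose i j r = m \<longleftrightarrow> r = transpose i j m" for m
      by (metis transpose_involutory)
    then show "(sgn_on {k,l} \<circ> transpose i j) r = sgn_on {transpose i j k, transpose i j l} r"
      by (simp add: sgn_on_def)
  qed
  then show ?thesis using weyl_diag_of[OF assms] by (simp add: flip_def)
qed

lemma flip_sq: "flip d i j * flip d i j = 1\<^sub>m d"
  unfolding flip_def diag_of_diag_of by (auto simp: diag_of_def intro!: eq_matI)

lemma flip_comm: "flip d i j * flip d k l = flip d k l * flip d i j"
  unfolding flip_def diag_of_diag_of by (simp add: mult.commute)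

lemma flip_prod:
  assumes "i \<noteq> j" "j \<noteq> k" "i \<noteq> k"
  shows "flip d i j * flip d j k = flip d i k"
  unfolding flip_def diag_of_diag_of by (rule arg_cong[where f = "diag_of d"]) (use assms in \<open>auto simp: sgn_on_def\<close>)

section \<open>Generation by elementary matrices\<close>

inductive_set elem_prods :: "nat \<Rightarrow> int mat set" for d where
  one: "1\<^sub>m d \<in> elem_prods d"
| step: "A \<in> elem_prods d \<Longrightarrow> i < d \<Longrightarrow> j < d \<Longrightarrow> i \<noteq> j \<Longrightarrow> elem d i j a * A \<in> elem_prods d"

lemma elem_prods_cancel:
  assumes "elem d i j a * A \<in> elem_prods d" "A \<in> carrier_mat d d" "i < d" "j < d" "i \<noteq> j"
  shows "A \<in> elem_prods d"
proof -
  have "elem d i j (-a) * (elem d i j a * A) = A"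
    using assms by (simp add: elem_mult) (rule eq_matI, auto)
  then show ?thesis using elem_prods.step[OF assms(1,3-5), of "-a"] by simp
qed

definition id_cols :: "nat \<Rightarrow> nat \<Rightarrow> int mat \<Rightarrow> bool" where
  "id_cols d k A \<longleftrightarrow> A \<in> carrier (SL d) \<and> (\<forall>r<d. \<forall>c<k. A $$ (r,c) = (if r = c then 1 else 0))"

text \<open>Row \<open>j\<close> vanishes in the first \<open>k\<close> columns because
  \<open>k \<le> j\<close>, so adding a multiple of it leaves them alone; the target row
  \<open>i\<close> is arbitrary, which allows clearing above the pivot too.\<close>

lemma id_cols_elem:
  assumes "id_cols d k A" "i < d" "j < d" "i \<noteq> j" "k \<le> j" "k \<le> d"
  shows "id_cols d k (elem d i j a * A)"
proof -
  have "elem d i j a * A \<in> carrier (SL d)"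
    using assms by (intro SL_mult_closed) (auto simp: id_cols_def simp del: SL_simps)
  moreover have "elem d i j a * A = addrow a i j A"
    using assms by (auto simp: id_cols_def elem_mult)
  ultimately show ?thesis using assms unfolding id_cols_def by auto
qed

lemma elem_entry:
  assumes "id_cols d k A" "j < d" "r < d" "c < d"
  shows "(elem d i j a * A) $$ (r,c) = (if r = i then a * A $$ (j,c) + A $$ (r,c) else A $$ (r,c))"
  using assms by (auto simp: id_cols_def elem_mult)

text \<open>Since the first \<open>k\<close> columns of \<open>A\<close> are unit vectors, row
  \<open>k\<close> of the inverse vanishes there. Entry \<open>(k,k)\<close> of
  \<open>B * A = 1\<close> thus writes 1 as a combination of the entries of column \<open>k\<close>
  from row \<open>k\<close> downwards.\<close>

lemma id_cols_unimodular:
  assumes "id_cols d k A" "k < d" "\<And>r. k \<le> r \<Longrightarrow> r < d \<Longrightarrow> c dvd A $$ (r,k)"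
  shows "c dvd 1"
proof -
  let ?B = "adj_mat A"
  have A: "A \<in> carrier_mat d d" "A \<in> carrier (SL d)" using assms by (auto simp: id_cols_def)
  have B: "?B \<in> carrier_mat d d" "?B * A = 1\<^sub>m d" using SL_inverse_exists[OF A(2)] by auto
  have e: "(\<Sum>r\<in>{0..<d}. ?B $$ (i,r) * A $$ (r,j)) = (if i = j then 1 else 0)" if "i < d" "j < d" for i j
    using arg_cong[OF B(2), of "\<lambda>M. M $$ (i,j)"] A B(1) that by (simp add: scalar_prod_def)
  have B0: "?B $$ (k,c) = 0" if "c < k" for c
  proof -
    have "(\<Sum>r\<in>{0..<d}. ?B $$ (k,r) * A $$ (r,c)) = (\<Sum>r\<in>{c}. ?B $$ (k,r) * A $$ (r,c))"
      by (rule sum.mono_neutral_right) (use assms that in \<open>auto simp: id_cols_def\<close>)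
    moreover have "A $$ (c,c) = 1" using assms that by (auto simp: id_cols_def)
    ultimately show ?thesis using e[of k c] that assms(2) by simp
  qed
  have "c dvd (\<Sum>r\<in>{0..<d}. ?B $$ (k,r) * A $$ (r,k))"
  proof (rule dvd_sum)
    fix r assume "r \<in> {0..<d}"
    then show "c dvd ?B $$ (k,r) * A $$ (r,k)"
      using B0[of r] assms(3)[of r] by (cases "r < k") auto
  qed
  then show ?thesis using e[of k k] assms(2) by simp
qed

text \<open>In the last column no row is left below the pivot to correct its sign; here the
  determinant does it, as \<open>A\<close> is upper triangular.\<close>

lemma id_cols_last:
  assumes "id_cols d k A" "Suc k = d"
  shows "A $$ (k,k) = 1"
proof -
  have A: "A \<in> carrier_mat d d" and dA: "det A = 1"
    and id: "\<And>r c. r < d \<Longrightarrow> c < k \<Longrightarrow> A $$ (r,c) = (if r = c then 1 else 0)"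
    using assms by (auto simp: id_cols_def)
  have "upper_triangular A" using id assms(2) A by (auto simp: upper_triangular_def)
  then have "det A = prod_list (diag_mat A)" using A by (rule det_upper_triangular)
  also have "\<dots> = (\<Prod>i\<in>{0..<d}. A $$ (i,i))"
    using A by (simp add: diag_mat_def prod.list_conv_set_nth)
  also have "\<dots> = (\<Prod>i\<in>{k}. A $$ (i,i))"
    by (rule prod.mono_neutral_right) (use id assms(2) in auto)
  finally show ?thesis using dA by simp
qed

text \<open>A pivot equal to 1 clears the other entries of its column one at a time, above as well
  as below; the induction counts the entries still to be cleared.\<close>

lemma elem_prods_pivot:
  assumes IH: "\<And>A. id_cols d (Suc k) A \<Longrightarrow> A \<in> elem_prods d" and k: "k < d"
  shows "id_cols d k A \<Longrightarrow> A $$ (k,k) = 1 \<Longrightarrow> A \<in> elem_prods d"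
proof (induction "card {r. r < d \<and> r \<noteq> k \<and> A $$ (r,k) \<noteq> 0}" arbitrary: A rule: less_induct)
  case less
  show ?case
  proof (cases "\<exists>r<d. r \<noteq> k \<and> A $$ (r,k) \<noteq> 0")
    case False
    then have "id_cols d (Suc k) A"
      using less.prems by (auto simp: id_cols_def less_Suc_eq)
    then show ?thesis by (rule IH)
  next
    case True
    then obtain r where r: "r < d" "r \<noteq> k" "A $$ (r,k) \<noteq> 0" by auto
    let ?B = "elem d r k (- A $$ (r,k)) * A"
    have B: "?B $$ (s,k) = (if s = r then 0 else A $$ (s,k))" if "s < d" for s
      using elem_entry[OF less.prems(1) k that k, where i = r and a = "- A $$ (r,k)"] less.prems(2) by auto
    have "?B \<in> elem_prods d"
    proof (rule less.hyps)
      show "id_cols d k ?B" by (rule id_cols_elem[OF less.prems(1) r(1) k r(2) order.refl]) (use k in simp)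
      show "?B $$ (k,k) = 1" using B[OF k] r less.prems by simp
      have "{s. s < d \<and> s \<noteq> k \<and> ?B $$ (s,k) \<noteq> 0} \<subseteq> {s. s < d \<and> s \<noteq> k \<and> A $$ (s,k) \<noteq> 0} - {r}"
      proof
        fix s assume "s \<in> {s. s < d \<and> s \<noteq> k \<and> ?B $$ (s,k) \<noteq> 0}"
        then have s: "s < d" "s \<noteq> k" and n: "?B $$ (s,k) \<noteq> 0" by blast+
        from n have "s \<noteq> r \<and> A $$ (s,k) \<noteq> 0" unfolding B[OF s(1)] by (metis (full_types))
        with s show "s \<in> {s. s < d \<and> s \<noteq> k \<and> A $$ (s,k) \<noteq> 0} - {r}" by blast
      qed
      moreover have "r \<in> {s. s < d \<and> s \<noteq> k \<and> A $$ (s,k) \<noteq> 0}" using r by blast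
      ultimately have "{s. s < d \<and> s \<noteq> k \<and> ?B $$ (s,k) \<noteq> 0} \<subset> {s. s < d \<and> s \<noteq> k \<and> A $$ (s,k) \<noteq> 0}"
        by blast
      then show "card {s. s < d \<and> s \<noteq> k \<and> ?B $$ (s,k) \<noteq> 0} < card {s. s < d \<and> s \<noteq> k \<and> A $$ (s,k) \<noteq> 0}"
        by (intro psubset_card_mono) auto
    qed
    then show ?thesis
      by (rule elem_prods_cancel) (use less.prems r k in \<open>auto simp: id_cols_def\<close>)
  qed
qed

lemma unit_sq: "x dvd 1 \<Longrightarrow> x * x = (1::int)"
  by (metis abs_mult_self_eq mult_1 zdvd1_eq)

text \<open>A unit \<open>u\<close> below the pivot satisfies \<open>u * u = 1\<close>, so adding
  \<open>(1 - A $$ (k,k)) * u\<close> times its row turns the pivot into exactly 1.\<close>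

lemma elem_prods_unit_entry:
  assumes IH: "\<And>A. id_cols d (Suc k) A \<Longrightarrow> A \<in> elem_prods d"
    and A: "id_cols d k A" and k: "k < d" and r: "k < r" "r < d" "A $$ (r,k) dvd 1"
  shows "A \<in> elem_prods d"
proof -
  let ?B = "elem d k r ((1 - A $$ (k,k)) * A $$ (r,k)) * A"
  have "?B $$ (k,k) = 1"
    using elem_entry[OF A r(2) k k] unit_sq[OF r(3)] by (simp add: algebra_simps)
  moreover have "id_cols d k ?B" using A r k by (intro id_cols_elem) auto
  ultimately have "?B \<in> elem_prods d" using elem_prods_pivot[OF IH k] by blast
  then show ?thesis by (rule elem_prods_cancel) (use A k r in \<open>auto simp: id_cols_def\<close>)
qed

text \<open>A pivot \<open>-1\<close> cannot be rescaled by elementary matrices. It is used to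
  create an entry 1 in row \<open>k + 1\<close>, which in turn repairs the pivot; in the last column
  there is no such row, but the pivot is 1 anyway.\<close>

lemma elem_prods_unit_diag:
  assumes IH: "\<And>A. id_cols d (Suc k) A \<Longrightarrow> A \<in> elem_prods d"
    and A: "id_cols d k A" and k: "k < d" and u: "A $$ (k,k) dvd 1"
  shows "A \<in> elem_prods d"
proof (cases "Suc k = d")
  case True
  then show ?thesis using elem_prods_pivot[OF IH k A] id_cols_last[OF A] by blast
next
  case False
  then have k': "Suc k < d" using k by simp
  let ?B = "elem d (Suc k) k ((1 - A $$ (Suc k,k)) * A $$ (k,k)) * A"
  have "?B $$ (Suc k,k) = 1"
    using elem_entry[OF A k k' k] unit_sq[OF u] by (simp add: algebra_simps)
  moreover have "id_cols d k ?B" using A k k' by (intro id_cols_elem) auto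
  ultimately have "?B \<in> elem_prods d" using elem_prods_unit_entry[OF IH _ k _ k'] by simp
  then show ?thesis by (rule elem_prods_cancel) (use A k k' in \<open>auto simp: id_cols_def\<close>)
qed

lemma abs_reduce: "x \<noteq> 0 \<Longrightarrow> \<bar>x\<bar> \<le> \<bar>y\<bar> \<Longrightarrow> \<bar>- (sgn x * sgn y) * x + y\<bar> < \<bar>y\<bar>" for x y :: int
  by (auto simp: sgn_if abs_if split: if_splits)

text \<open>Subtractive Euclidean algorithm on the part of column \<open>k\<close> from the diagonal
  down, with the sum of absolute values as measure. It stops at a single nonzero entry, which
  \<open>id_cols_unimodular\<close> shows to be a unit.\<close>

lemma elem_prods_euclid:
  assumes IH: "\<And>A. id_cols d (Suc k) A \<Longrightarrow> A \<in> elem_prods d" and k: "k < d"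
  shows "id_cols d k A \<Longrightarrow> A \<in> elem_prods d"
proof (induction "nat (\<Sum>r\<in>{k..<d}. \<bar>A $$ (r,k)\<bar>)" arbitrary: A rule: less_induct)
  case less
  note A = less.prems
  have car: "A \<in> carrier_mat d d" using A by (auto simp: id_cols_def)
  show ?case
  proof (cases "\<exists>r s. k \<le> r \<and> r < d \<and> k \<le> s \<and> s < d \<and> r \<noteq> s \<and> A $$ (r,k) \<noteq> 0 \<and> A $$ (s,k) \<noteq> 0")
    case True
    then obtain r s where rs: "k \<le> r" "r < d" "k \<le> s" "s < d" "r \<noteq> s" "A $$ (r,k) \<noteq> 0"
      and le: "\<bar>A $$ (r,k)\<bar> \<le> \<bar>A $$ (s,k)\<bar>"
      by (metis linorder_le_cases)
    let ?a = "- (sgn (A $$ (r,k)) * sgn (A $$ (s,k)))"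
    let ?B = "elem d s r ?a * A"
    have B: "?B $$ (t,k) = (if t = s then ?a * A $$ (r,k) + A $$ (s,k) else A $$ (t,k))" if "t < d" for t
      using elem_entry[OF A rs(2) that k] by simp
    have "(\<Sum>t\<in>{k..<d}. \<bar>?B $$ (t,k)\<bar>) < (\<Sum>t\<in>{k..<d}. \<bar>A $$ (t,k)\<bar>)"
    proof (rule sum_strict_mono_ex1)
      show "\<forall>t\<in>{k..<d}. \<bar>?B $$ (t,k)\<bar> \<le> \<bar>A $$ (t,k)\<bar>"
        using B abs_reduce[OF rs(6) le] by (auto simp del: mult_minus_left)
      show "\<exists>t\<in>{k..<d}. \<bar>?B $$ (t,k)\<bar> < \<bar>A $$ (t,k)\<bar>"
        using B[OF rs(4)] abs_reduce[OF rs(6) le] rs by (intro bexI[of _ s]) auto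
    qed simp
    moreover have "0 \<le> (\<Sum>t\<in>{k..<d}. \<bar>?B $$ (t,k)\<bar>)" by (rule sum_nonneg) simp
    ultimately have "nat (\<Sum>t\<in>{k..<d}. \<bar>?B $$ (t,k)\<bar>) < nat (\<Sum>t\<in>{k..<d}. \<bar>A $$ (t,k)\<bar>)" by linarith
    then have "?B \<in> elem_prods d"
      by (rule less.hyps) (use A rs k in \<open>auto intro!: id_cols_elem\<close>)
    then show ?thesis by (rule elem_prods_cancel) (use car rs in auto)
  next
    case False
    have "\<exists>r. k \<le> r \<and> r < d \<and> A $$ (r,k) \<noteq> 0"
      using id_cols_unimodular[OF A k, of 0] by auto
    then obtain r where r: "k \<le> r" "r < d" "A $$ (r,k) \<noteq> 0" by auto
    have "A $$ (r,k) dvd 1"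
    proof (rule id_cols_unimodular[OF A k])
      fix s assume "k \<le> s" "s < d"
      then have "s = r \<or> A $$ (s,k) = 0" using False r by blast
      then show "A $$ (r,k) dvd A $$ (s,k)" by auto
    qed
    then show ?thesis
      using elem_prods_unit_entry[OF IH A k _ r(2)] elem_prods_unit_diag[OF IH A k] r(1) by (cases "r = k") auto
  qed
qed

lemma SL_elem_prods: "carrier (SL d) \<subseteq> elem_prods d"
proof -
  have "k \<le> d \<Longrightarrow> id_cols d k A \<Longrightarrow> A \<in> elem_prods d" for k A
  proof (induction "d - k" arbitrary: k A)
    case 0
    then have "A = 1\<^sub>m d" by (intro eq_matI) (auto simp: id_cols_def)
    then show ?case by (simp add: elem_prods.one)
  next
    case (Suc n)
    then show ?case using elem_prods_euclid[of d k A] by (metis Suc_leI diff_Suc_1 diff_Suc_eq_diff_pred leI le_antisym diff_is_0_eq nat.simps(3) Suc_diff_Suc diff_Suc_Suc)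
  qed
  from this[of 0] show ?thesis by (auto simp: id_cols_def)
qed

lemma SL_elem_induct [consumes 1, case_names one step]:
  assumes "A \<in> carrier (SL d)"
    and "P (1\<^sub>m d)"
    and "\<And>A i j a. A \<in> carrier (SL d) \<Longrightarrow> P A \<Longrightarrow> i < d \<Longrightarrow> j < d \<Longrightarrow> i \<noteq> j \<Longrightarrow> P (elem d i j a * A)"
  shows "P A"
proof -
  have "A \<in> elem_prods d" using assms(1) SL_elem_prods by blast
  then have "A \<in> carrier (SL d) \<and> P A"
  proof induction
    case (step A i j a)
    then show ?case using assms(3) SL_mult_closed[OF elem_SL] by blast
  qed (use assms(2) in auto)
  then show ?thesis by blast
qed

section \<open>Joint eigenvectors\<close>

lemma sum_mult_mat_vec_index:
  "A \<in> carrier_mat n m \<Longrightarrow> v \<in> carrier_vec m \<Longrightarrow> r < n \<Longrightarrow>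
    (A *\<^sub>v v) $ r = (\<Sum>s\<in>{0..<m}. A $$ (r,s) * v $ s)"
  by (simp add: scalar_prod_def)

text \<open>Applying \<open>A - \<chi> k\<close> to a relation removes the term of
  \<open>x k\<close> and multiplies the coefficient \<open>c i\<close> by
  \<open>\<chi> i - \<chi> k\<close>. The operator may depend on the pair \<open>i\<close>,
  \<open>k\<close>, so no single matrix has to separate all characters.\<close>

lemma eigenvectors_independent:
  fixes x :: "'i \<Rightarrow> int vec"
  assumes "finite I"
    and x: "\<And>i. i \<in> I \<Longrightarrow> x i \<in> carrier_vec n \<and> x i \<noteq> 0\<^sub>v n"
    and sep: "\<And>i k. i \<in> I \<Longrightarrow> k \<in> I \<Longrightarrow> i \<noteq> k \<Longrightarrow>
      \<exists>A \<in> carrier_mat n n. \<exists>\<chi>. (\<forall>m\<in>I. A *\<^sub>v x m = \<chi> m \<cdot>\<^sub>v x m) \<and> \<chi> i \<noteq> \<chi> k"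
    and "\<And>r. r < n \<Longrightarrow> (\<Sum>m\<in>I. c m * x m $ r) = 0"
  shows "\<forall>m\<in>I. c m = 0"
  using assms
proof (induction I arbitrary: c)
  case (insert k I)
  have c0: "\<forall>i\<in>I. c i = 0"
  proof
    fix i assume i: "i \<in> I"
    with insert.hyps have "i \<noteq> k" by blast
    with insert.prems(2)[of i k] i obtain A \<chi> where A: "A \<in> carrier_mat n n"
      and \<chi>: "\<And>m. m \<in> insert k I \<Longrightarrow> A *\<^sub>v x m = \<chi> m \<cdot>\<^sub>v x m" and ne: "\<chi> i \<noteq> \<chi> k" by auto
    have "\<forall>m\<in>I. c m * (\<chi> m - \<chi> k) = 0"
    proof (rule insert.IH)
      fix r assume r: "r < n"
      have eig: "(A *\<^sub>v x m) $ r = \<chi> m * x m $ r" if "m \<in> insert k I" for m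
        using \<chi>[OF that] insert.prems(1)[OF that] r by (metis carrier_vecD index_smult_vec(1))
      have "(\<Sum>m\<in>insert k I. c m * \<chi> m * x m $ r) = (\<Sum>m\<in>insert k I. c m * (A *\<^sub>v x m) $ r)"
        using eig by (intro sum.cong) auto
      also have "\<dots> = (\<Sum>m\<in>insert k I. \<Sum>s\<in>{0..<n}. A $$ (r,s) * (c m * x m $ s))"
        using insert.prems(1) r A
        by (intro sum.cong) (auto simp: sum_mult_mat_vec_index[OF A] sum_distrib_left mult_ac simp del: index_mult_mat_vec)
      also have "\<dots> = (\<Sum>s\<in>{0..<n}. A $$ (r,s) * (\<Sum>m\<in>insert k I. c m * x m $ s))"
        by (subst sum.swap) (simp only: sum_distrib_left)
      also have "\<dots> = 0"
        by (rule sum.neutral) (metis insert.prems(3) atLeastLessThan_iff mult_zero_right)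
      finally have *: "(\<Sum>m\<in>insert k I. c m * \<chi> m * x m $ r) = 0" .
      have "(\<Sum>m\<in>insert k I. c m * (\<chi> m - \<chi> k) * x m $ r)
          = (\<Sum>m\<in>insert k I. c m * \<chi> m * x m $ r) - \<chi> k * (\<Sum>m\<in>insert k I. c m * x m $ r)"
        by (simp only: sum_distrib_left sum_subtractf[symmetric]) (intro sum.cong refl, simp add: algebra_simps)
      also have "\<dots> = 0" using * insert.prems(3)[OF r] by (simp only: mult_zero_right diff_self)
      finally show "(\<Sum>m\<in>I. c m * (\<chi> m - \<chi> k) * x m $ r) = 0"
        using insert.hyps by simp
    next
      fix i' k' assume "i' \<in> I" "k' \<in> I" "i' \<noteq> k'"
      then show "\<exists>A \<in> carrier_mat n n. \<exists>\<chi>. (\<forall>m\<in>I. A *\<^sub>v x m = \<chi> m \<cdot>\<^sub>v x m) \<and> \<chi> i' \<noteq> \<chi> k'"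
        using insert.prems(2)[of i' k'] by blast
    qed (use insert.prems(1) in blast)
    then have "c i * (\<chi> i - \<chi> k) = 0" using i by (rule bspec)
    then show "c i = 0" using ne by simp
  qed
  obtain r where r: "r < n" "x k $ r \<noteq> 0"
    using insert.prems(1)[of k] by (metis carrier_vecD eq_vecI index_zero_vec insertI1)
  have "c k = 0" using insert.prems(3)[OF r(1)] insert.hyps c0 r(2) by simp
  with c0 show ?case by simp
qed simp

text \<open>The vectors are made the columns of a square matrix of size \<open>card I\<close> padded
  with zero rows. Row \<open>n\<close> is zero, so the determinant vanishes and there is an integral
  kernel vector.\<close>

lemma dependent_of_card_gt:
  fixes x :: "'i \<Rightarrow> int vec"
  assumes fin: "finite I" and gt: "card I > n"
  obtains c where "\<And>r. r < n \<Longrightarrow> (\<Sum>m\<in>I. c m * x m $ r) = 0" "\<exists>m\<in>I. c m \<noteq> 0"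
proof -
  let ?N = "card I"
  obtain h where h: "bij_betw h {0..<?N} I" using ex_bij_betw_nat_finite[OF fin] by blast
  let ?M = "mat ?N ?N (\<lambda>(r,c). if r < n then x (h c) $ r else 0)"
  have "det (transpose_mat ?M) = 0"
  proof (subst det_0_iff_vec_prod_zero)
    show "transpose_mat ?M \<in> carrier_mat ?N ?N" by auto
    have "transpose_mat ?M *\<^sub>v unit_vec ?N n = 0\<^sub>v ?N"
      using gt by (intro eq_vecI) (auto simp: scalar_prod_def intro!: sum.neutral)
    moreover have "unit_vec ?N n \<noteq> (0\<^sub>v ?N :: int vec)" using gt by auto
    ultimately show "\<exists>v. v \<in> carrier_vec ?N \<and> v \<noteq> 0\<^sub>v ?N \<and> transpose_mat ?M *\<^sub>v v = 0\<^sub>v ?N"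
      using unit_vec_carrier by blast
  qed
  then have "det ?M = 0" by (simp add: det_transpose[of _ ?N])
  then obtain v where v: "v \<in> carrier_vec ?N" "v \<noteq> 0\<^sub>v ?N" "?M *\<^sub>v v = 0\<^sub>v ?N"
    using det_0_iff_vec_prod_zero[of ?M ?N] by auto
  define c where "c m = v $ (inv_into {0..<?N} h m)" for m
  have v4_char: "c (h k) = v $ k" if "k < ?N" for k
    using bij_betw_inv_into_left[OF h, of k] that by (simp add: c_def)
  show thesis
  proof
    fix r assume r: "r < n"
    have "(\<Sum>m\<in>I. c m * x m $ r) = (\<Sum>k\<in>{0..<?N}. c (h k) * x (h k) $ r)"
      by (rule sum.reindex_bij_betw[OF h, symmetric])
    also have "\<dots> = (?M *\<^sub>v v) $ r"
      using r gt v(1) by (auto simp: scalar_prod_def v4_char mult.commute intro!: sum.cong)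
    finally show "(\<Sum>m\<in>I. c m * x m $ r) = 0" using v(3) r gt by simp
  next
    obtain k where "k < ?N" "v $ k \<noteq> 0"
      using v(1,2) by (metis carrier_vecD eq_vecI index_zero_vec)
    then show "\<exists>m\<in>I. c m \<noteq> 0" using v4_char h by (metis atLeastLessThan_iff bij_betwE le0)
  qed
qed

lemma vec_eq_uminus:
  fixes v :: "int vec"
  assumes "v \<in> carrier_vec n" "v = - v"
  shows "v = 0\<^sub>v n"
proof (rule eq_vecI)
  fix r assume "r < dim_vec (0\<^sub>v n :: int vec)"
  then have r: "r < n" by simp
  have "v $ r = (- v) $ r" using assms(2) by (rule arg_cong)
  also have "\<dots> = - (v $ r)" using assms(1) r by simp
  finally show "v $ r = 0\<^sub>v n $ r" using r by simp
qed (use assms(1) in simp)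

lemma det_columns_nonzero:
  fixes x :: "nat \<Rightarrow> int vec"
  assumes "\<And>c. (\<And>r. r < n \<Longrightarrow> (\<Sum>m<n. c m * x m $ r) = 0) \<Longrightarrow> \<forall>m<n. c m = 0"
  shows "det (mat n n (\<lambda>(r,c). x c $ r)) \<noteq> 0"
proof
  let ?Q = "mat n n (\<lambda>(r,c). x c $ r)"
  have Q: "?Q \<in> carrier_mat n n" by simp
  assume "det ?Q = 0"
  then obtain v where v: "v \<in> carrier_vec n" "v \<noteq> 0\<^sub>v n" "?Q *\<^sub>v v = 0\<^sub>v n"
    using det_0_iff_vec_prod_zero[OF Q] by blast
  have "(\<Sum>m<n. v $ m * x m $ r) = 0" if "r < n" for r
  proof -
    have "(?Q *\<^sub>v v) $ r = (\<Sum>m\<in>{0..<n}. ?Q $$ (r,m) * v $ m)"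
      by (rule sum_mult_mat_vec_index[OF Q v(1) that])
    also have "\<dots> = (\<Sum>m<n. v $ m * x m $ r)"
      using that by (intro sum.cong) (auto simp: mult.commute)
    finally show ?thesis using v(3) that by simp
  qed
  then have "\<forall>m<n. v $ m = 0" by (rule assms)
  then have "v = 0\<^sub>v n" using v(1) by (intro eq_vecI) auto
  then show False using v(2) by contradiction
qed

lemma index_avoiding:
  fixes d :: nat
  assumes "finite T" "card T < d"
  obtains m where "m < d" "m \<notin> T"
proof -
  have "\<not> {..<d} \<subseteq> T" using card_mono[OF assms(1), of "{..<d}"] assms(2) by auto
  then show thesis using that by auto
qed

lemma third_index:
  fixes d :: nat
  assumes "d \<ge> 3"
  obtains m where "m < d" "m \<noteq> i" "m \<noteq> j"
proof -
  have "card {i,j} \<le> 2" by (simp add: card_insert_le_m1)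
  then show thesis using index_avoiding[of "{i,j}" d] assms that by auto
qed

text \<open>Any ordered pair is reached from any other by changing one index at a time; reversing a
  pair needs a third index as a parking place.\<close>

lemma pair_transitive:
  fixes d :: nat
  assumes d: "d \<ge> 3" and ij: "i < d" "j < d" "i \<noteq> j" "P i j"
    and col: "\<And>i j k. i < d \<Longrightarrow> j < d \<Longrightarrow> k < d \<Longrightarrow> i \<noteq> j \<Longrightarrow> j \<noteq> k \<Longrightarrow> i \<noteq> k \<Longrightarrow> P i j \<Longrightarrow> P i k"
    and row: "\<And>i j k. i < d \<Longrightarrow> j < d \<Longrightarrow> k < d \<Longrightarrow> i \<noteq> j \<Longrightarrow> j \<noteq> k \<Longrightarrow> i \<noteq> k \<Longrightarrow> P i j \<Longrightarrow> P k j"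
    and kl: "k < d" "l < d" "k \<noteq> l"
  shows "P k l"
proof -
  obtain m where m: "m < d" "m \<noteq> i" "m \<noteq> j" by (rule third_index[OF d])
  have row_i: "P i n" if "n < d" "n \<noteq> i" for n
    using ij col[of i j n] that by (cases "n = j") auto
  have row_k: "P k n" if "k \<noteq> i" "n < d" "n \<noteq> i" "n \<noteq> k" for n
    using row[of i n k] row_i that ij(1) kl(1) by auto
  show ?thesis
  proof (cases "k = i \<or> l \<noteq> i")
    case True
    then show ?thesis using row_i[of l] row_k[of l] kl by (cases "k = i") auto
  next
    case False
    then have k: "k \<noteq> i" "l = i" by auto
    obtain n where n: "n < d" "n \<noteq> i" "n \<noteq> k" using m ij by metis
    then show ?thesis using row_k[of n] col[of k n i] k kl ij(1) by auto
  qed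
qed

declare SL_simps(1) [simp del]

lemma SL_carrier_mat: "A \<in> carrier (SL d) \<Longrightarrow> A \<in> carrier_mat d d"
  by (simp add: SL_simps(1))

section \<open>The action on integer vectors through a nontrivial endomorphism\<close>

locale sl_hom =
  fixes d :: nat and f :: "int mat \<Rightarrow> int mat"
  assumes d3: "d \<ge> 3" and hom: "f \<in> hom (SL d) (SL d)"
    and nontrivial: "\<exists>A \<in> carrier (SL d). f A \<noteq> 1\<^sub>m d"
begin

lemmas assoc_sq = assoc_mult_mat[of _ d d _ d _ d]
lemmas mult_sq = mult_carrier_mat[of _ d d _ d]
lemmas left_one_sq = left_mult_one_mat[of _ d d]
lemmas right_one_sq = right_mult_one_mat[of _ d d]

lemma f_SL: "A \<in> carrier (SL d) \<Longrightarrow> f A \<in> carrier (SL d)"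
  using hom by (rule hom_in_carrier)

lemma f_carrier [simp]: "A \<in> carrier (SL d) \<Longrightarrow> f A \<in> carrier_mat d d"
  using f_SL by (auto simp: SL_simps(1))

lemma f_mult: "A \<in> carrier (SL d) \<Longrightarrow> B \<in> carrier (SL d) \<Longrightarrow> f (A * B) = f A * f B"
  using hom_mult[OF hom] by simp

lemma one_SL: "1\<^sub>m d \<in> carrier (SL d)"
  by (simp add: SL_simps(1))

lemma f_one: "f (1\<^sub>m d) = 1\<^sub>m d"
  using hom_one[OF hom group_SL group_SL] by simp

definition act :: "int mat \<Rightarrow> int vec \<Rightarrow> int vec" where
  "act A v = f A *\<^sub>v v"

lemma act_carrier: "A \<in> carrier (SL d) \<Longrightarrow> act A v \<in> carrier_vec d"
  unfolding act_def using carrier_matD(1)[OF f_carrier[of A]] by (intro carrier_vecI) auto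

lemma act_mult:
  "A \<in> carrier (SL d) \<Longrightarrow> B \<in> carrier (SL d) \<Longrightarrow> v \<in> carrier_vec d \<Longrightarrow> act (A * B) v = act A (act B v)"
  unfolding act_def by (simp only: f_mult) (rule assoc_mult_mat_vec[OF f_carrier f_carrier])

lemma act_one: "v \<in> carrier_vec d \<Longrightarrow> act (1\<^sub>m d) v = v"
  by (simp add: act_def f_one)

lemma act_add: "A \<in> carrier (SL d) \<Longrightarrow> v \<in> carrier_vec d \<Longrightarrow> w \<in> carrier_vec d \<Longrightarrow>
    act A (v + w) = act A v + act A w"
  unfolding act_def by (rule mult_add_distrib_mat_vec[OF f_carrier])

lemma act_smult: "A \<in> carrier (SL d) \<Longrightarrow> v \<in> carrier_vec d \<Longrightarrow> act A (k \<cdot>\<^sub>v v) = k \<cdot>\<^sub>v act A v"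
  unfolding act_def using carrier_matD[OF f_carrier[of A]]
  by (intro eq_vecI) (auto simp: scalar_prod_def sum_distrib_left algebra_simps)

lemma act_uminus:
  assumes "A \<in> carrier (SL d)" "v \<in> carrier_vec d"
  shows "act A (- v) = - act A v"
proof -
  have "- w = (-1) \<cdot>\<^sub>v w" for w :: "int vec" by (intro eq_vecI) auto
  then show ?thesis using act_smult[OF assms] by simp
qed

lemma act_rel:
  assumes "A * B = C * D" "A \<in> carrier (SL d)" "B \<in> carrier (SL d)" "C \<in> carrier (SL d)"
    "D \<in> carrier (SL d)" "v \<in> carrier_vec d"
  shows "act A (act B v) = act C (act D v)"
  using assms act_mult by metis

lemma act_nonzero:
  assumes "A \<in> carrier (SL d)" "v \<in> carrier_vec d" "v \<noteq> 0\<^sub>v d"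
  shows "act A v \<noteq> 0\<^sub>v d"
proof
  assume 0: "act A v = 0\<^sub>v d"
  note B = SL_inverse_exists[OF assms(1)]
  have "v = act (adj_mat A) (act A v)"
    using act_mult[OF B(1) assms(1,2)] act_one[OF assms(2)] B(2) by simp
  also have "\<dots> = 0\<^sub>v d" unfolding 0 using f_carrier[OF B(1)] by (auto simp: act_def intro!: eq_vecI)
  finally show False using assms(3) by contradiction
qed

lemma f_ne_oneE:
  assumes "A \<in> carrier (SL d)" "f A \<noteq> 1\<^sub>m d"
  obtains v where "v \<in> carrier_vec d" "act A v \<noteq> v"
proof -
  have "\<exists>v \<in> carrier_vec d. act A v \<noteq> v"
  proof (rule ccontr)
    assume "\<not> ?thesis"
    then have *: "f A *\<^sub>v v = v" if "v \<in> carrier_vec d" for v using that by (auto simp: act_def)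
    have "f A = 1\<^sub>m d"
    proof (rule mat_col_eqI)
      fix i assume "i < dim_col (1\<^sub>m d :: int mat)"
      then have i: "i < d" by simp
      have "col (f A) i = f A *\<^sub>v unit_vec d i"
        using col_mult2[OF f_carrier[OF assms(1)] one_carrier_mat i] f_carrier[OF assms(1)] i by simp
      then show "col (f A) i = col (1\<^sub>m d) i" using *[of "unit_vec d i"] i by simp
    qed (use f_carrier[OF assms(1)] in auto)
    then show False using assms(2) by simp
  qed
  then show thesis using that by blast
qed

text \<open>Either \<open>v + A v\<close> is a nonzero vector fixed by \<open>A\<close>, or it
  vanishes and \<open>A v = - v\<close>. Commutativity keeps the signs already found for
  \<open>L\<close>. The set \<open>U\<close> needs closure under addition only; it will be an
  eigenspace of a further matrix.\<close>

lemma joint_eigenvector: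
  assumes "finite L"
    and "L \<subseteq> carrier (SL d)" "U \<subseteq> carrier_vec d"
    and Uadd: "\<And>v w. v \<in> U \<Longrightarrow> w \<in> U \<Longrightarrow> v + w \<in> U"
    and "\<And>A v. A \<in> L \<Longrightarrow> v \<in> U \<Longrightarrow> act A v \<in> U \<and> act A (act A v) = v"
    and "\<And>A B v. A \<in> L \<Longrightarrow> B \<in> L \<Longrightarrow> v \<in> U \<Longrightarrow> act A (act B v) = act B (act A v)"
    and w: "w \<in> U" "w \<noteq> 0\<^sub>v d"
  shows "\<exists>v\<in>U. v \<noteq> 0\<^sub>v d \<and> (\<forall>A\<in>L. act A v = v \<or> act A v = - v)"
  using assms(1,2,5,6)
proof (induction L)
  case (insert A L)
  from insert.IH insert.prems obtain v where v: "v \<in> U" "v \<noteq> 0\<^sub>v d"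
    and e: "\<And>B. B \<in> L \<Longrightarrow> act B v = v \<or> act B v = - v" by auto
  have A: "act A v \<in> U" "act A (act A v) = v" using insert.prems(2)[of A v] v(1) by auto
  have SA: "A \<in> carrier (SL d)" using insert.prems by blast
  have vc: "v \<in> carrier_vec d" "act A v \<in> carrier_vec d" using v A assms(3) by auto
  show ?case
  proof (cases "v + act A v = 0\<^sub>v d")
    case True
    then have "act A v = - v" using vc
      by (intro eq_vecI) (use True in \<open>auto simp: vec_eq_iff\<close>)
    then show ?thesis using v e by blast
  next
    case False
    have "act A (v + act A v) = v + act A v"
      using act_add[OF SA vc] A vc by (simp add: comm_add_vec[of _ d])
    moreover have "act B (v + act A v) = v + act A v \<or> act B (v + act A v) = - (v + act A v)" if "B \<in> L" for B
    proof -
      have SB: "B \<in> carrier (SL d)" using insert.prems that by blast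
      have "act B (v + act A v) = act B v + act A (act B v)"
        using act_add[OF SB vc] insert.prems(3)[of B A v] that v by simp
      moreover have "act A (- v) = - act A v"
        by (rule act_uminus[OF SA vc(1)])
      moreover have "- v + - act A v = - (v + act A v)" using vc by (intro eq_vecI) auto
      ultimately show ?thesis using e[OF that] by metis
    qed
    ultimately show ?thesis using False v A Uadd by (intro bexI[of _ "v + act A v"]) auto
  qed
qed (use w in auto)

end

section \<open>Integral intertwiners\<close>

lemma mult_mat_index:
  "A \<in> carrier_mat n m \<Longrightarrow> B \<in> carrier_mat m k \<Longrightarrow> i < n \<Longrightarrow> j < k \<Longrightarrow>
    (A * B) $$ (i,j) = (\<Sum>s\<in>{0..<m}. A $$ (i,s) * B $$ (s,j))"
  by (simp add: scalar_prod_def)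

context sl_hom
begin

lemma f_rel:
  assumes "A * B = C * D" "A \<in> carrier (SL d)" "B \<in> carrier (SL d)" "C \<in> carrier (SL d)" "D \<in> carrier (SL d)"
  shows "f A * f B = f C * f D"
  using assms f_mult by metis

lemma f_left_cancel:
  assumes "f A * M = M" "A \<in> carrier (SL d)" "M \<in> carrier (SL d)"
  shows "f A = 1\<^sub>m d"
proof -
  note M = SL_inverse_exists[OF assms(3)]
  have c: "M \<in> carrier_mat d d" "adj_mat M \<in> carrier_mat d d" using assms(3) M(1) by (auto simp: SL_simps(1))
  have "f A = f A * (M * adj_mat M)" using M f_carrier[OF assms(2)] by simp
  also have "\<dots> = (f A * M) * adj_mat M" using f_carrier[OF assms(2)] c by (intro assoc_mult_mat[symmetric])
  also have "\<dots> = 1\<^sub>m d" using assms(1) M by simp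
  finally show ?thesis .
qed

text \<open>The kernel is normal: by the commutator relation one elementary matrix in it drags in
  all of them, and these generate the group.\<close>

lemma elem_nontrivial:
  assumes ij: "i < d" "j < d" "i \<noteq> j"
  shows "f (elem d i j 1) \<noteq> 1\<^sub>m d"
proof
  assume 1: "f (elem d i j 1) = 1\<^sub>m d"
  let ?P = "\<lambda>i j. \<forall>b. f (elem d i j b) = 1\<^sub>m d"
  have col: "f (elem d i k b) = 1\<^sub>m d"
    if "f (elem d i j 1) = 1\<^sub>m d" "i < d" "j < d" "k < d" "i \<noteq> j" "j \<noteq> k" "i \<noteq> k" for i j k b
  proof -
    have "f (elem d i j 1) * f (elem d j k b) = f (elem d i k b) * f (elem d j k b * elem d i j 1)"
      using that elem_commutator[of i d j k 1 b] by (intro f_rel SL_mult_closed elem_SL) auto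
    moreover have "f (elem d j k b * elem d i j 1) = f (elem d j k b)"
      using that f_mult[of "elem d j k b" "elem d i j 1"] by (simp add: right_one_sq)
    ultimately have "f (elem d i k b) * f (elem d j k b) = f (elem d j k b)"
      using that by (simp add: left_one_sq right_one_sq)
    then show ?thesis by (rule f_left_cancel) (use that f_SL in auto)
  qed
  have row: "f (elem d k j b) = 1\<^sub>m d"
    if "f (elem d i j 1) = 1\<^sub>m d" "i < d" "j < d" "k < d" "i \<noteq> j" "j \<noteq> k" "i \<noteq> k" for i j k b
  proof -
    have "f (elem d k i b) * f (elem d i j 1) = f (elem d k j b) * f (elem d i j 1 * elem d k i b)"
      using that elem_commutator[of k d i j b 1] by (intro f_rel SL_mult_closed elem_SL) auto
    moreover have "f (elem d i j 1 * elem d k i b) = f (elem d k i b)"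
      using that f_mult[of "elem d i j 1" "elem d k i b"] by (simp add: left_one_sq)
    ultimately have "f (elem d k j b) * f (elem d k i b) = f (elem d k i b)"
      using that by (simp add: left_one_sq right_one_sq)
    then show ?thesis by (rule f_left_cancel) (use that f_SL in auto)
  qed
  obtain k where k: "k < d" "k \<noteq> i" "k \<noteq> j" by (rule third_index[OF d3])
  \<comment> \<open>The commutator relation passes from the parameter 1 to every \<open>b\<close>,
    but it changes an index on the way. So the starting pair for transitivity is
    \<open>(i,k)\<close> rather than \<open>(i,j)\<close>.\<close>
  have Pik: "?P i k" using col[OF 1 ij(1,2) k(1)] ij k by auto
  have all: "?P m l" if "m < d" "l < d" "m \<noteq> l" for m l
  proof (rule pair_transitive[OF d3 ij(1) k(1), of ?P])
    show "?P i k" by (rule Pik)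
    show "?P i k" if "i < d" "j < d" "k < d" "i \<noteq> j" "j \<noteq> k" "i \<noteq> k" "?P i j" for i j k
      using col[OF spec[OF that(7)] that(1-6)] by blast
    show "?P k j" if "i < d" "j < d" "k < d" "i \<noteq> j" "j \<noteq> k" "i \<noteq> k" "?P i j" for i j k
      using row[OF spec[OF that(7)] that(1-6)] by blast
  qed (use k that in auto)
  have "f A = 1\<^sub>m d" if "A \<in> carrier (SL d)" for A
    using that
  proof (induction rule: SL_elem_induct)
    case (step A i j a)
    then show ?case using all f_mult[of "elem d i j a" A] by simp
  qed (rule f_one)
  then show False using nontrivial by blast
qed

lemma f_elem_intertwine:
  assumes Q: "Q \<in> carrier_mat d d"
    and e: "f (elem d i j 1) * Q = Q * elem d i j 1"
    and ij: "i < d" "j < d" "i \<noteq> j"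
  shows "f (elem d i j a) * Q = Q * elem d i j a"
proof -
  have fc: "f (elem d i j b) \<in> carrier_mat d d" for b using ij by simp
  have split: "f (elem d i j (a + b)) * Q = f (elem d i j a) * (f (elem d i j b) * Q)" for a b
    using f_mult[of "elem d i j a" "elem d i j b"] ij elem_add[of i d j a b] Q fc
    by (simp add: assoc_sq)
  have splitQ: "Q * elem d i j (a + b) = (Q * elem d i j a) * elem d i j b" for a b
    using elem_add[of i d j a b] ij Q by (simp add: assoc_sq)
  have el0: "elem d i j 0 = 1\<^sub>m d" by (intro eq_matI) auto
  have comp: "f (elem d i j (a + b)) * Q = Q * elem d i j (a + b)"
    if "f (elem d i j a) * Q = Q * elem d i j a" "f (elem d i j b) * Q = Q * elem d i j b" for a b
  proof -
    have "f (elem d i j (a + b)) * Q = f (elem d i j a) * (Q * elem d i j b)" unfolding split that(2) ..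
    also have "\<dots> = (f (elem d i j a) * Q) * elem d i j b"
      using Q fc by (simp add: assoc_sq)
    finally show ?thesis unfolding that(1) splitQ .
  qed
  have m1: "f (elem d i j (-1)) * Q = Q * elem d i j (-1)"
  proof -
    have "Q * elem d i j (-1) = f (elem d i j (-1)) * (f (elem d i j 1) * Q) * elem d i j (-1)"
      using split[of "-1" 1] Q by (simp add: el0 f_one)
    also have "\<dots> = f (elem d i j (-1)) * (Q * elem d i j 1 * elem d i j (-1))"
      unfolding e using Q fc by (simp add: assoc_sq mult_sq)
    also have "\<dots> = f (elem d i j (-1)) * Q"
      using splitQ[of 1 "-1"] Q by (simp add: el0)
    finally show ?thesis by simp
  qed
  show ?thesis
  proof (induction a rule: int_induct[where k = 0])
    case base
    then show ?case using Q by (simp add: el0 f_one)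
  next
    case (step1 i)
    then show ?case using comp e by blast
  next
    case (step2 i)
    then show ?case using comp[OF _ m1] by simp
  qed
qed

lemma f_intertwine:
  assumes Q: "Q \<in> carrier_mat d d"
    and e: "\<And>i j. i < d \<Longrightarrow> j < d \<Longrightarrow> i \<noteq> j \<Longrightarrow> f (elem d i j 1) * Q = Q * elem d i j 1"
    and A: "A \<in> carrier (SL d)"
  shows "f A * Q = Q * A"
  using A
proof (induction rule: SL_elem_induct)
  case one
  then show ?case using Q by (simp add: f_one)
next
  case (step A i j a)
  have A: "A \<in> carrier_mat d d" "f A \<in> carrier_mat d d" "f (elem d i j a) \<in> carrier_mat d d"
    using step SL_carrier_mat by auto
  have "f (elem d i j a * A) * Q = f (elem d i j a) * (f A * Q)"
    using step Q A f_mult[of "elem d i j a" A] by (simp add: assoc_sq)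
  also have "\<dots> = (f (elem d i j a) * Q) * A"
    unfolding step(5) using Q A by (simp add: assoc_sq)
  also have "\<dots> = Q * (elem d i j a * A)"
    using f_elem_intertwine[OF Q e[OF step(2-4)] step(2-4)] Q A by (simp add: assoc_sq)
  finally show ?case .
qed

end

section \<open>From a rational intertwiner to a unimodular one\<close>

lemma gcd_normalize_mat:
  fixes Q :: "int mat"
  assumes Q: "Q \<in> carrier_mat n n" and nz: "det Q \<noteq> 0"
    and n: "n > 0"
  obtains g R where "R \<in> carrier_mat n n" "Q = g \<cdot>\<^sub>m R" "g \<noteq> 0" "det R \<noteq> 0"
    "\<And>c. (\<And>i j. i < n \<Longrightarrow> j < n \<Longrightarrow> c dvd R $$ (i,j)) \<Longrightarrow> c dvd 1"
proof -
  let ?S = "{Q $$ (i,j) | i j. i < n \<and> j < n}"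
  let ?g = "Gcd ?S"
  let ?R = "mat n n (\<lambda>(i,j). Q $$ (i,j) div ?g)"
  have g: "?g dvd Q $$ (i,j)" if "i < n" "j < n" for i j using that by (intro Gcd_dvd) auto
  have QR: "Q = ?g \<cdot>\<^sub>m ?R" using Q g by (intro eq_matI) auto
  have "det (?g \<cdot>\<^sub>m ?R) = ?g ^ n * det ?R" by simp
  then have "det Q = ?g ^ n * det ?R" using QR by (simp only:)
  with nz n have d: "?g \<noteq> 0" "det ?R \<noteq> 0" by (auto simp: zero_power)
  have "c dvd 1" if c: "\<And>i j. i < n \<Longrightarrow> j < n \<Longrightarrow> c dvd ?R $$ (i,j)" for c
  proof -
    have "?g * c dvd ?g"
    proof (rule Gcd_greatest)
      fix x assume "x \<in> ?S"
      then obtain i j where ij: "i < n" "j < n" and x: "x = Q $$ (i,j)" by blast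
      have "x = ?g * ?R $$ (i,j)" using g[OF ij] ij x by simp
      moreover have "?g * c dvd ?g * ?R $$ (i,j)" using c[OF ij] by (intro mult_dvd_mono dvd_refl)
      ultimately show "?g * c dvd x" by (simp only:)
    qed
    then have "?g * c dvd ?g * 1" by (simp only: mult_1_right)
    then show ?thesis using d(1) unfolding dvd_mult_cancel_left by blast
  qed
  then show thesis using that[OF _ QR d] by auto
qed

text \<open>After division by \<open>gcd D a\<close>, the cofactor of \<open>D\<close> is coprime to
  that of \<open>a\<close>, hence divides every member of \<open>S\<close> and is a unit.\<close>

lemma dvd_of_dvd_mult_primitive:
  fixes D a :: int
  assumes "D \<noteq> 0" and "\<And>x. x \<in> S \<Longrightarrow> D dvd x * a" and "\<And>c. (\<And>x. x \<in> S \<Longrightarrow> c dvd x) \<Longrightarrow> c dvd 1"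
  shows "D dvd a"
proof -
  obtain D' a' where da: "D = gcd D a * D'" "a = gcd D a * a'" "coprime D' a'"
    using gcd_coprime_exists[of D a] assms(1) by (metis gcd_eq_0_iff mult.commute)
  have g: "gcd D a \<noteq> 0" using assms(1) by simp
  have "D' dvd x" if "x \<in> S" for x
  proof -
    have "gcd D a * D' dvd gcd D a * (x * a')"
      using assms(2)[OF that] da by (metis mult.left_commute)
    then have "D' dvd x * a'" unfolding dvd_mult_cancel_left using g by blast
    then show ?thesis using da(3) by (simp add: coprime_dvd_mult_left_iff)
  qed
  then have "D' dvd 1" by (rule assms(3))
  then have "D dvd gcd D a" using da(1) by (metis mult.right_neutral mult_dvd_mono dvd_refl)
  then show ?thesis using dvd_trans gcd_dvd2 by blast
qed

context sl_hom
begin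

lemma mult_elem_index:
  assumes "Q \<in> carrier_mat d d" "i < d" "j < d" "r < d" "c < d" "i \<noteq> j"
  shows "(Q * elem d i j a) $$ (r,c) = Q $$ (r,c) + (if c = j then a * Q $$ (r,i) else 0)"
proof -
  have "(Q * elem d i j a) $$ (r,c) = (\<Sum>k\<in>{0..<d}. Q $$ (r,k) * elem d i j a $$ (k,c))"
    using assms by (simp add: scalar_prod_def)
  also have "\<dots> = (\<Sum>k\<in>{0..<d}. (if k = c then Q $$ (r,c) else 0) + (if k = i then (if c = j then a * Q $$ (r,i) else 0) else 0))"
    by (rule sum.cong) (use assms in \<open>auto simp: algebra_simps\<close>)
  also have "\<dots> = Q $$ (r,c) + (if c = j then a * Q $$ (r,i) else 0)"
    using assms by (simp add: sum.distrib)
  finally show ?thesis .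
qed

text \<open>For the primitive multiple \<open>R\<close> of \<open>Q\<close>, each
  \<open>R E R^(-1)\<close> with \<open>E\<close> a matrix unit is integral, because it is a
  polynomial in the integral matrices \<open>f A\<close>. Multiplying by \<open>det R\<close> shows
  that \<open>det R\<close> divides all products of an entry of \<open>R\<close> and an entry of
  \<open>adj_mat R\<close>. Primitivity of \<open>R\<close> then gives \<open>det R\<close> dividing
  \<open>adj_mat R\<close>, so that the inverse of \<open>R\<close> is integral.\<close>

lemma GL_conj_of_intertwiner:
  assumes Q: "Q \<in> carrier_mat d d" "det Q \<noteq> 0"
    and e: "\<And>i j. i < d \<Longrightarrow> j < d \<Longrightarrow> i \<noteq> j \<Longrightarrow> f (elem d i j 1) * Q = Q * elem d i j 1"
  shows "\<exists>P \<in> carrier (GL d). \<forall>A \<in> carrier (SL d). f A = GL_conj d P A"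
proof -
  obtain g R where R: "R \<in> carrier_mat d d" "det R \<noteq> 0"
    and QR: "Q = g \<cdot>\<^sub>m R" "g \<noteq> 0"
    and prim: "\<And>c. (\<And>i j. i < d \<Longrightarrow> j < d \<Longrightarrow> c dvd R $$ (i,j)) \<Longrightarrow> c dvd 1"
    using gcd_normalize_mat[OF Q] d3 by (metis (no_types, lifting) gr0I not_numeral_le_zero)
  have fR: "f A * R = R * A" if A: "A \<in> carrier (SL d)" for A
  proof (rule eq_matI)
    have c: "A \<in> carrier_mat d d" "f A \<in> carrier_mat d d" using A SL_carrier_mat by auto
    fix r s assume "r < dim_row (R * A)" "s < dim_col (R * A)"
    then have rs: "r < d" "s < d" using c R by auto
    have "g \<cdot>\<^sub>m (f A * R) = f A * Q" unfolding QR using c R by (simp add: mult_smult_distrib[of _ d d _ d])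
    also have "\<dots> = Q * A" by (rule f_intertwine[OF Q(1) e A])
    also have "\<dots> = g \<cdot>\<^sub>m (R * A)" unfolding QR using c R by (simp add: mult_smult_assoc_mat[of _ d d _ d])
    finally have "(g \<cdot>\<^sub>m (f A * R)) $$ (r,s) = (g \<cdot>\<^sub>m (R * A)) $$ (r,s)" by simp
    moreover have "(g \<cdot>\<^sub>m M) $$ (r,s) = g * M $$ (r,s)" if "M \<in> carrier_mat d d" for M
      using that rs by auto
    ultimately have "g * (f A * R) $$ (r,s) = g * (R * A) $$ (r,s)"
      using mult_carrier_mat[OF c(2) R(1)] mult_carrier_mat[OF R(1) c(1)] by metis
    then show "(f A * R) $$ (r,s) = (R * A) $$ (r,s)" using QR(2) by simp
  qed (use A R SL_carrier_mat[OF A] carrier_matD[OF f_carrier[OF A]] in auto)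
  let ?D = "det R" and ?J = "adj_mat R"
  have J: "?J \<in> carrier_mat d d" "R * ?J = ?D \<cdot>\<^sub>m 1\<^sub>m d" "?J * R = ?D \<cdot>\<^sub>m 1\<^sub>m d"
    using adj_mat[OF R(1)] by auto
  \<comment> \<open>For \<open>N = f(e\<^sub>i\<^sub>j) - 1\<close> one has \<open>N R = R E\<^sub>i\<^sub>j\<close>, hence \<open>(det R) N = R E\<^sub>i\<^sub>j adj R\<close>.\<close>
  have base: "?D dvd R $$ (k,i) * ?J $$ (j,l)"
    if N: "N \<in> carrier_mat d d" and "i < d" "j < d" "k < d" "l < d"
      and NR: "\<And>r s. r < d \<Longrightarrow> s < d \<Longrightarrow> (N * R) $$ (r,s) = (if s = j then R $$ (r,i) else 0)" for N i j k l
  proof -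
    have "N * (R * ?J) = N * R * ?J" using N R J by (intro assoc_mult_mat[symmetric]) auto
    then have "?D \<cdot>\<^sub>m N = N * R * ?J"
      using J N that by (simp add: mult_smult_distrib[of _ d d _ d])
    moreover have "(?D \<cdot>\<^sub>m N) $$ (k,l) = ?D * N $$ (k,l)" using N that by simp
    ultimately have "?D * N $$ (k,l) = (N * R * ?J) $$ (k,l)" by (simp only:)
    also have "\<dots> = (\<Sum>s\<in>{0..<d}. (N * R) $$ (k,s) * ?J $$ (s,l))"
      by (rule mult_mat_index[OF mult_carrier_mat[OF N R(1)] J(1) that(4,5)])
    also have "\<dots> = (\<Sum>s\<in>{j}. (N * R) $$ (k,s) * ?J $$ (s,l))"
      by (rule sum.mono_neutral_right) (use that in \<open>auto simp del: index_mult_mat\<close>)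
    also have "\<dots> = R $$ (k,i) * ?J $$ (j,l)" using that by (simp del: index_mult_mat)
    finally show ?thesis by (metis dvd_triv_left)
  qed
  let ?N = "\<lambda>i j. f (elem d i j 1) - 1\<^sub>m d"
  have N: "?N i j \<in> carrier_mat d d" if "i \<noteq> j" for i j using that by (intro minus_carrier_mat) simp
  have NR: "(?N i j * R) $$ (r,s) = (if s = j then R $$ (r,i) else 0)"
    if "i \<noteq> j" "i < d" "j < d" "r < d" "s < d" for i j r s
  proof -
    have "?N i j * R = f (elem d i j 1) * R - R"
      using R that by (simp add: minus_mult_distrib_mat[of _ d d _ _ d])
    also have "\<dots> = R * elem d i j 1 - R" using fR[of "elem d i j 1"] that by simp
    finally show ?thesis using mult_elem_index[OF R(1) that(2-5) that(1), of 1] that R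
      by (simp del: index_mult_mat add: index_mult_mat(2,3))
  qed
  have dvd: "?D dvd R $$ (k,i) * ?J $$ (j,l)" if "i < d" "j < d" "k < d" "l < d" for i j k l
  proof (cases "i = j")
    case False
    then show ?thesis using base[OF N[OF False] that NR] that by blast
  next
    case True
    \<comment> \<open>No \<open>f(e_ij) - 1\<close> corresponds to a diagonal matrix unit, but
      \<open>E_ii = E_im E_mi\<close> does come from a product of two of them.\<close>
    obtain m where m: "m < d" "m \<noteq> i"
      using d3 that[of "if i = 0 then 1 else 0"] by auto
    have "(?N i m * ?N m i * R) $$ (r,s) = (if s = j then R $$ (r,i) else 0)" if rs: "r < d" "s < d" for r s
    proof -
      have "?N i m * ?N m i * R = ?N i m * (?N m i * R)"
        using N m R by (intro assoc_mult_mat) auto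
      also have "?N m i * R = mat d d (\<lambda>(r,s). if s = i then R $$ (r,m) else 0)"
        using NR[of m i] m R \<open>i < d\<close> N[of m i] by (intro eq_matI) (auto simp del: index_mult_mat simp: index_mult_mat(2,3))
      also have "(?N i m * \<dots>) $$ (r,s) = (if s = i then (?N i m * R) $$ (r,m) else 0)"
        unfolding mult_mat_index[OF N[OF m(2)[symmetric]] mat_carrier rs]
          mult_mat_index[OF N[OF m(2)[symmetric]] R(1) rs(1) m(1)]
        using rs by simp
      finally show ?thesis using NR[of i m r m] m rs \<open>i < d\<close> True by (simp del: index_mult_mat)
    qed
    then show ?thesis
      using base[of "?N i m * ?N m i" i j k l] that N m by (simp del: index_mult_mat add: mult_sq)
  qed
  have J_dvd: "?D dvd ?J $$ (j,l)" if "j < d" "l < d" for j l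
    by (rule dvd_of_dvd_mult_primitive[OF R(2), where S = "{R $$ (k,i) | k i. k < d \<and> i < d}"])
      (use dvd that prim in blast)+
  let ?K = "mat d d (\<lambda>(j,l). ?J $$ (j,l) div ?D)"
  have JK: "?J = ?D \<cdot>\<^sub>m ?K" using J_dvd J(1) by (intro eq_matI) auto
  have K: "?K \<in> carrier_mat d d" by simp
  have smult_cancel: "M = 1\<^sub>m d" if M: "M \<in> carrier_mat d d" "?D \<cdot>\<^sub>m M = ?D \<cdot>\<^sub>m 1\<^sub>m d" for M
  proof (rule eq_matI)
    fix r s assume "r < dim_row (1\<^sub>m d :: int mat)" "s < dim_col (1\<^sub>m d :: int mat)"
    then have rs: "r < d" "s < d" by auto
    have "(?D \<cdot>\<^sub>m M) $$ (r,s) = (?D \<cdot>\<^sub>m 1\<^sub>m d) $$ (r,s)" using M(2) by simp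
    then show "M $$ (r,s) = 1\<^sub>m d $$ (r,s)" using rs M(1) R(2) by simp
  qed (use M in auto)
  have RK: "R * ?K = 1\<^sub>m d"
    by (rule smult_cancel) (use R J JK mult_smult_distrib[OF R(1) K, of ?D] in auto)
  have KR: "?K * R = 1\<^sub>m d"
    by (rule smult_cancel) (use R J JK mult_smult_assoc_mat[OF K R(1), of ?D] in auto)
  have RG: "R \<in> carrier (GL d)" and KG: "?K \<in> carrier (GL d)"
    using R K RK KR by (auto simp: carrier_GL)
  interpret G: group "GL d" by (rule group_GL)
  have inv: "inv\<^bsub>GL d\<^esub> R = ?K" using G.inv_equality[OF _ RG KG] KR by simp
  have "f A = GL_conj d R A" if A: "A \<in> carrier (SL d)" for A
  proof -
    have c: "A \<in> carrier_mat d d" "f A \<in> carrier_mat d d" using A SL_carrier_mat by auto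
    have "f A = f A * (R * ?K)" using c RK by simp
    also have "\<dots> = f A * R * ?K" using c R K by (intro assoc_mult_mat[symmetric])
    finally show ?thesis unfolding GL_conj_def inv fR[OF A] .
  qed
  then show ?thesis using RG by blast
qed

end

section \<open>Weights of the diagonal sign matrices\<close>

lemma sgn_on_image_transpose: "sgn_on (transpose i j ` S) k = sgn_on S (transpose i j k)"
proof -
  have "k \<in> transpose i j ` S \<longleftrightarrow> transpose i j k \<in> S"
    by (metis image_iff transpose_involutory)
  then show ?thesis by (simp add: sgn_on_def)
qed

lemma flip_commute: "flip d i j = flip d j i"
  by (simp add: flip_def insert_commute)

text \<open>For \<open>d = 3\<close> both sides equal 4, which is why that dimension gets its own
  argument.\<close>

lemma pow_gt: "d \<ge> 4 \<Longrightarrow> d + 1 < 2 ^ (d - 1)" for d :: nat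
proof (induction d rule: dec_induct)
  case (step n)
  then have "(2::nat) ^ (Suc n - 1) = 2 * 2 ^ (n - 1)" by (cases n) auto
  then show ?case using step by linarith
qed simp

text \<open>With \<open>k = a + 2\<close> and \<open>d - k = b + 2\<close> the difference of the two
  sides is \<open>a * b + a + b\<close>. It vanishes only for \<open>d = 4\<close>,
  \<open>k = 2\<close>, the exceptional weights indexed by pairs.\<close>

lemma mult_diff_gt:
  fixes k d :: nat
  assumes "2 \<le> k" "k + 2 \<le> d" "5 \<le> d"
  shows "d < k * (d - k)"
proof -
  define a b where "a = k - 2" and "b = d - k - 2"
  then have ab: "k = a + 2" "d = a + b + 4" using assms by auto
  have "k * (d - k) = a * b + 2 * a + 2 * b + 4" unfolding ab by (simp add: algebra_simps)
  moreover have "a + b \<ge> 1" using ab assms(3) by simp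
  ultimately show ?thesis using ab(2) by linarith
qed

context sl_hom
begin

lemma act_independent:
  assumes "finite I"
    and "\<And>i. i \<in> I \<Longrightarrow> x i \<in> carrier_vec d \<and> x i \<noteq> 0\<^sub>v d"
    and sep: "\<And>i k. i \<in> I \<Longrightarrow> k \<in> I \<Longrightarrow> i \<noteq> k \<Longrightarrow>
      \<exists>A \<in> carrier (SL d). \<exists>\<chi>. (\<forall>m\<in>I. act A (x m) = \<chi> m \<cdot>\<^sub>v x m) \<and> \<chi> i \<noteq> \<chi> k"
    and "\<And>r. r < d \<Longrightarrow> (\<Sum>m\<in>I. c m * x m $ r) = 0"
  shows "\<forall>m\<in>I. c m = 0"
proof (rule eigenvectors_independent[OF assms(1,2) _ assms(4)])
  fix i k assume "i \<in> I" "k \<in> I" "i \<noteq> k"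
  from sep[OF this] obtain A \<chi> where "A \<in> carrier (SL d)"
    "\<forall>m\<in>I. f A *\<^sub>v x m = \<chi> m \<cdot>\<^sub>v x m" "\<chi> i \<noteq> \<chi> k" by (auto simp: act_def)
  then show "\<exists>A \<in> carrier_mat d d. \<exists>\<chi>. (\<forall>m\<in>I. A *\<^sub>v x m = \<chi> m \<cdot>\<^sub>v x m) \<and> \<chi> i \<noteq> \<chi> k"
    using f_carrier by blast
qed

lemma act_card_le:
  assumes "finite I"
    and "\<And>i. i \<in> I \<Longrightarrow> x i \<in> carrier_vec d \<and> x i \<noteq> 0\<^sub>v d"
    and sep: "\<And>i k. i \<in> I \<Longrightarrow> k \<in> I \<Longrightarrow> i \<noteq> k \<Longrightarrow>
      \<exists>A \<in> carrier (SL d). \<exists>\<chi>. (\<forall>m\<in>I. act A (x m) = \<chi> m \<cdot>\<^sub>v x m) \<and> \<chi> i \<noteq> \<chi> k"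
  shows "card I \<le> d"
proof (rule ccontr)
  assume "\<not> ?thesis"
  then have "card I > d" by simp
  from dependent_of_card_gt[OF assms(1) this, of x] obtain c where
    c: "\<And>r. r < d \<Longrightarrow> (\<Sum>m\<in>I. c m * x m $ r) = 0" "\<exists>m\<in>I. c m \<noteq> 0" by blast
  from act_independent[OF assms c(1)] c(2) show False by blast
qed

lemma involution_eigenvector:
  assumes A: "A \<in> carrier (SL d)" "f A \<noteq> 1\<^sub>m d"
    and sq: "\<And>v. v \<in> carrier_vec d \<Longrightarrow> act A (act A v) = v"
  obtains w where "w \<in> carrier_vec d" "w \<noteq> 0\<^sub>v d" "act A w = - w"
proof -
  obtain v where v: "v \<in> carrier_vec d" "act A v \<noteq> v" by (rule f_ne_oneE[OF A])
  let ?w = "v + - act A v"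
  have c: "act A v \<in> carrier_vec d" by (rule act_carrier[OF A(1)])
  have "act A ?w = act A v + - act A (act A v)"
    using act_add[OF A(1) v(1), of "- act A v"] act_uminus[OF A(1) c] c by simp
  also have "\<dots> = - ?w" unfolding sq[OF v(1)] using v c by (intro eq_vecI) auto
  finally have "act A ?w = - ?w" .
  moreover have "?w \<noteq> 0\<^sub>v d"
  proof
    assume "?w = 0\<^sub>v d"
    moreover have "?w $ i = v $ i - act A v $ i" if "i < d" for i using that v c by simp
    ultimately have "v $ i = act A v $ i" if "i < d" for i using that by (metis eq_iff_diff_eq_0 index_zero_vec(1))
    then have "act A v = v" using v c by (intro eq_vecI) auto
    then show False using v by simp
  qed
  ultimately show thesis using that[of ?w] v c by simp
qed

text \<open>The \<open>-1\<close> eigenspace of \<open>A\<close> is nonzero, as it contains some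
  \<open>v - A v\<close>, and it is stable under \<open>L\<close>; the search for a joint
  eigenvector is run inside it. Prescribing this one sign guarantees a nontrivial character.\<close>

lemma joint_eigenvector_minus:
  assumes L: "finite L" "L \<subseteq> carrier (SL d)"
    and sq: "\<And>B v. B \<in> L \<Longrightarrow> v \<in> carrier_vec d \<Longrightarrow> act B (act B v) = v"
    and comm: "\<And>B C v. B \<in> L \<Longrightarrow> C \<in> L \<Longrightarrow> v \<in> carrier_vec d \<Longrightarrow> act B (act C v) = act C (act B v)"
    and A: "A \<in> carrier (SL d)" "f A \<noteq> 1\<^sub>m d" "\<And>v. v \<in> carrier_vec d \<Longrightarrow> act A (act A v) = v"
    and commA: "\<And>B v. B \<in> L \<Longrightarrow> v \<in> carrier_vec d \<Longrightarrow> act A (act B v) = act B (act A v)"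
  obtains v where "v \<in> carrier_vec d" "v \<noteq> 0\<^sub>v d" "act A v = - v"
    "\<And>B. B \<in> L \<Longrightarrow> act B v = v \<or> act B v = - v"
proof -
  obtain w where w: "w \<in> carrier_vec d" "w \<noteq> 0\<^sub>v d" "act A w = - w"
    by (rule involution_eigenvector[OF A])
  let ?U = "{v \<in> carrier_vec d. act A v = - v}"
  have "\<exists>v\<in>?U. v \<noteq> 0\<^sub>v d \<and> (\<forall>B\<in>L. act B v = v \<or> act B v = - v)"
  proof (rule joint_eigenvector[OF L])
    fix v w assume vw: "v \<in> ?U" "w \<in> ?U"
    then have "act A (v + w) = - v + - w" using act_add[OF A(1)] by simp
    also have "\<dots> = - (v + w)" using vw by (intro eq_vecI) auto
    finally show "v + w \<in> ?U" using vw by simp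
  next
    fix B v assume "B \<in> L" "v \<in> ?U"
    then have B: "B \<in> carrier (SL d)" "act A (act B v) = - act B v" and v: "v \<in> carrier_vec d"
      using L(2) commA act_uminus by auto
    then show "act B v \<in> ?U \<and> act B (act B v) = v"
      using act_carrier[OF B(1)] sq[OF \<open>B \<in> L\<close> v] by simp
  qed (use w comm in auto)
  then show thesis using that by auto
qed

text \<open>The set \<open>S\<close> is determined by the weight vector only up to complement.\<close>

definition weight :: "nat set \<Rightarrow> int vec \<Rightarrow> bool" where
  "weight S v \<longleftrightarrow> v \<in> carrier_vec d \<and> v \<noteq> 0\<^sub>v d \<and>
     (\<forall>i<d. \<forall>j<d. i \<noteq> j \<longrightarrow> act (flip d i j) v = (sgn_on S i * sgn_on S j) \<cdot>\<^sub>v v)"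

lemma weightD:
  assumes "weight S v"
  shows "v \<in> carrier_vec d" "v \<noteq> 0\<^sub>v d"
    "i < d \<Longrightarrow> j < d \<Longrightarrow> i \<noteq> j \<Longrightarrow> act (flip d i j) v = (sgn_on S i * sgn_on S j) \<cdot>\<^sub>v v"
  using assms by (auto simp: weight_def)

text \<open>The sign matrices \<open>flip d 0 j\<close> generate the others, since
  \<open>flip d i j = flip d 0 i * flip d 0 j\<close>.\<close>

lemma weightI_base:
  assumes v: "v \<in> carrier_vec d" "v \<noteq> 0\<^sub>v d"
    and 0: "\<And>j. 0 < j \<Longrightarrow> j < d \<Longrightarrow> act (flip d 0 j) v = (sgn_on S 0 * sgn_on S j) \<cdot>\<^sub>v v"
  shows "weight S v"
proof -
  have "act (flip d i j) v = (sgn_on S i * sgn_on S j) \<cdot>\<^sub>v v" if ij: "i < d" "j < d" "i \<noteq> j" for i j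
  proof (cases "i = 0 \<or> j = 0")
    case True
    then show ?thesis using 0[of j] 0[of i] ij flip_commute[of d i 0] by (auto simp: mult.commute)
  next
    case False
    then have p: "0 < i" "0 < j" by auto
    have "flip d i j = flip d 0 i * flip d 0 j"
      using flip_prod[of i 0 j d] p ij flip_commute[of d i 0] by simp
    then have "act (flip d i j) v = act (flip d 0 i) (act (flip d 0 j) v)"
      using act_mult[OF _ _ v(1), of "flip d 0 i" "flip d 0 j"] flip_SL[of 0 d i] flip_SL[of 0 d j] p ij by simp
    also have "\<dots> = (sgn_on S 0 * sgn_on S j) \<cdot>\<^sub>v ((sgn_on S 0 * sgn_on S i) \<cdot>\<^sub>v v)"
      using 0[of j] 0[of i] p ij act_smult[OF flip_SL[of 0 d i] v(1)] by simp
    also have "\<dots> = (sgn_on S i * sgn_on S j) \<cdot>\<^sub>v v"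
      unfolding smult_smult_assoc by (simp add: mult.assoc mult.left_commute mult.commute)
    finally show ?thesis .
  qed
  then show ?thesis using v by (simp add: weight_def)
qed

lemma flip_act_sq:
  assumes "i < d" "j < d" "i \<noteq> j" "v \<in> carrier_vec d"
  shows "act (flip d i j) (act (flip d i j) v) = v"
  using act_mult[OF flip_SL flip_SL assms(4), OF assms(1-3,1-3)] flip_sq act_one[OF assms(4)] by simp

lemma pm_smult:
  assumes "act A v = v \<or> act A v = - v" "v \<in> carrier_vec d"
  shows "act A v = (if act A v = - v then -1 else 1) \<cdot>\<^sub>v v"
proof -
  have "(-1) \<cdot>\<^sub>v v = - v" "1 \<cdot>\<^sub>v v = v" by auto
  then show ?thesis using assms(1) by auto
qed

text \<open>Reading \<open>S\<close> off the matrices \<open>flip d 0 j\<close> puts 0 outside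
  \<open>S\<close>, which selects one of the two complementary sets. The matrix \<open>A\<close>
  will be a sign matrix or, in dimension four, \<open>minus_one\<close>.\<close>

lemma weight_exists:
  assumes A: "A \<in> carrier (SL d)" "f A \<noteq> 1\<^sub>m d" "\<And>v. v \<in> carrier_vec d \<Longrightarrow> act A (act A v) = v"
    and comm: "\<And>j. A * flip d 0 j = flip d 0 j * A"
  obtains S v where "weight S v" "S \<subseteq> {1..<d}" "act A v = - v"
proof -
  have t: "flip d 0 j \<in> carrier (SL d)" if "0 < j" "j < d" for j using flip_SL[of 0 d j] that by simp
  let ?L = "(\<lambda>j. flip d 0 j) ` {1..<d}"
  obtain v where v: "v \<in> carrier_vec d" "v \<noteq> 0\<^sub>v d" "act A v = - v"
    and pm: "\<And>B. B \<in> ?L \<Longrightarrow> act B v = v \<or> act B v = - v"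
  proof (rule joint_eigenvector_minus[of ?L A])
    show "?L \<subseteq> carrier (SL d)" using t by auto
    show "act B (act B v) = v" if "B \<in> ?L" "v \<in> carrier_vec d" for B v
      using flip_act_sq[of 0 _ v] that by auto
    show "act B (act C v) = act C (act B v)" if "B \<in> ?L" "C \<in> ?L" "v \<in> carrier_vec d" for B C v
    proof -
      have "B * C = C * B" using that flip_comm by auto
      then show ?thesis by (rule act_rel) (use that t in auto)
    qed
    show "act A (act B v) = act B (act A v)" if "B \<in> ?L" "v \<in> carrier_vec d" for B v
    proof -
      have "A * B = B * A" using that comm by auto
      then show ?thesis by (rule act_rel) (use that t A(1) in auto)
    qed
  qed (use A in auto)
  let ?S = "{j \<in> {1..<d}. act (flip d 0 j) v = - v}"
  have "weight ?S v"
  proof (rule weightI_base[OF v(1,2)])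
    fix j assume j: "0 < j" "j < d"
    then have "sgn_on ?S 0 * sgn_on ?S j = (if act (flip d 0 j) v = - v then -1 else 1)" by (simp add: sgn_on_def)
    moreover have "act (flip d 0 j) v = v \<or> act (flip d 0 j) v = - v" by (rule pm) (use j in auto)
    ultimately show "act (flip d 0 j) v = (sgn_on ?S 0 * sgn_on ?S j) \<cdot>\<^sub>v v"
      using pm_smult[OF _ v(1)] by simp
  qed
  moreover have "?S \<subseteq> {1..<d}" by blast
  ultimately show thesis using v(3) by (rule that)
qed

lemma weight_weyl:
  assumes "weight S v" "i < d" "j < d" "i \<noteq> j"
  shows "weight (transpose i j ` S) (act (weyl d i j) v)"
  unfolding weight_def
proof (intro conjI allI impI)
  note v = weightD(1,2)[OF assms(1)]
  have w: "weyl d i j \<in> carrier (SL d)" by (rule weyl_SL[OF assms(4)])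
  show "act (weyl d i j) v \<in> carrier_vec d" using act_carrier[OF w] .
  show "act (weyl d i j) v \<noteq> 0\<^sub>v d" using act_nonzero[OF w v] .
  fix k l assume kl: "k < d" "l < d" "k \<noteq> l"
  let ?k = "transpose i j k" and ?l = "transpose i j l"
  have kl': "?k < d" "?l < d" "?k \<noteq> ?l" using kl assms by (auto simp: transpose_def)
  have "weyl d i j * flip d ?k ?l = flip d k l * weyl d i j" using weyl_flip[OF assms(2-4), of ?k ?l] by simp
  then have "act (flip d k l) (act (weyl d i j) v) = act (weyl d i j) (act (flip d ?k ?l) v)"
    by (intro act_rel[symmetric] w flip_SL v kl kl')
  then show "act (flip d k l) (act (weyl d i j) v) = (sgn_on (transpose i j ` S) k * sgn_on (transpose i j ` S) l) \<cdot>\<^sub>v act (weyl d i j) v"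
    using weightD(3)[OF assms(1) kl'] act_smult[OF w v(1)] by (simp add: sgn_on_image_transpose)
qed

lemma weight_cong:
  assumes "weight S v" "\<And>i j. i < d \<Longrightarrow> j < d \<Longrightarrow> sgn_on S i * sgn_on S j = sgn_on T i * sgn_on T j"
  shows "weight T v"
  using assms by (simp add: weight_def)

text \<open>Exchanging a member of \<open>S\<close> with a nonmember gives \<open>k (d - k) > d\<close> weights, \<open>k = card S\<close>, which for \<open>d \<ge> 5\<close>
  are distinct even up to complement.\<close>

lemma weight_card:
  assumes v: "weight S v" and S: "S \<subseteq> {..<d}" and d5: "d \<ge> 5" and c: "2 \<le> card S"
  shows "card S \<ge> d - 1"
proof (rule ccontr)
  assume "\<not> ?thesis"
  then have c': "card S + 2 \<le> d" by simp
  have fin: "finite S" using S finite_subset by auto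
  let ?I = "S \<times> ({..<d} - S)"
  let ?x = "\<lambda>(a,b). act (weyl d a b) v"
  have T: "weight (transpose a b ` S) (act (weyl d a b) v)" if "(a,b) \<in> ?I" for a b
    using weight_weyl[OF v, of a b] that S by auto
  have "card ?I \<le> d"
  proof (rule act_card_le[where x = ?x])
    fix p assume "p \<in> ?I"
    then show "?x p \<in> carrier_vec d \<and> ?x p \<noteq> 0\<^sub>v d"
      using weightD(1,2)[OF T[of "fst p" "snd p"]] by (cases p) auto
  next
    fix p q assume pq: "p \<in> ?I" "q \<in> ?I" "p \<noteq> q"
    obtain a b a' b' where e: "p = (a,b)" "q = (a',b')" by (cases p, cases q)
    \<comment> \<open>An index \<open>l\<close> fixed by both transpositions removes the ambiguity
      up to complement: both sets have the same sign at \<open>l\<close>, so any \<open>k\<close>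
      where they differ gives a separating \<open>flip d k l\<close>. This is where
      \<open>d \<ge> 5\<close> enters.\<close>
    have "card {a,b,a',b'} \<le> 4" by (auto simp: card_insert_if)
    then obtain l where l: "l < d" "l \<notin> {a,b,a',b'}"
      using index_avoiding[of "{a,b,a',b'}" d] d5 by auto
    obtain k where k: "k < d" "k \<noteq> l" "sgn_on (transpose a b ` S) k \<noteq> sgn_on (transpose a' b' ` S) k"
    proof (cases "a = a'")
      case False
      have "sgn_on S b = 1" "sgn_on S a = -1" using pq e by (auto simp: sgn_on_def)
      moreover have "a \<noteq> b'" "a < d" using pq e S by auto
      ultimately show thesis using that[of a] l False by (auto simp: sgn_on_image_transpose)
    next
      case True
      then have "b \<noteq> b'" using pq e by auto
      moreover have "sgn_on S b = 1" "sgn_on S a = -1" "b \<noteq> a'" "b < d" using pq e by (auto simp: sgn_on_def)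
      ultimately show thesis using that[of b] l by (auto simp: sgn_on_image_transpose)
    qed
    let ?\<chi> = "\<lambda>(a,b). sgn_on (transpose a b ` S) k * sgn_on (transpose a b ` S) l"
    have "flip d k l \<in> carrier (SL d)" using flip_SL k l by blast
    moreover have "\<forall>m\<in>?I. act (flip d k l) (?x m) = ?\<chi> m \<cdot>\<^sub>v ?x m"
      using weightD(3)[OF T k(1) l(1) k(2)] by auto
    moreover have "sgn_on (transpose a b ` S) l = sgn_on S l" "sgn_on (transpose a' b' ` S) l = sgn_on S l"
      using l by (auto simp: sgn_on_image_transpose)
    then have "?\<chi> p \<noteq> ?\<chi> q" using e k sgn_on_cases[of S l] by auto
    ultimately show "\<exists>A \<in> carrier (SL d). \<exists>\<chi>. (\<forall>m\<in>?I. act A (?x m) = \<chi> m \<cdot>\<^sub>v ?x m) \<and> \<chi> p \<noteq> \<chi> q"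
      by blast
  qed (use fin in simp)
  moreover have "card ?I = card S * (d - card S)"
    using S fin by (simp add: card_cartesian_product card_Diff_subset)
  ultimately show False using mult_diff_gt[OF c c' d5] by simp
qed

text \<open>Only cardinalities 1 and \<open>d - 1\<close> survive the count, trivially so for
  \<open>d = 3\<close>. As \<open>0 \<notin> S\<close>, the latter means that \<open>S\<close> is
  the complement of \<open>{0}\<close> and carries the same weight. The matrices
  \<open>weyl d i j\<close> then spread one singleton to all.\<close>

lemma weight_singletons:
  assumes "weight S v" "S \<subseteq> {1..<d}" "S \<noteq> {}" and ne: "\<not> (d = 4 \<and> card S = 2)"
  obtains x where "\<And>i. i < d \<Longrightarrow> weight {i} (x i)"
proof -
  have fin: "finite S" using assms(2) finite_subset by auto
  have cle: "card S \<le> d - 1" using card_mono[OF _ assms(2)] by simp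
  have cpos: "card S > 0" using fin assms(3) by auto
  have sub: "S \<subseteq> {..<d}" using assms(2) by auto
  have "\<exists>j<d. weight {j} v"
  proof (cases "card S = 1")
    case True
    then show ?thesis using assms by (auto simp: card_1_singleton_iff)
  next
    case False
    then have "card S = d - 1"
      using weight_card[OF assms(1) sub] cle cpos ne d3 by (cases "d \<ge> 5") auto
    then have "S = {1..<d}" using assms(2) by (intro card_subset_eq) auto
    then have "weight {0} v" by (intro weight_cong[OF assms(1)]) (auto simp: sgn_on_def)
    then show ?thesis using d3 by (intro exI[of _ 0]) auto
  qed
  then obtain j where j: "j < d" "weight {j} v" by blast
  have "\<exists>w. weight {i} w" if "i < d" for i
    using weight_weyl[OF j(2) that j(1)] j(2) by (cases "i = j") auto
  then have "\<forall>i. \<exists>w. i < d \<longrightarrow> weight {i} w" by blast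
  then obtain x where "\<forall>i. i < d \<longrightarrow> weight {i} (x i)" by (rule choice[THEN exE])
  then show thesis using that by blast
qed

section \<open>Characters of the first-row elementary matrices when \<open>f\<close> kills the sign
  matrices\<close>

definition elem_weight :: "nat set \<Rightarrow> int vec \<Rightarrow> bool" where
  "elem_weight S v \<longleftrightarrow> v \<in> carrier_vec d \<and> v \<noteq> 0\<^sub>v d \<and>
     (\<forall>j. 0 < j \<longrightarrow> j < d \<longrightarrow> act (elem d 0 j 1) v = sgn_on S j \<cdot>\<^sub>v v)"

lemma flip_trivial:
  assumes "f (flip d 0 1) = 1\<^sub>m d" "i < d" "j < d" "i \<noteq> j"
  shows "f (flip d i j) = 1\<^sub>m d"
proof -
  have step: "f (flip d (transpose p q k) (transpose p q l)) = 1\<^sub>m d"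
    if "f (flip d k l) = 1\<^sub>m d" "k < d" "l < d" "k \<noteq> l" "p < d" "q < d" "p \<noteq> q" for k l p q
  proof -
    let ?k = "transpose p q k" and ?l = "transpose p q l"
    have kl': "?k < d" "?l < d" "?k \<noteq> ?l" using that by (auto simp: transpose_def)
    have "f (weyl d p q) * f (flip d k l) = f (flip d ?k ?l) * f (weyl d p q)"
      by (rule f_rel[OF weyl_flip[OF that(5-7)]]) (use weyl_SL flip_SL that kl' in auto)
    then have "f (flip d ?k ?l) * f (weyl d p q) = f (weyl d p q)"
      using that weyl_SL[OF that(7)] by (simp add: right_one_sq)
    then show ?thesis by (rule f_left_cancel[OF _ flip_SL[OF kl'] f_SL[OF weyl_SL[OF that(7)]]])
  qed
  show ?thesis
  proof (rule pair_transitive[OF d3, of 0 1 "\<lambda>i j. f (flip d i j) = 1\<^sub>m d"])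
    show "f (flip d i k) = 1\<^sub>m d" if "i < d" "j < d" "k < d" "i \<noteq> j" "j \<noteq> k" "i \<noteq> k" "f (flip d i j) = 1\<^sub>m d" for i j k
      using step[OF that(7), of j k] that by simp
    show "f (flip d k j) = 1\<^sub>m d" if "i < d" "j < d" "k < d" "i \<noteq> j" "j \<noteq> k" "i \<noteq> k" "f (flip d i j) = 1\<^sub>m d" for i j k
      using step[OF that(7), of i k] that by simp
  qed (use assms d3 in auto)
qed

text \<open>A sign matrix conjugates \<open>e_ij(1)\<close> into its inverse; once \<open>f\<close>
  kills the sign matrices, the images of the two coincide.\<close>

lemma elem_act_sq:
  assumes tr: "f (flip d 0 1) = 1\<^sub>m d" and ij: "i < d" "j < d" "i \<noteq> j" and v: "v \<in> carrier_vec d"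
  shows "act (elem d i j 1) (act (elem d i j 1) v) = v"
proof -
  obtain m where m: "m < d" "m \<noteq> i" "m \<noteq> j" by (rule third_index[OF d3])
  have t1: "act (flip d i m) w = w" if "w \<in> carrier_vec d" for w
    using flip_trivial[OF tr ij(1) m(1) m(2)[symmetric]] that by (simp add: act_def)
  have c: "act (elem d i j 1) w \<in> carrier_vec d" for w by (rule act_carrier) (use ij in simp)
  have e: "act (elem d i j 1) w = act (elem d i j (-1)) w" if w: "w \<in> carrier_vec d" for w
  proof -
    have "flip d i m * elem d i j 1 = elem d i j (-1) * flip d i m"
      using flip_elem[OF ij, of i m 1] ij m by (simp add: sgn_on_def)
    then have "act (flip d i m) (act (elem d i j 1) w) = act (elem d i j (-1)) (act (flip d i m) w)"
      by (rule act_rel) (use flip_SL ij m w in auto)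
    then show ?thesis using t1 w c by simp
  qed
  have "act (elem d i j (-1)) (act (elem d i j 1) v) = act (elem d i j (-1) * elem d i j 1) v"
    using act_mult[of "elem d i j (-1)" "elem d i j 1" v] ij v by simp
  also have "elem d i j (-1) * elem d i j 1 = 1\<^sub>m d"
    unfolding elem_add[OF ij] by (intro eq_matI) auto
  finally show ?thesis using e[OF c] act_one[OF v] by simp
qed

text \<open>The vector is sought in the \<open>-1\<close> eigenspace of \<open>e_01\<close>, nonzero
  because \<open>f\<close> never kills an elementary matrix; so \<open>1 \<in> S\<close>.\<close>

lemma elem_weight_exists:
  assumes tr: "f (flip d 0 1) = 1\<^sub>m d"
  obtains S v where "elem_weight S v" "S \<subseteq> {1..<d}" "S \<noteq> {}"
proof -
  have t: "elem d 0 j 1 \<in> carrier (SL d)" if "0 < j" for j using that by simp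
  have d1: "1 < d" using d3 by simp
  have comm: "act (elem d 0 i 1) (act (elem d 0 j 1) v) = act (elem d 0 j 1) (act (elem d 0 i 1) v)"
    if "0 < i" "i < d" "0 < j" "j < d" "v \<in> carrier_vec d" for i j v
    by (rule act_rel[OF elem_comm]) (use that t in auto)
  let ?L = "(\<lambda>j. elem d 0 j 1) ` {1..<d}"
  obtain v where v: "v \<in> carrier_vec d" "v \<noteq> 0\<^sub>v d" "act (elem d 0 1 1) v = - v"
    and pm: "\<And>B. B \<in> ?L \<Longrightarrow> act B v = v \<or> act B v = - v"
  proof (rule joint_eigenvector_minus[of ?L "elem d 0 1 1"])
    show "?L \<subseteq> carrier (SL d)" "elem d 0 1 1 \<in> carrier (SL d)" using t by auto
    show "f (elem d 0 1 1) \<noteq> 1\<^sub>m d" by (rule elem_nontrivial) (use d1 in auto)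
    show "act (elem d 0 1 1) (act (elem d 0 1 1) v) = v" if "v \<in> carrier_vec d" for v
      using elem_act_sq[OF tr, of 0 1] d1 that by simp
    show "act B (act B v) = v" if "B \<in> ?L" "v \<in> carrier_vec d" for B v
      using elem_act_sq[OF tr, of 0 _ v] that by auto
    show "act B (act C v) = act C (act B v)" if "B \<in> ?L" "C \<in> ?L" "v \<in> carrier_vec d" for B C v
      using comm that by auto
    show "act (elem d 0 1 1) (act B v) = act B (act (elem d 0 1 1) v)" if "B \<in> ?L" "v \<in> carrier_vec d" for B v
      using comm[of 1] d1 that by auto
  qed auto
  let ?S = "{j \<in> {1..<d}. act (elem d 0 j 1) v = - v}"
  have "act (elem d 0 j 1) v = sgn_on ?S j \<cdot>\<^sub>v v" if j: "0 < j" "j < d" for j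
  proof -
    have "sgn_on ?S j = (if act (elem d 0 j 1) v = - v then -1 else 1)" using j by (simp add: sgn_on_def)
    moreover have "act (elem d 0 j 1) v = v \<or> act (elem d 0 j 1) v = - v" by (rule pm) (use j in auto)
    ultimately show ?thesis using pm_smult[OF _ v(1)] by simp
  qed
  then have "elem_weight ?S v" using v by (simp add: elem_weight_def)
  moreover have "1 \<in> ?S" using v d1 by simp
  ultimately show thesis using that[of ?S v] by blast
qed

text \<open>By the commutator relation \<open>e_jk\<close> acts on characters as a transvection over
  the field with two elements: the sign at \<open>j\<close> is multiplied by the sign at
  \<open>k\<close>, the others stay.\<close>

lemma elem_weight_elem:
  assumes "elem_weight S v" and jk: "0 < j" "j < d" "0 < k" "k < d" "j \<noteq> k"
    and T: "\<And>l. l \<noteq> j \<Longrightarrow> sgn_on T l = sgn_on S l" "sgn_on T j = sgn_on S j * sgn_on S k"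
  shows "elem_weight T (act (elem d j k 1) v)"
  unfolding elem_weight_def
proof (intro conjI allI impI)
  have v: "v \<in> carrier_vec d" "v \<noteq> 0\<^sub>v d"
    and ev: "\<And>l. 0 < l \<Longrightarrow> l < d \<Longrightarrow> act (elem d 0 l 1) v = sgn_on S l \<cdot>\<^sub>v v"
    using assms(1) by (auto simp: elem_weight_def)
  have e: "elem d j k 1 \<in> carrier (SL d)" using jk by simp
  show "act (elem d j k 1) v \<in> carrier_vec d" using act_carrier[OF e] .
  show "act (elem d j k 1) v \<noteq> 0\<^sub>v d" using act_nonzero[OF e v] .
  have comm: "act (elem d 0 l 1) (act (elem d j k 1) v) = sgn_on S l \<cdot>\<^sub>v act (elem d j k 1) v"
    if "0 < l" "l < d" "l \<noteq> j" for l
  proof -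
    have "act (elem d 0 l 1) (act (elem d j k 1) v) = act (elem d j k 1) (act (elem d 0 l 1) v)"
      by (rule act_rel[OF elem_comm]) (use that jk v in auto)
    then show ?thesis using ev[OF that(1,2)] act_smult[OF e v(1)] by simp
  qed
  fix l assume l: "0 < l" "l < d"
  show "act (elem d 0 l 1) (act (elem d j k 1) v) = sgn_on T l \<cdot>\<^sub>v act (elem d j k 1) v"
  proof (cases "l = j")
    case False
    then show ?thesis using comm l T by simp
  next
    case True
    have e2: "elem d j k 1 * elem d 0 j 1 \<in> carrier (SL d)" by (rule SL_mult_closed) (use jk in auto)
    have "act (elem d 0 j 1) (act (elem d j k 1) v) = act (elem d 0 k 1) (act (elem d j k 1 * elem d 0 j 1) v)"
      by (rule act_rel) (use elem_commutator[of 0 d j k 1 1] jk v e2 in auto)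
    also have "act (elem d j k 1 * elem d 0 j 1) v = act (elem d j k 1) (act (elem d 0 j 1) v)"
      by (rule act_mult) (use jk v in auto)
    also have "\<dots> = sgn_on S j \<cdot>\<^sub>v act (elem d j k 1) v"
      using ev[of j] jk act_smult[OF e v(1)] by simp
    also have "act (elem d 0 k 1) \<dots> = sgn_on S j \<cdot>\<^sub>v (sgn_on S k \<cdot>\<^sub>v act (elem d j k 1) v)"
      using act_smult[of "elem d 0 k 1" "act (elem d j k 1) v"] act_carrier[OF e] comm[of k] jk by simp
    finally show ?thesis unfolding smult_smult_assoc True T(2) .
  qed
qed

text \<open>Transvections are transitive on nonzero vectors: as long as some \<open>k\<close> lies
  in the set, any other \<open>j\<close> can be inserted or removed. So a nonempty set shrinks to a
  singleton, moves, and grows to \<open>T\<close>.\<close>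

lemma elem_weight_all:
  assumes tr: "f (flip d 0 1) = 1\<^sub>m d" and T: "T \<subseteq> {1..<d}" "T \<noteq> {}"
  shows "\<exists>v. elem_weight T v"
proof -
  let ?P = "\<lambda>S. \<exists>v. elem_weight S v"
  have ins: "?P (insert j S)" if "?P S" "k \<in> S" "j \<notin> S" "j \<in> {1..<d}" "k \<in> {1..<d}" for S j k
    using elem_weight_elem[of S _ j k "insert j S"] that by (auto simp: sgn_on_def)
  have del: "?P S" if "?P (insert j S)" "k \<in> S" "j \<notin> S" "j \<in> {1..<d}" "k \<in> {1..<d}" for S j k
    using elem_weight_elem[of "insert j S" _ j k S] that by (auto simp: sgn_on_def)
  have shrink: "?P {k}"
    if "finite R" "R \<subseteq> {1..<d}" "k \<notin> R" "k \<in> {1..<d}" "?P (insert k R)" for k R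
    using that
  proof (induction R)
    case (insert j R)
    have "?P (insert k R)"
      by (rule del[of j _ k]) (use insert in \<open>auto simp: insert_commute\<close>)
    then show ?case using insert by auto
  qed auto
  obtain S v where S: "elem_weight S v" "S \<subseteq> {1..<d}" "S \<noteq> {}" by (rule elem_weight_exists[OF tr])
  then obtain k where k: "k \<in> S" by blast
  have "insert k (S - {k}) = S" using k by blast
  then have "?P (insert k (S - {k}))" using S(1) by auto
  then have "?P {k}" by (intro shrink[of "S - {k}" k]) (use S k finite_subset[OF S(2)] in auto)
  then have single: "?P {j}" if "j \<in> {1..<d}" for j
    using ins[of "{k}" k j] del[of k "{j}" j] that k S by (cases "j = k") (auto simp: insert_commute)
  have "finite T" using T finite_subset by auto
  then show ?thesis using T(2,1)
  proof (induction T rule: finite_ne_induct)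
    case (singleton j)
    then show ?case using single by auto
  next
    case (insert j F)
    then obtain k where "k \<in> F" by blast
    then show ?case using ins[of F k j] insert by auto
  qed
qed

lemma elem_weight_sep:
  assumes "\<And>m. m \<in> I \<Longrightarrow> m \<subseteq> {1..<d} \<and> elem_weight m (x m)" "S \<in> I" "T \<in> I" "S \<noteq> T"
  shows "\<exists>A \<in> carrier (SL d). \<exists>\<chi>. (\<forall>m\<in>I. act A (x m) = \<chi> m \<cdot>\<^sub>v x m) \<and> \<chi> S \<noteq> \<chi> T"
proof -
  obtain j where j: "j \<in> {1..<d}" "(j \<in> S) \<noteq> (j \<in> T)" using assms by blast
  then show ?thesis using assms(1)
    by (intro bexI[of _ "elem d 0 j 1"] exI[of _ "\<lambda>S. sgn_on S j"]) (auto simp: elem_weight_def sgn_on_def)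
qed

lemma flip_nontrivial_ge4:
  assumes "d \<ge> 4"
  shows "f (flip d 0 1) \<noteq> 1\<^sub>m d"
proof
  assume tr: "f (flip d 0 1) = 1\<^sub>m d"
  let ?I = "Pow {1..<d} - {{}}"
  have "\<forall>T. \<exists>v. T \<in> ?I \<longrightarrow> elem_weight T v" using elem_weight_all[OF tr] by auto
  then obtain x where x: "\<forall>T. T \<in> ?I \<longrightarrow> elem_weight T (x T)" by (rule choice[THEN exE])
  have "card ?I \<le> d"
  proof (rule act_card_le[where x = x])
    show "x i \<in> carrier_vec d \<and> x i \<noteq> 0\<^sub>v d" if "i \<in> ?I" for i using x that by (auto simp: elem_weight_def)
    show "\<exists>A \<in> carrier (SL d). \<exists>\<chi>. (\<forall>m\<in>?I. act A (x m) = \<chi> m \<cdot>\<^sub>v x m) \<and> \<chi> S \<noteq> \<chi> T"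
      if "S \<in> ?I" "T \<in> ?I" "S \<noteq> T" for S T
      by (rule elem_weight_sep) (use x that in auto)
  qed simp
  moreover have "card ?I = 2 ^ (d - 1) - 1" by (simp add: card_Diff_subset card_Pow)
  ultimately show False using pow_gt[OF assms] by simp
qed

end

section \<open>Elementary matrices in a weight basis\<close>

lemma rat_sq_ne_three: "r * r \<noteq> (3::rat)"
proof
  assume 3: "r * r = 3"
  obtain a b where ab: "r = of_int a / of_int b" "b > 0" "coprime a b"
    by (cases r) (auto simp: Fract_of_int_quotient)
  then have "of_int a * of_int a = (r * r) * (of_int b * of_int b :: rat)" by simp
  then have "of_int (a * a) = (of_int (3 * (b * b)) :: rat)" unfolding 3 by simp
  then have e: "a * a = 3 * (b * b)" by (simp only: of_int_eq_iff)
  have m: "3 dvd x" if "3 dvd x * x" for x :: int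
  proof -
    have z: "(x mod 3) * (x mod 3) mod 3 = 0" using that by (simp only: mod_mult_eq dvd_eq_mod_eq_0)
    have "x mod 3 \<noteq> 1" "x mod 3 \<noteq> 2"
    proof -
      show "x mod 3 \<noteq> 1" proof assume *: "x mod 3 = 1" from z show False unfolding * by simp qed
      show "x mod 3 \<noteq> 2" proof assume *: "x mod 3 = 2" from z show False unfolding * by simp qed
    qed
    moreover have "0 \<le> x mod 3" "x mod 3 < 3" by simp_all
    ultimately have "x mod 3 = 0" by linarith
    then show ?thesis by (simp only: dvd_eq_mod_eq_0)
  qed
  have "3 dvd a" by (rule m) (unfold e, rule dvd_triv_left)
  then obtain c where c: "a = 3 * c" by (elim dvdE)
  then have e': "b * b = 3 * (c * c)" using e by simp
  have "3 dvd b" by (rule m) (unfold e', rule dvd_triv_left)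
  then have "3 dvd (1::int)" using \<open>3 dvd a\<close> ab(3) by (meson coprime_common_divisor)
  then show False by simp
qed

text \<open>Matrix entries in a weight basis. They are rational because such a basis need not span
  all integer vectors. Only entries with indices below \<open>d\<close>, at elements of
  \<open>SL d\<close>, carry meaning.\<close>

locale sl_rep =
  fixes d :: nat and g :: "int mat \<Rightarrow> nat \<Rightarrow> nat \<Rightarrow> rat"
  assumes d3: "d \<ge> 3"
    and g_mult: "\<And>A B k l. A \<in> carrier (SL d) \<Longrightarrow> B \<in> carrier (SL d) \<Longrightarrow> k < d \<Longrightarrow> l < d \<Longrightarrow>
      g (A * B) k l = (\<Sum>m<d. g A k m * g B m l)"
    and g_one: "\<And>k l. k < d \<Longrightarrow> l < d \<Longrightarrow> g (1\<^sub>m d) k l = (if k = l then 1 else 0)"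
begin

lemma g_mult_single:
  assumes "A \<in> carrier (SL d)" "B \<in> carrier (SL d)" "k < d" "l < d" "p < d"
    and "\<And>m. m < d \<Longrightarrow> m \<noteq> p \<Longrightarrow> g A k m = 0 \<or> g B m l = 0"
  shows "g (A * B) k l = g A k p * g B p l"
proof -
  have "(\<Sum>m<d. g A k m * g B m l) = (\<Sum>m\<in>{p}. g A k m * g B m l)"
    by (rule sum.mono_neutral_right) (use assms(5,6) in auto)
  then show ?thesis using g_mult assms(1-4) by simp
qed

lemma g_mult_double:
  assumes "A \<in> carrier (SL d)" "B \<in> carrier (SL d)" "k < d" "l < d" "p < d" "q < d" "p \<noteq> q"
    and "\<And>m. m < d \<Longrightarrow> m \<noteq> p \<Longrightarrow> m \<noteq> q \<Longrightarrow> g A k m = 0 \<or> g B m l = 0"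
  shows "g (A * B) k l = g A k p * g B p l + g A k q * g B q l"
proof -
  have "(\<Sum>m<d. g A k m * g B m l) = (\<Sum>m\<in>{p,q}. g A k m * g B m l)"
    by (rule sum.mono_neutral_right) (use assms(5-8) in auto)
  then show ?thesis using g_mult assms(1-4,7) by simp
qed

end

text \<open>Describes a basis of vectors of weights \<open>{0}\<close>, ..., \<open>{d - 1}\<close>,
  where the sign matrices act as in the standard representation.\<close>

locale sl_rep_diag = sl_rep +
  assumes g_flip: "\<And>i j k l. i < d \<Longrightarrow> j < d \<Longrightarrow> i \<noteq> j \<Longrightarrow> k < d \<Longrightarrow> l < d \<Longrightarrow>
      g (flip d i j) k l = (if k = l then of_int (sgn_on {i,j} k) else 0)"
begin

lemma g_flip_left:
  assumes "A \<in> carrier (SL d)" "i < d" "j < d" "i \<noteq> j" "k < d" "l < d"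
  shows "g (flip d i j * A) k l = of_int (sgn_on {i,j} k) * g A k l"
  using g_mult_single[of "flip d i j" A k l k] assms flip_SL[of i d j] by (auto simp: g_flip)

lemma g_flip_right:
  assumes "A \<in> carrier (SL d)" "i < d" "j < d" "i \<noteq> j" "k < d" "l < d"
  shows "g (A * flip d i j) k l = g A k l * of_int (sgn_on {i,j} l)"
  using g_mult_single[of A "flip d i j" k l l] assms flip_SL[of i d j] by (auto simp: g_flip)

lemma elem_flip_entry:
  assumes "i < d" "j < d" "i \<noteq> j" "p < d" "q < d" "p \<noteq> q" "k < d" "l < d"
  shows "of_int (sgn_on {p,q} k) * g (elem d i j a) k l
    = g (elem d i j (sgn_on {p,q} i * sgn_on {p,q} j * a)) k l * of_int (sgn_on {p,q} l)"
  using g_flip_left[of "elem d i j a" p q k l] g_flip_right[of "elem d i j (sgn_on {p,q} i * sgn_on {p,q} j * a)" p q k l]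
    flip_elem[of i d j p q a] assms by simp

text \<open>With equal signs at \<open>i\<close> and \<open>j\<close> the sign matrix commutes with
  \<open>e_ij\<close>, which therefore has no entry between different eigenspaces.\<close>

lemma elem_zero_sep:
  assumes "i < d" "j < d" "i \<noteq> j" "p < d" "q < d" "p \<noteq> q" "k < d" "l < d"
    and "sgn_on {p,q} i = sgn_on {p,q} j" "sgn_on {p,q} k \<noteq> sgn_on {p,q} l"
  shows "g (elem d i j a) k l = 0"
proof -
  have "of_int (sgn_on {p,q} k) * g (elem d i j a) k l = g (elem d i j a) k l * of_int (sgn_on {p,q} l)"
    using elem_flip_entry[OF assms(1-8), of a] assms(9) by simp
  then show ?thesis using sgn_on_cases[of "{p,q}" k] sgn_on_cases[of "{p,q}" l] assms(10) by auto
qed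

text \<open>If exactly one of \<open>k\<close>, \<open>l\<close> lies in \<open>{i,j}\<close>, then
  \<open>flip d i j\<close> separates them. If none does, a fifth index \<open>m\<close> is needed
  to form \<open>flip d k m\<close>, whence the exception in dimension four.\<close>

lemma elem_zero_aux:
  assumes ij: "i < d" "j < d" "i \<noteq> j" and kl: "k < d" "l < d" "k \<noteq> l" "{k,l} \<noteq> {i,j}"
    and ne: "d \<noteq> 4 \<or> {k,l} \<inter> {i,j} \<noteq> {}"
  shows "g (elem d i j a) k l = 0"
proof (cases "{k,l} \<inter> {i,j} = {}")
  case False
  then show ?thesis using kl by (intro elem_zero_sep[OF ij ij kl(1,2)]) (auto simp: sgn_on_def)
next
  case True
  have c4: "card {i,j,k,l} = 4" using ij kl True by (auto simp: card_insert_if)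
  moreover have "card {i,j,k,l} \<le> card {..<d}" by (rule card_mono) (use ij kl in auto)
  ultimately have "d > 4" using ne True by simp
  then obtain m where m: "m < d" "m \<notin> {i,j,k,l}"
    using index_avoiding[of "{i,j,k,l}" d] c4 by auto
  have "sgn_on {k,m} i = 1" "sgn_on {k,m} j = 1" "sgn_on {k,m} k = -1" "sgn_on {k,m} l = 1"
    using m True kl(3) by (auto simp: sgn_on_def)
  then show ?thesis using m(2) by (intro elem_zero_sep[OF ij kl(1) m(1) _ kl(1,2)]) auto
qed

text \<open>\<open>weyl d i j\<close> permutes the weights of the sign matrices by the
  transposition, so its image is monomial of the same shape.\<close>

lemma weyl_zero:
  assumes ij: "i < d" "j < d" "i \<noteq> j" and kl: "k < d" "l < d" "transpose i j k \<noteq> l"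
  shows "g (weyl d i j) k l = 0"
proof -
  let ?k = "transpose i j k"
  have k: "?k < d" using ij kl by (auto simp: transpose_def)
  obtain m where m: "m < d" "m \<noteq> ?k" "m \<noteq> l" by (rule third_index[OF d3])
  have m': "transpose i j l < d" "transpose i j m < d" "transpose i j l \<noteq> transpose i j m"
    using ij kl m by (auto simp: transpose_def)
  have w: "weyl d i j \<in> carrier (SL d)" by (rule weyl_SL[OF ij(3)])
  have "g (weyl d i j) k l * of_int (sgn_on {l,m} l)
      = of_int (sgn_on {transpose i j l, transpose i j m} k) * g (weyl d i j) k l"
    using g_flip_left[OF w m' kl(1,2)] g_flip_right[OF w kl(2) m(1) m(3)[symmetric] kl(1,2)] weyl_flip[OF ij, of l m] by auto
  moreover have "transpose i j l \<noteq> k" "transpose i j m \<noteq> k"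
    using kl(3) m(2) by (metis transpose_involutory)+
  ultimately show ?thesis by (simp add: sgn_on_def)
qed

lemma weyl_nonzero:
  assumes ij: "i < d" "j < d" "i \<noteq> j" and k: "k < d"
  shows "g (weyl d i j) k (transpose i j k) * g (weyl d i j) (transpose i j k) k = of_int (sgn_on {i,j} k)"
proof -
  have w: "weyl d i j \<in> carrier (SL d)" by (rule weyl_SL[OF ij(3)])
  have "transpose i j k < d" using ij k by (auto simp: transpose_def)
  then have "g (weyl d i j * weyl d i j) k k = g (weyl d i j) k (transpose i j k) * g (weyl d i j) (transpose i j k) k"
    by (intro g_mult_single w k) (use weyl_zero[OF ij k] in auto)
  then show ?thesis using weyl_sq[OF ij] g_flip[OF ij k k] by simp
qed

text \<open>Conjugation by \<open>flip d i m\<close> inverts \<open>e_ij\<close>, and in a weight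
  basis that conjugation only changes signs of entries.\<close>

lemma elem_inverse_entry:
  assumes ij: "i < d" "j < d" "i \<noteq> j" and m: "m < d" "m \<noteq> i" "m \<noteq> j" and kl: "k < d" "l < d"
  shows "g (elem d i j (-1)) k l = of_int (sgn_on {i,m} k * sgn_on {i,m} l) * g (elem d i j 1) k l"
proof -
  have "of_int (sgn_on {i,m} k) * g (elem d i j 1) k l = g (elem d i j (-1)) k l * of_int (sgn_on {i,m} l)"
    using elem_flip_entry[OF ij ij(1) m(1) m(2)[symmetric] kl, of 1] ij m by (simp add: sgn_on_def)
  then show ?thesis using sgn_on_cases[of "{i,m}" l] by (auto simp: mult.commute)
qed

lemma elem_inverse: "i < d \<Longrightarrow> j < d \<Longrightarrow> i \<noteq> j \<Longrightarrow> elem d i j 1 * elem d i j (-1) = 1\<^sub>m d"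
  by (simp add: elem_add) (intro eq_matI, auto)

text \<open>In dimension four the diagonal sign matrices do not separate the two lines fixed by
  \<open>e\<^sub>i\<^sub>j\<close>. On their span \<open>e\<^sub>i\<^sub>j\<close> commutes with the rotation \<open>w\<^sub>k\<^sub>l\<close>, and its cube is
  the scalar \<open>w\<^sub>i\<^sub>j = \<plusminus>1\<close>; a nonscalar cube root of \<open>\<plusminus>1\<close> in \<open>\<rat>(i)\<close> would need \<open>sqrt 3\<close>.\<close>

lemma elem_zero_four:
  assumes ij: "i < d" "j < d" "i \<noteq> j" and kl: "k < d" "l < d" "k \<noteq> l"
    and dis: "{k,l} \<inter> {i,j} = {}" and d4: "d = 4"
  shows "g (elem d i j 1) k l = 0"
proof (rule ccontr)
  let ?U = "g (elem d i j 1)" and ?U' = "g (elem d j i (-1))"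
  let ?W = "g (weyl d k l)" and ?V = "g (weyl d i j)"
  assume y: "?U k l \<noteq> 0"
  have ne: "k \<noteq> i" "k \<noteq> j" "l \<noteq> i" "l \<noteq> j" using dis by auto
  have four: "m = i \<or> m = j" if "m < d" "m \<noteq> k" "m \<noteq> l" for m
  proof (rule ccontr)
    assume "\<not> ?thesis"
    then have "card {m,i,j,k,l} = 5" using that ij kl ne by (auto simp: card_insert_if)
    moreover have "card {m,i,j,k,l} \<le> card {..<d}" by (rule card_mono) (use that ij kl in auto)
    ultimately show False using d4 by simp
  qed
  have e: "elem d i j 1 \<in> carrier (SL d)" "elem d j i (-1) \<in> carrier (SL d)" "elem d i j (-1) \<in> carrier (SL d)"
    using ij by auto
  have w: "weyl d k l \<in> carrier (SL d)" "weyl d i j \<in> carrier (SL d)" using weyl_SL kl ij by auto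
  have row: "g (elem d i j a) r m = 0" "g (elem d j i a) r m = 0"
    if "r = k \<or> r = l" "m < d" "m \<noteq> k" "m \<noteq> l" for a r m
  proof -
    have "m = i \<or> m = j" using four that by blast
    then have "r < d" "r \<noteq> m" "{r,m} \<noteq> {i,j}" "{r,m} \<inter> {i,j} \<noteq> {}" "{r,m} \<noteq> {j,i}" "{r,m} \<inter> {j,i} \<noteq> {}"
      using that kl ne by auto
    then show "g (elem d i j a) r m = 0" "g (elem d j i a) r m = 0"
      using elem_zero_aux[OF ij, of r m a] elem_zero_aux[OF ij(2,1) ij(3)[symmetric], of r m a] that by auto
  qed
  have prod: "g (elem d i j a * B) r s = g (elem d i j a) r k * g B k s + g (elem d i j a) r l * g B l s"
    "g (elem d j i a * B) r s = g (elem d j i a) r k * g B k s + g (elem d j i a) r l * g B l s"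
    if "r = k \<or> r = l" "s = k \<or> s = l" "B \<in> carrier (SL d)" for a B r s
    using that kl ij row[OF that(1)] by (intro g_mult_double; auto)+
  have trk: "transpose k l k = l" "transpose k l l = k" "transpose i j k = k" "transpose i j l = l"
    using ne by auto
  have W: "g (weyl d k l * B) k s = ?W k l * g B l s" "g (weyl d k l * B) l s = ?W l k * g B k s"
    if "B \<in> carrier (SL d)" "s < d" for B s
    by (intro g_mult_single w that kl; use weyl_zero[OF kl] kl trk in auto)+
  have V: "g (weyl d i j * B) k s = ?V k k * g B k s" "g (weyl d i j * B) l s = ?V l l * g B l s"
    if "B \<in> carrier (SL d)" "s < d" for B s
    by (intro g_mult_single w that kl; use weyl_zero[OF ij] kl trk in auto)+
  have W0: "?W k k = 0" "?W l l = 0" "?V k l = 0" "?V l k = 0"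
    using weyl_zero[OF kl, of k k] weyl_zero[OF kl, of l l] weyl_zero[OF ij, of k l] weyl_zero[OF ij, of l k] kl trk by auto
  have pq: "?W k l * ?W l k = -1" using weyl_nonzero[OF kl kl(1)] trk by (simp add: sgn_on_def)
  have ss: "?V k k * ?V k k = 1" using weyl_nonzero[OF ij kl(1)] trk ne by (simp add: sgn_on_def)
  have s12: "?V k k = ?V l l"
  proof -
    have "weyl d k l * weyl d i j = weyl d i j * weyl d k l" using weyl_comm ij kl dis by blast
    then have "?W k l * ?V l l = ?V k k * ?W k l" using W(1)[OF w(2) kl(2)] V(1)[OF w(1) kl(2)] by auto
    then show ?thesis using pq by auto
  qed
  have comm: "weyl d k l * elem d i j 1 = elem d i j 1 * weyl d k l" by (rule weyl_elem_comm) (use ij kl dis in auto)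
  have eq1: "?W k l * ?U l k = ?U k l * ?W l k"
    using W(1)[OF e(1) kl(1)] prod(1)[of k k "weyl d k l" 1] w comm W0 by simp
  have eq2: "?U l l = ?U k k"
  proof -
    have "?W k l * ?U l l = ?U k k * ?W k l"
      using W(1)[OF e(1) kl(2)] prod(1)[of k l "weyl d k l" 1] w comm W0 by auto
    then show ?thesis using pq by auto
  qed
  \<comment> \<open>On the span of the two lines \<open>weyl d i j\<close> is the scalar
    \<open>?V k k\<close>, so conjugation by it is invisible there and \<open>e_ji(-1)\<close> acts
    like \<open>e_ij(1)\<close>. Hence the cube.\<close>
  have U': "?U' r s = ?U r s" if rs: "r = k \<or> r = l" "s = k \<or> s = l" for r s
  proof -
    have "s < d" using rs kl by auto
    have "?V k k * ?U r s = g (weyl d i j * elem d i j 1) r s"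
      using V[OF e(1) \<open>s < d\<close>] s12 rs(1) by auto
    also have "\<dots> = g (elem d j i (-1) * weyl d i j) r s" using weyl_elem_flip[OF ij, of 1] by simp
    also have "\<dots> = ?U' r s * ?V k k" using prod(2)[OF rs w(2), of "-1"] W0 s12 rs(2) by auto
    finally show ?thesis using ss by auto
  qed
  define x where "x = ?U k k"
  define y where "y = ?U k l"
  define z where "z = ?U l k"
  have wdef: "weyl d i j = elem d i j 1 * (elem d j i (-1) * elem d i j 1)" by (rule weyl_def)
  have c: "elem d j i (-1) * elem d i j 1 \<in> carrier (SL d)" by (intro SL_mult_closed e)
  have sq: "g (elem d j i (-1) * elem d i j 1) r s = ?U r k * ?U k s + ?U r l * ?U l s"
    if "r = k \<or> r = l" "s = k \<or> s = l" for r s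
    using prod(2)[OF that e(1), of "-1"] U' that by auto
  \<comment> \<open>The off-diagonal entry of the cube vanishes, which yields
    \<open>y * (3 * (x * x) + y * z) = 0\<close>.\<close>
  have "?V k l = ?U k k * g (elem d j i (-1) * elem d i j 1) k l + ?U k l * g (elem d j i (-1) * elem d i j 1) l l"
    unfolding wdef by (rule prod(1)) (use c in auto)
  then have "0 = x * (x * y + y * x) + y * (z * y + x * x)"
    using sq[of k l] sq[of l l] eq2 W0 by (simp add: x_def y_def z_def)
  then have "y * (3 * (x * x) + y * z) = 0" by (simp add: algebra_simps)
  moreover have y0: "y \<noteq> 0" using y by (simp add: y_def)
  ultimately have A: "3 * (x * x) + y * z = 0" by simp
  have inv: "g (elem d i j (-1)) k k = x" "g (elem d i j (-1)) l k = - z"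
    using elem_inverse_entry[OF ij kl(1) ne(1,2), of k k] elem_inverse_entry[OF ij kl(1) ne(1,2), of l k] kl ne
    by (auto simp: x_def z_def sgn_on_def)
  have "g (1\<^sub>m d) k k = ?U k k * g (elem d i j (-1)) k k + ?U k l * g (elem d i j (-1)) l k"
    unfolding elem_inverse[OF ij, symmetric] by (rule prod(1)) (use e in auto)
  then have B: "x * x - y * z = 1" using inv g_one[OF kl(1) kl(1)] by (simp add: x_def y_def)
  define p q where "p = ?W k l" and "q = ?W l k"
  have C: "p * z = y * q" "p * q = -1" using eq1 pq by (simp_all add: p_def q_def y_def z_def)
  \<comment> \<open>Commuting with the rotation makes \<open>y * z\<close> equal to minus the square
    of \<open>y * q\<close>. Equations \<open>A\<close> and \<open>B\<close> give
    \<open>y * z = -3/4\<close>, so \<open>2 * (y * q)\<close> would be a square root of 3.\<close>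
  have "- z = q * (p * z)" using C(2) by (metis mult.assoc mult.commute mult_minus1)
  then have "z = - (y * q) * q" unfolding C(1) by (simp add: algebra_simps)
  then have "y * z = - ((y * q) * (y * q))" by (simp add: algebra_simps)
  then have "(2 * (y * q)) * (2 * (y * q)) = 3" using A B by (simp add: algebra_simps)
  then show False using rat_sq_ne_three by blast
qed

lemma elem_zero:
  assumes ij: "i < d" "j < d" "i \<noteq> j" and kl: "k < d" "l < d" "k \<noteq> l" "{k,l} \<noteq> {i,j}"
  shows "g (elem d i j 1) k l = 0"
  using elem_zero_aux[OF assms, of 1] elem_zero_four[OF assms(1-6)] by blast

text \<open>\<open>e_ij(1)\<close> and \<open>e_ij(-1)\<close> have equal diagonal entries. Their
  product is 1, and one vanishing off-diagonal entry suppresses the cross terms on the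
  diagonal.\<close>

lemma elem_diag_sq:
  assumes ij: "i < d" "j < d" "i \<noteq> j" and k: "k < d"
    and z: "g (elem d i j 1) i j = 0 \<or> g (elem d i j 1) j i = 0"
  shows "g (elem d i j 1) k k * g (elem d i j 1) k k = 1"
proof -
  obtain m where m: "m < d" "m \<noteq> i" "m \<noteq> j" by (rule third_index[OF d3])
  have e: "elem d i j 1 \<in> carrier (SL d)" "elem d i j (-1) \<in> carrier (SL d)" using ij by auto
  have "g (elem d i j 1 * elem d i j (-1)) k k = g (elem d i j 1) k k * g (elem d i j (-1)) k k"
  proof (rule g_mult_single[OF e k k k])
    fix n assume n: "n < d" "n \<noteq> k"
    show "g (elem d i j 1) k n = 0 \<or> g (elem d i j (-1)) n k = 0"
    proof (cases "{k,n} = {i,j}")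
      case True
      then have "(k = i \<and> n = j) \<or> (k = j \<and> n = i)" using ij by (auto simp: doubleton_eq_iff)
      then show ?thesis using z elem_inverse_entry[OF ij m n(1) k] by auto
    qed (use elem_zero[OF ij k n(1)] n in auto)
  qed
  then show ?thesis
    using elem_inverse[OF ij] g_one[OF k k] elem_inverse_entry[OF ij m k k] by simp
qed

text \<open>If every \<open>e_ij\<close> acted diagonally, the images would commute and the
  commutator relation would make each of them trivial.\<close>

lemma off_diagonal_exists:
  assumes nt: "\<exists>i<d. \<exists>j<d. i \<noteq> j \<and> (\<exists>k<d. \<exists>l<d. g (elem d i j 1) k l \<noteq> (if k = l then 1 else 0))"
  shows "\<exists>i<d. \<exists>j<d. i \<noteq> j \<and> (g (elem d i j 1) i j \<noteq> 0 \<or> g (elem d i j 1) j i \<noteq> 0)"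
proof (rule ccontr)
  assume no: "\<not> ?thesis"
  have diag: "g (elem d i j 1) k l = 0" if "i < d" "j < d" "i \<noteq> j" "k < d" "l < d" "k \<noteq> l" for i j k l
  proof (cases "{k,l} = {i,j}")
    case True
    then have "(k = i \<and> l = j) \<or> (k = j \<and> l = i)" using that by (auto simp: doubleton_eq_iff)
    then show ?thesis using no that by blast
  qed (use elem_zero that in auto)
  obtain i k r s where nt: "i < d" "k < d" "i \<noteq> k" "r < d" "s < d" "g (elem d i k 1) r s \<noteq> (if r = s then 1 else 0)"
    using nt by blast
  then have rs: "r = s" using diag by (metis (full_types))
  obtain j where j: "j < d" "j \<noteq> i" "j \<noteq> k" by (rule third_index[OF d3])
  have e: "elem d i j 1 \<in> carrier (SL d)" "elem d j k 1 \<in> carrier (SL d)" "elem d i k 1 \<in> carrier (SL d)"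
    using nt j by auto
  have D: "g (elem d p q 1 * B) r r = g (elem d p q 1) r r * g B r r"
    if "p < d" "q < d" "p \<noteq> q" "B \<in> carrier (SL d)" for p q B
    by (rule g_mult_single) (use that nt diag in auto)
  have nz: "g (elem d p q 1) r r \<noteq> 0" if "p < d" "q < d" "p \<noteq> q" for p q
    using elem_diag_sq[OF that nt(4)] diag[OF that that] by auto
  have "g (elem d i j 1) r r * g (elem d j k 1) r r = g (elem d i k 1) r r * (g (elem d j k 1) r r * g (elem d i j 1) r r)"
    using D[OF nt(1) j(1) j(2)[symmetric] e(2)] D[OF nt(1-3) SL_mult_closed[OF e(2,1)]]
      D[OF j(1) nt(2) j(3) e(1)] elem_commutator[of i d j k 1 1] nt j by auto
  then have "g (elem d i k 1) r r = 1" using nz nt j by (simp add: mult.commute)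
  then show False using nt rs by simp
qed

text \<open>Besides entry \<open>(j,i)\<close>, the only off-diagonal entry left by
  \<open>elem_zero\<close>. It is the nonzero one in the standard representation, entry
  \<open>(j,i)\<close> the nonzero one in the dual.\<close>

definition rcoeff :: "nat \<Rightarrow> nat \<Rightarrow> rat" where
  "rcoeff i j = g (elem d i j 1) i j"

lemma rcoeff_col:
  assumes "i < d" "j < d" "k < d" "i \<noteq> j" "j \<noteq> k" "i \<noteq> k" "rcoeff i j \<noteq> 0"
  shows "rcoeff i k \<noteq> 0"
proof -
  let ?w = "weyl d k j"
  have w: "?w \<in> carrier (SL d)" by (rule weyl_SL) (use assms in auto)
  have e: "elem d i j 1 \<in> carrier (SL d)" "elem d i k 1 \<in> carrier (SL d)" using assms by auto
  have tr: "transpose k j i = i" "transpose k j k = j" "transpose k j j = k" using assms by auto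
  have "g (?w * elem d i j 1) i j = g ?w i i * rcoeff i j"
    unfolding rcoeff_def by (rule g_mult_single[OF w e(1)]) (use assms weyl_zero[of k j i] tr in auto)
  moreover have "g (elem d i k 1 * ?w) i j = rcoeff i k * g ?w k j"
    unfolding rcoeff_def
  proof (rule g_mult_single[OF e(2) w])
    fix m assume "m < d" "m \<noteq> k"
    then have "transpose k j m \<noteq> j" using tr by (metis transpose_eq_imp_eq)
    then show "g (elem d i k 1) i m = 0 \<or> g ?w m j = 0" using weyl_zero[of k j m j] \<open>m < d\<close> assms by auto
  qed (use assms in auto)
  moreover have "g ?w i i \<noteq> 0" using weyl_nonzero[of k j i] tr assms by (auto simp: sgn_on_def)
  ultimately show ?thesis using weyl_elem_col[of i d j k 1] assms by auto
qed

lemma rcoeff_row: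
  assumes "i < d" "j < d" "k < d" "i \<noteq> j" "j \<noteq> k" "i \<noteq> k" "rcoeff i j \<noteq> 0"
  shows "rcoeff k j \<noteq> 0"
proof -
  let ?w = "weyl d k i"
  have w: "?w \<in> carrier (SL d)" by (rule weyl_SL) (use assms in auto)
  have e: "elem d i j 1 \<in> carrier (SL d)" "elem d k j 1 \<in> carrier (SL d)" using assms by auto
  have tr: "transpose k i j = j" "transpose k i k = i" "transpose k i i = k" using assms by auto
  have "g (?w * elem d i j 1) k j = g ?w k i * rcoeff i j"
    unfolding rcoeff_def by (rule g_mult_single[OF w e(1)]) (use assms weyl_zero[of k i k] tr in auto)
  moreover have "g (elem d k j 1 * ?w) k j = rcoeff k j * g ?w j j"
    unfolding rcoeff_def
  proof (rule g_mult_single[OF e(2) w])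
    fix m assume "m < d" "m \<noteq> j"
    then have "transpose k i m \<noteq> j" using tr by (metis transpose_eq_imp_eq)
    then show "g (elem d k j 1) k m = 0 \<or> g ?w m j = 0" using weyl_zero[of k i m j] \<open>m < d\<close> assms by auto
  qed (use assms in auto)
  moreover have "g ?w k i \<noteq> 0" using weyl_nonzero[of k i k] tr assms by (auto simp: sgn_on_def)
  ultimately show ?thesis using weyl_elem_row[of i d j k 1] assms by auto
qed

lemma rcoeff_nonzero:
  assumes "i < d" "j < d" "i \<noteq> j" "rcoeff i j \<noteq> 0" "k < d" "l < d" "k \<noteq> l"
  shows "rcoeff k l \<noteq> 0"
  by (rule pair_transitive[OF d3 assms(1-3), of "\<lambda>i j. rcoeff i j \<noteq> 0"]) (use assms rcoeff_col rcoeff_row in blast)+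

text \<open>Standard and dual behaviour exclude each other: \<open>e_ij\<close> and
  \<open>e_ik\<close> commute, and comparing entries \<open>(j,k)\<close> of the two products leaves
  entry \<open>(j,i)\<close> of \<open>e_ij\<close> times \<open>rcoeff i k\<close>.\<close>

lemma c_zero:
  assumes rcoeff: "rcoeff i k \<noteq> 0" and ijk: "i < d" "j < d" "k < d" "i \<noteq> j" "j \<noteq> k" "i \<noteq> k"
  shows "g (elem d i j 1) j i = 0"
proof -
  have e: "elem d i j 1 \<in> carrier (SL d)" "elem d i k 1 \<in> carrier (SL d)" using ijk by auto
  have "g (elem d i j 1 * elem d i k 1) j k = g (elem d i j 1) j i * g (elem d i k 1) i k + g (elem d i j 1) j j * g (elem d i k 1) j k"
    by (rule g_mult_double[OF e]) (use ijk elem_zero[of i j j] in \<open>auto simp: doubleton_eq_iff\<close>)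
  also have "g (elem d i k 1) j k = 0" by (rule elem_zero) (use ijk in \<open>auto simp: doubleton_eq_iff\<close>)
  also have "g (elem d i j 1 * elem d i k 1) j k = g (elem d i k 1 * elem d i j 1) j k"
    using elem_comm[of i d j i k 1 1] ijk by simp
  also have "\<dots> = g (elem d i k 1) j j * g (elem d i j 1) j k"
    by (rule g_mult_single[OF e(2,1)]) (use ijk elem_zero[of i k j] in \<open>auto simp: doubleton_eq_iff\<close>)
  also have "g (elem d i j 1) j k = 0" by (rule elem_zero) (use ijk in \<open>auto simp: doubleton_eq_iff\<close>)
  finally show ?thesis using rcoeff by (simp add: rcoeff_def)
qed

context
  assumes rcoeff_nz: "\<And>i j. i < d \<Longrightarrow> j < d \<Longrightarrow> i \<noteq> j \<Longrightarrow> rcoeff i j \<noteq> 0"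
begin

lemma u_zero:
  assumes ij: "i < d" "j < d" "i \<noteq> j" and kl: "k < d" "l < d" "k \<noteq> l" "\<not> (k = i \<and> l = j)"
  shows "g (elem d i j 1) k l = 0"
proof (cases "k = j \<and> l = i")
  case True
  obtain m where m: "m < d" "m \<noteq> i" "m \<noteq> j" by (rule third_index[OF d3])
  show ?thesis using c_zero[OF rcoeff_nz[OF ij(1) m(1)] ij(1,2) m(1)] ij m True by auto
next
  case False
  then show ?thesis using kl by (intro elem_zero[OF ij]) (auto simp: doubleton_eq_iff)
qed

lemma u_diag_sq:
  assumes "i < d" "j < d" "i \<noteq> j" "k < d"
  shows "g (elem d i j 1) k k * g (elem d i j 1) k k = 1"
  using elem_diag_sq[OF assms] u_zero[OF assms(1-3,2,1)] assms by auto

text \<open>The diagonal of \<open>e_ik\<close> is constant: position \<open>k\<close> is compared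
  with \<open>i\<close> through \<open>e_ik(1) e_ik(-1) = 1\<close>, any other position
  \<open>j\<close> through commutation with \<open>e_ij\<close>.\<close>

lemma u_diag_eq:
  assumes ik: "i < d" "k < d" "i \<noteq> k" and j: "j < d"
  shows "g (elem d i k 1) j j = g (elem d i k 1) i i"
proof (cases "j = i")
  case False
  show ?thesis
  proof (cases "j = k")
    case True
    obtain m where m: "m < d" "m \<noteq> i" "m \<noteq> k" by (rule third_index[OF d3])
    have e: "elem d i k 1 \<in> carrier (SL d)" "elem d i k (-1) \<in> carrier (SL d)" using ik by auto
    have "g (elem d i k 1 * elem d i k (-1)) i k
        = g (elem d i k 1) i i * g (elem d i k (-1)) i k + g (elem d i k 1) i k * g (elem d i k (-1)) k k"
      by (rule g_mult_double[OF e]) (use ik u_zero[OF ik, of i] in auto)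
    moreover have "g (elem d i k (-1)) i k = - rcoeff i k" "g (elem d i k (-1)) k k = g (elem d i k 1) k k"
      using elem_inverse_entry[OF ik m, of i k] elem_inverse_entry[OF ik m, of k k] ik m
      by (auto simp: sgn_on_def rcoeff_def)
    moreover have "g (elem d i k 1 * elem d i k (-1)) i k = 0"
      using elem_inverse[OF ik] g_one[OF ik(1,2)] ik by simp
    ultimately have "rcoeff i k * (g (elem d i k 1) k k - g (elem d i k 1) i i) = 0"
      by (auto simp: rcoeff_def)
    then show ?thesis using rcoeff_nz[OF ik] True by auto
  next
    case jk: False
    have e: "elem d i j 1 \<in> carrier (SL d)" "elem d i k 1 \<in> carrier (SL d)" using ik False by auto
    have "g (elem d i j 1 * elem d i k 1) i j = g (elem d i j 1) i j * g (elem d i k 1) j j"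
      by (rule g_mult_single[OF e]) (use ik j jk False u_zero[of i j i] u_zero[of i k i j] in auto)
    moreover have "g (elem d i k 1 * elem d i j 1) i j = g (elem d i k 1) i i * g (elem d i j 1) i j"
      by (rule g_mult_single[OF e(2,1)]) (use ik j jk False u_zero[of i k i] u_zero[of i j k j] in auto)
    moreover have "elem d i j 1 * elem d i k 1 = elem d i k 1 * elem d i j 1"
      by (rule elem_comm) (use ik j jk False in auto)
    ultimately show ?thesis using rcoeff_nz[OF ik(1) j] False by (auto simp: rcoeff_def)
  qed
qed simp

text \<open>The remaining common sign is killed by the commutator relation, where at entry
  \<open>(i,i)\<close> the factors for \<open>e_ij\<close> and \<open>e_jk\<close> cancel.\<close>

lemma u_diag:
  assumes ik: "i < d" "k < d" "i \<noteq> k" and r: "r < d"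
  shows "g (elem d i k 1) r r = 1"
proof -
  obtain j where j: "j < d" "j \<noteq> i" "j \<noteq> k" by (rule third_index[OF d3])
  have e: "elem d i j 1 \<in> carrier (SL d)" "elem d j k 1 \<in> carrier (SL d)" "elem d i k 1 \<in> carrier (SL d)"
    using ik j by auto
  note c = SL_mult_closed[OF e(2,1)]
  let ?X = "g (elem d j k 1 * elem d i j 1)"
  have "g (elem d i j 1 * elem d j k 1) i i = g (elem d i j 1) i i * g (elem d j k 1) i i"
    by (rule g_mult_single[OF e(1,2)]) (use ik j u_zero[of i j i] u_zero[of j k j i] in auto)
  moreover have "g (elem d i k 1 * (elem d j k 1 * elem d i j 1)) i i = g (elem d i k 1) i i * ?X i i + g (elem d i k 1) i k * ?X k i"
    by (rule g_mult_double[OF e(3) c]) (use ik j u_zero[of i k i] in auto)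
  moreover have "?X k i = 0"
    using g_mult_single[OF e(2,1), of k i k] u_zero[of j k k] u_zero[of i j k i] ik j by auto
  moreover have "?X i i = g (elem d j k 1) i i * g (elem d i j 1) i i"
    by (rule g_mult_single[OF e(2,1)]) (use ik j u_zero[of j k i] in auto)
  moreover have "g (elem d i j 1) i i \<noteq> 0" "g (elem d j k 1) i i \<noteq> 0"
    using u_diag_sq[of i j i] u_diag_sq[of j k i] ik j by auto
  ultimately have "g (elem d i k 1) i i = 1" using elem_commutator[of i d j k 1 1] ik j by auto
  then show ?thesis using u_diag_eq[OF ik r] by simp
qed

text \<open>The multiplicative cocycle identity, read off at entry \<open>(i,k)\<close> of the
  commutator relation. It is what makes a rescaling of the basis possible.\<close>

lemma rcoeff_trans:
  assumes ik: "i < d" "k < d" "i \<noteq> k" and j: "j < d" "j \<noteq> i" "j \<noteq> k"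
  shows "rcoeff i k = rcoeff i j * rcoeff j k"
proof -
  have e: "elem d i j 1 \<in> carrier (SL d)" "elem d j k 1 \<in> carrier (SL d)" "elem d i k 1 \<in> carrier (SL d)"
    using ik j by auto
  note c = SL_mult_closed[OF e(2,1)]
  let ?X = "g (elem d j k 1 * elem d i j 1)"
  have "g (elem d i j 1 * elem d j k 1) i k = rcoeff i j * rcoeff j k"
    unfolding rcoeff_def by (rule g_mult_single[OF e(1,2)]) (use ik j u_zero[of i j i] u_zero[of j k i k] in auto)
  moreover have "g (elem d i k 1 * (elem d j k 1 * elem d i j 1)) i k = g (elem d i k 1) i i * ?X i k + rcoeff i k * ?X k k"
    unfolding rcoeff_def by (rule g_mult_double[OF e(3) c]) (use ik j u_zero[of i k i] in auto)
  moreover have "?X i k = g (elem d j k 1) i i * g (elem d i j 1) i k"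
    by (rule g_mult_single[OF e(2,1)]) (use ik j u_zero[of j k i] in auto)
  moreover have "?X k k = g (elem d j k 1) k k * g (elem d i j 1) k k"
    by (rule g_mult_single[OF e(2,1)]) (use ik j u_zero[of j k k] in auto)
  ultimately show ?thesis
    using elem_commutator[of i d j k 1 1] ik j u_diag u_zero[of i j i k] by auto
qed

lemma rcoeff_inverse:
  assumes ij: "i < d" "j < d" "i \<noteq> j"
  shows "rcoeff i j * rcoeff j i = 1"
proof -
  obtain k where k: "k < d" "k \<noteq> i" "k \<noteq> j" by (rule third_index[OF d3])
  have "rcoeff i k = rcoeff i j * (rcoeff j i * rcoeff i k)"
    using rcoeff_trans[of i k j] rcoeff_trans[of j k i] ij k by simp
  then show ?thesis using rcoeff_nz[of i k] ij k by auto
qed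

end

end

section \<open>Assembling the conjugating matrix from a weight basis\<close>

context sl_hom
begin

text \<open>\<open>g A\<close> is \<open>f A\<close> conjugated by the rational inverse of the
  matrix with columns \<open>x i\<close>. The last property transfers relations that hold only after
  applying \<open>f\<close>, such as squares of elementary matrices becoming trivial.\<close>

lemma basis_rep:
  assumes x: "\<And>i. i < d \<Longrightarrow> x i \<in> carrier_vec d"
    and ind: "\<And>c. (\<And>r. r < d \<Longrightarrow> (\<Sum>m<d. c m * x m $ r) = 0) \<Longrightarrow> \<forall>m<d. c m = (0::int)"
  obtains g :: "int mat \<Rightarrow> nat \<Rightarrow> nat \<Rightarrow> rat" where "sl_rep d g"
    "\<And>A l r. A \<in> carrier (SL d) \<Longrightarrow> l < d \<Longrightarrow> r < d \<Longrightarrow>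
      of_int (act A (x l) $ r) = (\<Sum>k<d. g A k l * of_int (x k $ r))"
    "\<And>A l c. A \<in> carrier (SL d) \<Longrightarrow> l < d \<Longrightarrow> act A (x l) = c \<cdot>\<^sub>v x l \<Longrightarrow>
      \<forall>k<d. g A k l = (if k = l then of_int c else 0)"
    "\<And>A. A \<in> carrier (SL d) \<Longrightarrow> \<forall>k<d. \<forall>l<d. g A k l = (if k = l then 1 else 0) \<Longrightarrow> f A = 1\<^sub>m d"
    "\<And>A B. f A = f B \<Longrightarrow> g A = g B"
proof -
  let ?h = "map_mat (of_int :: int \<Rightarrow> rat)"
  let ?Q = "mat d d (\<lambda>(r,c). x c $ r)"
  have Q: "?Q \<in> carrier_mat d d" by simp
  have "det ?Q \<noteq> 0" by (rule det_columns_nonzero) (rule ind)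
  then have "det (?h ?Q) \<noteq> 0" by simp
  then have "?h ?Q \<in> Units (ring_mat TYPE(rat) d ())" by (intro det_non_zero_imp_unit) auto
  then obtain W where W: "W \<in> carrier_mat d d" "W * ?h ?Q = 1\<^sub>m d" "?h ?Q * W = 1\<^sub>m d"
    unfolding Units_def by (auto simp: ring_mat_simps)
  define g where "g A k l = (W * ?h (f A) * ?h ?Q) $$ (k,l)" for A k l
  have hc: "?h (f A) \<in> carrier_mat d d" if "A \<in> carrier (SL d)" for A using that f_carrier by simp
  have hQ: "?h ?Q \<in> carrier_mat d d" by simp
  have gc: "W * ?h (f A) * ?h ?Q \<in> carrier_mat d d" if "A \<in> carrier (SL d)" for A
    using W(1) hc[OF that] hQ by (intro mult_sq)
  have Qg: "?h ?Q * (W * ?h (f A) * ?h ?Q) = ?h (f A) * ?h ?Q" if "A \<in> carrier (SL d)" for A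
  proof -
    have "?h ?Q * (W * ?h (f A) * ?h ?Q) = (?h ?Q * W) * (?h (f A) * ?h ?Q)"
      using W(1) hc[OF that] hQ by (simp add: assoc_sq mult_sq)
    then show ?thesis using W(3) hc[OF that] hQ by (simp add: left_one_sq mult_sq)
  qed
  have expand: "of_int (act A (x l) $ r) = (\<Sum>k<d. g A k l * of_int (x k $ r))"
    if A: "A \<in> carrier (SL d)" and lr: "l < d" "r < d" for A l r
  proof -
    have "of_int (act A (x l) $ r) = (\<Sum>s\<in>{0..<d}. of_int (f A $$ (r,s)) * of_int (x l $ s) :: rat)"
      unfolding act_def sum_mult_mat_vec_index[OF f_carrier[OF A] x[OF lr(1)] lr(2)] by simp
    also have "\<dots> = (?h (f A) * ?h ?Q) $$ (r,l)"
      unfolding mult_mat_index[OF hc[OF A] hQ lr(2,1)]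
      using carrier_matD[OF f_carrier[OF A]] lr by (intro sum.cong) auto
    also have "\<dots> = (?h ?Q * (W * ?h (f A) * ?h ?Q)) $$ (r,l)" using Qg[OF A] by simp
    also have "\<dots> = (\<Sum>k\<in>{0..<d}. ?h ?Q $$ (r,k) * g A k l)"
      unfolding mult_mat_index[OF hQ gc[OF A] lr(2,1)] g_def ..
    also have "\<dots> = (\<Sum>k<d. g A k l * of_int (x k $ r))"
      using lr by (intro sum.cong) auto
    finally show ?thesis .
  qed
  have rep: "sl_rep d g"
  proof
    show "d \<ge> 3" by (rule d3)
    fix A B k l assume AB: "A \<in> carrier (SL d)" "B \<in> carrier (SL d)" and kl: "k < d" "l < d"
    have "W * ?h (f (A * B)) * ?h ?Q = W * ?h (f A) * (?h (f B) * ?h ?Q)"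
      unfolding f_mult[OF AB] of_int_hom.mat_hom_mult[OF f_carrier[OF AB(1)] f_carrier[OF AB(2)]]
      using W(1) hc[OF AB(1)] hc[OF AB(2)] hQ
      by (simp add: assoc_sq mult_sq)
    also have "\<dots> = (W * ?h (f A) * ?h ?Q) * (W * ?h (f B) * ?h ?Q)"
      unfolding Qg[OF AB(2), symmetric]
      using W(1) hc[OF AB(1)] hc[OF AB(2)] hQ gc[OF AB(2)]
      by (simp add: assoc_sq mult_sq)
    finally show "g (A * B) k l = (\<Sum>m<d. g A k m * g B m l)"
      unfolding g_def using mult_mat_index[OF gc[OF AB(1)] gc[OF AB(2)] kl] by (simp add: atLeast0LessThan)
  next
    fix k l assume kl: "k < d" "l < d"
    have "?h (f (1\<^sub>m d)) = 1\<^sub>m d" unfolding f_one by (intro eq_matI) auto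
    then have "W * ?h (f (1\<^sub>m d)) * ?h ?Q = 1\<^sub>m d" using W by simp
    then show "g (1\<^sub>m d) k l = (if k = l then 1 else 0)" unfolding g_def using kl by simp
  qed
  have eig: "\<forall>k<d. g A k l = (if k = l then of_int c else 0)"
    if A: "A \<in> carrier (SL d)" and l: "l < d" and e: "act A (x l) = c \<cdot>\<^sub>v x l" for A l c
  proof (intro allI impI)
    fix k assume k: "k < d"
    have "g A k l = (W * (?h (f A) * ?h ?Q)) $$ (k,l)"
      unfolding g_def using W(1) hc[OF A] hQ by (simp add: assoc_sq)
    also have "\<dots> = (\<Sum>s\<in>{0..<d}. W $$ (k,s) * (?h (f A) * ?h ?Q) $$ (s,l))"
      by (rule mult_mat_index[OF W(1) mult_carrier_mat[OF hc[OF A] hQ] k l])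
    also have "\<dots> = (\<Sum>s\<in>{0..<d}. of_int c * (W $$ (k,s) * ?h ?Q $$ (s,l)))"
    proof (rule sum.cong[OF refl])
      fix s assume "s \<in> {0..<d}"
      then have s: "s < d" by simp
      have "(?h (f A) * ?h ?Q) $$ (s,l) = of_int (act A (x l) $ s)"
        unfolding mult_mat_index[OF hc[OF A] hQ s l] act_def
          sum_mult_mat_vec_index[OF f_carrier[OF A] x[OF l] s]
        using carrier_matD[OF f_carrier[OF A]] s l by (simp add: atLeast0LessThan)
      also have "\<dots> = of_int c * ?h ?Q $$ (s,l)" unfolding e using x[OF l] s l by simp
      finally show "W $$ (k,s) * (?h (f A) * ?h ?Q) $$ (s,l) = of_int c * (W $$ (k,s) * ?h ?Q $$ (s,l))" by simp
    qed
    also have "\<dots> = of_int c * (W * ?h ?Q) $$ (k,l)"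
      unfolding mult_mat_index[OF W(1) hQ k l] by (simp only: sum_distrib_left)
    finally show "g A k l = (if k = l then of_int c else 0)" using W(2) k l by simp
  qed
  have faithful: "f A = 1\<^sub>m d"
    if A: "A \<in> carrier (SL d)" and one: "\<forall>k<d. \<forall>l<d. g A k l = (if k = l then 1 else 0)" for A
  proof -
    have "W * ?h (f A) * ?h ?Q = 1\<^sub>m d" using one gc[OF A] unfolding g_def by (intro eq_matI) auto
    then have e: "?h (f A) * ?h ?Q = ?h ?Q" using Qg[OF A] by (simp add: right_one_sq)
    have "?h (f A) = ?h (f A) * (?h ?Q * W)" using W(3) hc[OF A] by (simp add: right_one_sq)
    also have "\<dots> = ?h (f A) * ?h ?Q * W" using hc[OF A] hQ W(1) by (intro assoc_mult_mat[symmetric])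
    also have "\<dots> = 1\<^sub>m d" unfolding e by (rule W(3))
    finally have h1: "?h (f A) = 1\<^sub>m d" .
    show ?thesis
    proof (rule eq_matI)
      fix r s assume "r < dim_row (1\<^sub>m d :: int mat)" "s < dim_col (1\<^sub>m d :: int mat)"
      then have rs: "r < d" "s < d" by auto
      have "of_int (f A $$ (r,s)) = ?h (f A) $$ (r,s)" using carrier_matD[OF f_carrier[OF A]] rs by simp
      also have "\<dots> = of_int (if r = s then 1 else 0)" unfolding h1 using rs by simp
      finally show "f A $$ (r,s) = 1\<^sub>m d $$ (r,s)" using rs by (simp only: of_int_eq_iff) simp
    qed (use carrier_matD[OF f_carrier[OF A]] in auto)
  qed
  have cong: "g A = g B" if "f A = f B" for A B
    unfolding g_def fun_eq_iff that by simp
  show thesis using that[OF rep expand eig faithful cong] by blast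
qed

lemma singletons_independent:
  assumes x: "\<And>i. i < d \<Longrightarrow> weight {i} (x i)"
    and "\<And>r. r < d \<Longrightarrow> (\<Sum>m<d. c m * x m $ r) = 0"
  shows "\<forall>m<d. c m = 0"
proof -
  have "\<forall>m\<in>{..<d}. c m = 0"
  proof (rule act_independent[where x = x])
    fix i k assume ik: "i \<in> {..<d}" "k \<in> {..<d}" "i \<noteq> k"
    obtain m where m: "m < d" "m \<noteq> i" "m \<noteq> k" by (rule third_index[OF d3])
    have "flip d i m \<in> carrier (SL d)" using flip_SL ik m by simp
    moreover have "\<forall>n\<in>{..<d}. act (flip d i m) (x n) = (sgn_on {n} i * sgn_on {n} m) \<cdot>\<^sub>v x n"
      using weightD(3)[OF x] ik m by auto
    moreover have "sgn_on {i} i * sgn_on {i} m \<noteq> sgn_on {k} i * sgn_on {k} m" using ik m by (auto simp: sgn_on_def)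
    ultimately show "\<exists>A \<in> carrier (SL d). \<exists>\<chi>. (\<forall>m\<in>{..<d}. act A (x m) = \<chi> m \<cdot>\<^sub>v x m) \<and> \<chi> i \<noteq> \<chi> k"
      by (intro bexI[of _ "flip d i m"] exI[of _ "\<lambda>n. sgn_on {n} i * sgn_on {n} m"]) auto
  qed (use weightD(1,2)[OF x] assms(2) in auto)
  then show ?thesis by auto
qed

lemma act_scaled:
  assumes "A \<in> carrier (SL d)" "x \<in> carrier_vec d" "y \<in> carrier_vec d"
    and "\<And>r. r < d \<Longrightarrow> of_int (y $ r) = q * (of_int (x $ r) :: rat)" "r < d"
  shows "of_int (act A y $ r) = q * (of_int (act A x $ r) :: rat)"
  unfolding act_def sum_mult_mat_vec_index[OF f_carrier[OF assms(1)] assms(2,5)]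
    sum_mult_mat_vec_index[OF f_carrier[OF assms(1)] assms(3,5)]
  using assms(4) by (simp add: sum_distrib_left mult.left_commute)

text \<open>By the cocycle identity \<open>rcoeff i j = q i / q j\<close> with
  \<open>q c = rcoeff c 0\<close>, so in the basis \<open>q c\<close> times \<open>x c\<close> every
  \<open>f(e_ij)\<close> is the elementary matrix \<open>e_ij\<close> itself.\<close>

lemma GL_conj_of_b:
  assumes x: "\<And>i. i < d \<Longrightarrow> weight {i} (x i)"
    and rep: "sl_rep_diag d g"
    and expand: "\<And>A l r. A \<in> carrier (SL d) \<Longrightarrow> l < d \<Longrightarrow> r < d \<Longrightarrow>
      of_int (act A (x l) $ r) = (\<Sum>k<d. g A k l * of_int (x k $ r))"
    and b_ne: "i0 < d" "j0 < d" "i0 \<noteq> j0" "g (elem d i0 j0 1) i0 j0 \<noteq> 0"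
  shows "\<exists>P \<in> carrier (GL d). \<forall>A \<in> carrier (SL d). f A = GL_conj d P A"
proof -
  interpret R: sl_rep_diag d g by (rule rep)
  have nz: "R.rcoeff i j \<noteq> 0" if "i < d" "j < d" "i \<noteq> j" for i j
    using R.rcoeff_nonzero[OF b_ne(1-3) _ that] b_ne(4) by (simp add: R.rcoeff_def)
  have xc: "x i \<in> carrier_vec d" if "i < d" for i using weightD(1)[OF x[OF that]] .
  have d0: "0 < d" using d3 by simp
  have u: "of_int (act (elem d i j 1) (x l) $ r)
      = of_int (x l $ r) + (if l = j then R.rcoeff i j * of_int (x i $ r) else 0)"
    if ij: "i < d" "j < d" "i \<noteq> j" and lr: "l < d" "r < d" for i j l r
  proof -
    have "of_int (act (elem d i j 1) (x l) $ r) = (\<Sum>k<d. g (elem d i j 1) k l * of_int (x k $ r))"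
      by (rule expand) (use that in auto)
    also have "\<dots> = (\<Sum>k<d. (if k = l then of_int (x l $ r) else 0) +
        (if k = i then (if l = j then R.rcoeff i j * of_int (x i $ r) else 0) else 0))"
    proof (rule sum.cong[OF refl])
      fix k assume "k \<in> {..<d}"
      then show "g (elem d i j 1) k l * of_int (x k $ r) = (if k = l then of_int (x l $ r) else 0) +
        (if k = i then (if l = j then R.rcoeff i j * of_int (x i $ r) else 0) else 0)"
        using R.u_diag[OF nz ij, of l] R.u_zero[OF nz ij, of k l] ij lr
        by (cases "k = l"; cases "k = i \<and> l = j") (auto simp: R.rcoeff_def)
    qed
    also have "\<dots> = of_int (x l $ r) + (if l = j then R.rcoeff i j * of_int (x i $ r) else 0)"
      using ij lr by (simp add: sum.distrib)
    finally show ?thesis .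
  qed
  \<comment> \<open>The factors \<open>q c\<close> are rational, yet no denominators have to be
    cleared: \<open>f(e_c0) - 1\<close> maps \<open>x 0\<close> to \<open>q c\<close> times
    \<open>x c\<close>, and that image is integral.\<close>
  define y where "y c = (if c = 0 then x 0 else act (elem d c 0 1) (x 0) - x 0)" for c
  define q where "q c = (if c = 0 then 1 else R.rcoeff c 0)" for c
  have yc: "y c \<in> carrier_vec d" for c
    unfolding y_def using xc[OF d0] act_carrier[of "elem d c 0 1" "x 0"] by auto
  have yq: "of_int (y c $ r) = q c * of_int (x c $ r)" if "c < d" "r < d" for c r
  proof (cases "c = 0")
    case False
    then have "act (elem d c 0 1) (x 0) \<in> carrier_vec d" by (intro act_carrier) simp
    then show ?thesis using u[OF that(1) d0 False d0 that(2)] xc[OF d0] False that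
      by (simp add: y_def q_def)
  qed (simp add: y_def q_def)
  have q0: "q c \<noteq> 0" if "c < d" for c using nz that d0 by (auto simp: q_def)
  have ytyp: "weight {c} (y c)" if c: "c < d" for c
    unfolding weight_def
  proof (intro conjI allI impI)
    show "y c \<in> carrier_vec d" by (rule yc)
    show "y c \<noteq> 0\<^sub>v d"
    proof
      assume "y c = 0\<^sub>v d"
      then have "x c $ r = 0" if "r < d" for r using yq[OF c that] q0[OF c] that by simp
      then have "x c = 0\<^sub>v d" using xc[OF c] by (intro eq_vecI) auto
      then show False using weightD(2)[OF x[OF c]] by contradiction
    qed
    fix i j assume ij: "i < d" "j < d" "i \<noteq> j"
    have t: "flip d i j \<in> carrier (SL d)" by (rule flip_SL[OF ij])
    show "act (flip d i j) (y c) = (sgn_on {c} i * sgn_on {c} j) \<cdot>\<^sub>v y c"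
    proof (rule eq_vecI)
      fix r assume "r < dim_vec ((sgn_on {c} i * sgn_on {c} j) \<cdot>\<^sub>v y c)"
      then have r: "r < d" using yc[of c] by simp
      have "(of_int (act (flip d i j) (y c) $ r) :: rat) = q c * of_int (act (flip d i j) (x c) $ r)"
        by (rule act_scaled[OF t xc[OF c] yc yq[OF c] r])
      also have "\<dots> = of_int ((sgn_on {c} i * sgn_on {c} j) * y c $ r)"
        using weightD(3)[OF x[OF c] ij] yq[OF c r] xc[OF c] r by simp
      finally show "act (flip d i j) (y c) $ r = ((sgn_on {c} i * sgn_on {c} j) \<cdot>\<^sub>v y c) $ r"
        using yc[of c] r by (simp only: of_int_eq_iff) simp
    qed (use carrier_vecD[OF act_carrier[OF t]] carrier_vecD[OF yc] in simp)
  qed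
  let ?Q = "mat d d (\<lambda>(r,c). y c $ r)"
  have Q: "?Q \<in> carrier_mat d d" by simp
  have "det ?Q \<noteq> 0"
    by (rule det_columns_nonzero) (rule singletons_independent[of y], use ytyp in auto)
  moreover have "f (elem d i j 1) * ?Q = ?Q * elem d i j 1" if ij: "i < d" "j < d" "i \<noteq> j" for i j
  proof (rule eq_matI)
    have e: "elem d i j 1 \<in> carrier (SL d)" using ij by simp
    fix r c assume "r < dim_row (?Q * elem d i j 1)" "c < dim_col (?Q * elem d i j 1)"
    then have rc: "r < d" "c < d" by auto
    have qb: "q j * R.rcoeff i j = q i"
    proof -
      consider "j = 0" | "i = 0" "j \<noteq> 0" | "i \<noteq> 0" "j \<noteq> 0" by blast
      then show ?thesis
      proof cases
        case 2
        then show ?thesis using R.rcoeff_inverse[OF nz ij(2,1)] ij by (simp add: q_def)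
      next
        case 3
        then show ?thesis using R.rcoeff_trans[OF nz ij(1) d0 _ ij(2)] ij by (simp add: q_def mult.commute)
      qed (use ij in \<open>simp add: q_def\<close>)
    qed
    have "(f (elem d i j 1) * ?Q) $$ (r,c) = act (elem d i j 1) (y c) $ r"
      unfolding mult_mat_index[OF f_carrier[OF e] Q rc] act_def
        sum_mult_mat_vec_index[OF f_carrier[OF e] yc rc(1)] using rc by (intro sum.cong) auto
    then have "(of_int ((f (elem d i j 1) * ?Q) $$ (r,c)) :: rat) = q c * of_int (act (elem d i j 1) (x c) $ r)"
      using act_scaled[OF e xc[OF rc(2)] yc yq[OF rc(2)] rc(1)] by simp
    also have "\<dots> = of_int (y c $ r) + (if c = j then of_int (y i $ r) else 0)"
      unfolding u[OF ij rc(2,1)] using yq[OF rc(2,1)] yq[OF ij(1) rc(1)] qb[symmetric] by (simp add: algebra_simps)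
    also have "\<dots> = of_int ((?Q * elem d i j 1) $$ (r,c))"
      unfolding mult_elem_index[OF Q ij(1,2) rc ij(3)] using rc ij by simp
    finally show "(f (elem d i j 1) * ?Q) $$ (r,c) = (?Q * elem d i j 1) $$ (r,c)" by (simp only: of_int_eq_iff)
  qed (use carrier_matD[OF f_carrier[of "elem d i j 1"]] ij in auto)
  ultimately show ?thesis by (rule GL_conj_of_intertwiner[OF Q])
qed

end

lemma inv_transpose_elem:
  assumes "i < d" "j < d" "i \<noteq> j"
  shows "inv_transpose d (elem d i j a) = elem d j i (- a)"
proof -
  interpret group "SL d" by (rule group_SL)
  have "inv\<^bsub>SL d\<^esub> (elem d i j a) = elem d i j (- a)"
  proof (rule inv_equality)
    show "elem d i j (- a) \<otimes>\<^bsub>SL d\<^esub> elem d i j a = \<one>\<^bsub>SL d\<^esub>"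
      using assms by (simp add: elem_add) (intro eq_matI, auto)
  qed (use assms in auto)
  then show ?thesis unfolding inv_transpose_def by (auto intro!: eq_matI)
qed

lemma inv_transpose_flip:
  assumes "i < d" "j < d" "i \<noteq> j"
  shows "inv_transpose d (flip d i j) = flip d i j"
proof -
  interpret group "SL d" by (rule group_SL)
  have "inv\<^bsub>SL d\<^esub> (flip d i j) = flip d i j"
    by (rule inv_equality) (use assms flip_SL in \<open>auto simp: flip_sq\<close>)
  then show ?thesis unfolding inv_transpose_def by (auto simp: flip_def diag_of_def intro!: eq_matI)
qed

lemma inv_transpose_SL: "A \<in> carrier (SL d) \<Longrightarrow> inv_transpose d A \<in> carrier (SL d)"
  using inv_transpose_hom by (rule hom_in_carrier)

lemma inv_transpose_mult:
  "A \<in> carrier (SL d) \<Longrightarrow> B \<in> carrier (SL d) \<Longrightarrow> inv_transpose d (A * B) = inv_transpose d A * inv_transpose d B"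
  using hom_mult[OF inv_transpose_hom, of A d B] by simp

context sl_hom
begin

text \<open>In the dual case \<open>f\<close> is replaced by its composite with the inverse
  transpose. This fixes the sign matrices, so the same vectors \<open>x i\<close> remain weight
  vectors, while \<open>e_ij(1)\<close> turns into \<open>e_ji(-1)\<close> and entry
  \<open>(j,i)\<close> takes the place of \<open>(i,j)\<close>.\<close>

lemma conj_of_singletons:
  assumes x: "\<And>i. i < d \<Longrightarrow> weight {i} (x i)"
  shows "\<exists>P \<in> carrier (GL d). (\<forall>A \<in> carrier (SL d). f A = GL_conj d P A) \<or>
    (\<forall>A \<in> carrier (SL d). f A = GL_conj d P (inv_transpose d A))"
proof -
  have xc: "x i \<in> carrier_vec d" if "i < d" for i using weightD(1)[OF x[OF that]] .
  obtain g :: "int mat \<Rightarrow> nat \<Rightarrow> nat \<Rightarrow> rat" where rep: "sl_rep d g"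
    and expand: "\<And>A l r. A \<in> carrier (SL d) \<Longrightarrow> l < d \<Longrightarrow> r < d \<Longrightarrow>
      of_int (act A (x l) $ r) = (\<Sum>k<d. g A k l * of_int (x k $ r))"
    and eig: "\<And>A l c. A \<in> carrier (SL d) \<Longrightarrow> l < d \<Longrightarrow> act A (x l) = c \<cdot>\<^sub>v x l \<Longrightarrow>
      \<forall>k<d. g A k l = (if k = l then of_int c else 0)"
    and faithful: "\<And>A. A \<in> carrier (SL d) \<Longrightarrow> \<forall>k<d. \<forall>l<d. g A k l = (if k = l then 1 else 0) \<Longrightarrow> f A = 1\<^sub>m d"
    by (rule basis_rep[OF xc singletons_independent[OF x]]) blast+
  interpret R: sl_rep d g by (rule rep)
  have gtm: "g (flip d i j) k l = (if k = l then of_int (sgn_on {i,j} k) else 0)"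
    if "i < d" "j < d" "i \<noteq> j" "k < d" "l < d" for i j k l
  proof -
    have "sgn_on {l} i * sgn_on {l} j = sgn_on {i,j} l" using that by (auto simp: sgn_on_def)
    then show ?thesis using eig[OF flip_SL[OF that(1-3)] that(5) weightD(3)[OF x[OF that(5)] that(1-3)]] that(4) by simp
  qed
  interpret D: sl_rep_diag d g by unfold_locales (rule gtm)
  have "\<exists>i<d. \<exists>j<d. i \<noteq> j \<and> (\<exists>k<d. \<exists>l<d. g (elem d i j 1) k l \<noteq> (if k = l then 1 else 0))"
  proof -
    have "0 < d" "1 < d" using d3 by auto
    then have ne: "f (elem d 0 1 1) \<noteq> 1\<^sub>m d" by (intro elem_nontrivial) auto
    show ?thesis
    proof (rule ccontr)
      assume "\<not> ?thesis"
      then have "\<forall>k<d. \<forall>l<d. g (elem d 0 1 1) k l = (if k = l then 1 else 0)"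
        using \<open>0 < d\<close> \<open>1 < d\<close> zero_neq_one by blast
      then show False using faithful[of "elem d 0 1 1"] ne by simp
    qed
  qed
  from D.off_diagonal_exists[OF this] obtain i j where ij: "i < d" "j < d" "i \<noteq> j"
    and ne: "g (elem d i j 1) i j \<noteq> 0 \<or> g (elem d i j 1) j i \<noteq> 0" by blast
  show ?thesis
  proof (cases "g (elem d i j 1) i j = 0")
    case False
    then show ?thesis using GL_conj_of_b[OF x D.sl_rep_diag_axioms expand ij] by blast
  next
    case True
    let ?f = "\<lambda>A. f (inv_transpose d A)" and ?g = "\<lambda>A. g (inv_transpose d A)"
    have "sl_hom d ?f"
    proof
      show "d \<ge> 3" by (rule d3)
      show "?f \<in> hom (SL d) (SL d)"
        using hom_compose[OF inv_transpose_hom hom] by (simp add: comp_def)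
      obtain A where "A \<in> carrier (SL d)" "f A \<noteq> 1\<^sub>m d" using nontrivial by blast
      then show "\<exists>A \<in> carrier (SL d). ?f A \<noteq> 1\<^sub>m d"
        using inv_transpose_SL inv_transpose_involution by (intro bexI[of _ "inv_transpose d A"]) auto
    qed
    then interpret F: sl_hom d ?f .
    have Fact: "F.act A v = act (inv_transpose d A) v" for A v by (simp add: F.act_def act_def)
    have Fx: "F.weight {i} (x i)" if "i < d" for i
      using x[OF that] unfolding F.weight_def weight_def Fact by (simp add: inv_transpose_flip)
    have Frep: "sl_rep_diag d ?g"
    proof
      show "d \<ge> 3" by (rule d3)
      show "?g (A * B) k l = (\<Sum>m<d. ?g A k m * ?g B m l)"
        if "A \<in> carrier (SL d)" "B \<in> carrier (SL d)" "k < d" "l < d" for A B k l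
        using R.g_mult inv_transpose_SL that by (simp add: inv_transpose_mult)
      have "inv_transpose d (1\<^sub>m d) = 1\<^sub>m d" using hom_one[OF inv_transpose_hom group_SL group_SL] by simp
      then show "?g (1\<^sub>m d) k l = (if k = l then 1 else 0)" if "k < d" "l < d" for k l
        using R.g_one that by simp
      show "?g (flip d i j) k l = (if k = l then of_int (sgn_on {i,j} k) else 0)"
        if "i < d" "j < d" "i \<noteq> j" "k < d" "l < d" for i j k l
        using gtm that by (simp add: inv_transpose_flip)
    qed
    have Fexp: "of_int (F.act A (x l) $ r) = (\<Sum>k<d. ?g A k l * of_int (x k $ r))"
      if "A \<in> carrier (SL d)" "l < d" "r < d" for A l r
      unfolding Fact by (rule expand) (use that inv_transpose_SL in auto)
    obtain m where m: "m < d" "m \<noteq> i" "m \<noteq> j" by (rule third_index[OF d3])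
    have "?g (elem d j i 1) j i \<noteq> 0"
      using D.elem_inverse_entry[OF ij m ij(2,1)] ij m ne True
      by (simp add: inv_transpose_elem) (simp add: sgn_on_def)
    then obtain P where P: "P \<in> carrier (GL d)" "\<And>A. A \<in> carrier (SL d) \<Longrightarrow> ?f A = GL_conj d P A"
      using F.GL_conj_of_b[OF Fx Frep Fexp ij(2,1) ij(3)[symmetric]] by blast
    have "f A = GL_conj d P (inv_transpose d A)" if "A \<in> carrier (SL d)" for A
      using P(2)[OF inv_transpose_SL[OF that]] inv_transpose_involution[OF that] by simp
    then show ?thesis using P(1) by blast
  qed
qed

text \<open>In a basis of characters of \<open>\<langle>f(e\<^sub>0\<^sub>1), f(e\<^sub>0\<^sub>2)\<rangle>\<close> the relations leave one rational parameter
  \<open>s\<close>, subject to \<open>(s + t)\<^sup>2 = 1/4\<close> with \<open>s t = 1/2\<close>, a quadratic of discriminant \<open>-7\<close>.\<close>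

lemma flip_nontrivial_three:
  assumes d: "d = 3"
  shows "f (flip d 0 1) \<noteq> 1\<^sub>m d"
proof
  assume tr: "f (flip d 0 1) = 1\<^sub>m d"
  \<comment> \<open>The three nonempty subsets of \<open>{1,2}\<close>, that is the nontrivial
    characters of a Klein four-group; their vectors just fill up dimension three.\<close>
  define S :: "nat \<Rightarrow> nat set" where "S i = (if i = 0 then {1,2} else {i})" for i
  have lt: "i < 3 \<longleftrightarrow> i = 0 \<or> i = 1 \<or> i = 2" for i :: nat by auto
  have sgS0: "sgn_on (S 0) 1 = -1" "sgn_on (S 1) 1 = -1" "sgn_on (S 2) 1 = 1"
    "sgn_on (S 0) 2 = -1" "sgn_on (S 1) 2 = 1" "sgn_on (S 2) 2 = -1" by (simp_all add: S_def sgn_on_def)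
  note sgS = sgS0 sgS0[unfolded One_nat_def]
  have SI: "S i \<subseteq> {1..<d}" "S i \<noteq> {}" if "i < d" for i using that d by (auto simp: S_def)
  have "\<forall>i. \<exists>v. i < d \<longrightarrow> elem_weight (S i) v" using elem_weight_all[OF tr SI] by blast
  then obtain x where x: "\<forall>i. i < d \<longrightarrow> elem_weight (S i) (x i)" by (rule choice[THEN exE])
  have xc: "x i \<in> carrier_vec d" if "i < d" for i using x that by (auto simp: elem_weight_def)
  have ind: "\<forall>m<d. c m = 0" if "\<And>r. r < d \<Longrightarrow> (\<Sum>m<d. c m * x m $ r) = 0" for c
  proof -
    have "\<forall>m\<in>{..<d}. c m = 0"
    proof (rule act_independent[where x = x])
      fix i k assume ik: "i \<in> {..<d}" "k \<in> {..<d}" "i \<noteq> k"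
      have "sgn_on (S i) 1 \<noteq> sgn_on (S k) 1 \<or> sgn_on (S i) 2 \<noteq> sgn_on (S k) 2"
        using ik unfolding d lessThan_iff lt by (elim disjE) (simp_all add: sgS)
      then obtain j where j: "0 < j" "j < d" "sgn_on (S i) j \<noteq> sgn_on (S k) j" using that[of 1] that[of 2] d by auto
      then show "\<exists>A \<in> carrier (SL d). \<exists>\<chi>. (\<forall>m\<in>{..<d}. act A (x m) = \<chi> m \<cdot>\<^sub>v x m) \<and> \<chi> i \<noteq> \<chi> k"
        using x by (intro bexI[of _ "elem d 0 j 1"] exI[of _ "\<lambda>m. sgn_on (S m) j"]) (auto simp: elem_weight_def)
    qed (use x that in \<open>auto simp: elem_weight_def\<close>)
    then show ?thesis by auto
  qed
  obtain g :: "int mat \<Rightarrow> nat \<Rightarrow> nat \<Rightarrow> rat" where rep: "sl_rep d g"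
    and eig: "\<And>A l c. A \<in> carrier (SL d) \<Longrightarrow> l < d \<Longrightarrow> act A (x l) = c \<cdot>\<^sub>v x l \<Longrightarrow>
      \<forall>k<d. g A k l = (if k = l then of_int c else 0)"
    and cong: "\<And>A B. f A = f B \<Longrightarrow> g A = g B"
    by (rule basis_rep[OF xc ind]) blast+
  interpret R: sl_rep d g by (rule rep)
  have e: "elem d i j 1 \<in> carrier (SL d)" if "i \<noteq> j" for i j using that by simp
  have mult: "g (A * B) k l = g A k 0 * g B 0 l + g A k 1 * g B 1 l + g A k 2 * g B 2 l"
    if "A \<in> carrier (SL d)" "B \<in> carrier (SL d)" "k < d" "l < d" for A B k l
    unfolding R.g_mult[OF that] d by (simp add: numeral_3_eq_3 numeral_2_eq_2)
  have diag: "g (elem d 0 j 1) k l = (if k = l then of_int (sgn_on (S l) j) else 0)"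
    if "0 < j" "j < d" "k < d" "l < d" for j k l
    using eig[OF e that(4), of 0 j "sgn_on (S l) j"] x that by (auto simp: elem_weight_def)
  define Z where "Z = g (elem d 1 2 1)"
  define Y where "Y = g (elem d 2 1 1)"
  define X where "X = g (elem d 1 0 1)"
  have left: "g (elem d 0 j 1 * A) k l = of_int (sgn_on (S k) j) * g A k l"
    and right: "g (A * elem d 0 j 1) k l = g A k l * of_int (sgn_on (S l) j)"
    if "A \<in> carrier (SL d)" "0 < j" "j < d" "k < d" "l < d" for A j k l
    using R.g_mult_single[OF e that(1,4,5,4), of 0 j] R.g_mult_single[OF that(1) e that(4,5,5), of 0 j]
      diag that by auto
  have sq: "f (elem d i j 1 * elem d i j 1) = 1\<^sub>m d" if ij: "i < d" "j < d" "i \<noteq> j" for i j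
  proof (rule ccontr)
    assume "\<not> ?thesis"
    then obtain v where "v \<in> carrier_vec d" "act (elem d i j 1 * elem d i j 1) v \<noteq> v"
      by (rule f_ne_oneE[OF SL_mult_closed[OF e[OF ij(3)] e[OF ij(3)]]])
    then show False using elem_act_sq[OF tr ij] act_mult[OF e[OF ij(3)] e[OF ij(3)]] by simp
  qed
  have gsq: "g (elem d i j 1 * elem d i j 1) k l = (if k = l then 1 else 0)"
    if "i < d" "j < d" "i \<noteq> j" "k < d" "l < d" for i j k l
    using cong[of "elem d i j 1 * elem d i j 1" "1\<^sub>m d"] sq[OF that(1-3)] f_one R.g_one[OF that(4,5)] by simp
  have Zrel: "of_int (sgn_on (S k) 1) * Z k l = of_int (sgn_on (S k) 2) * (Z k l * of_int (sgn_on (S l) 1))"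
    "of_int (sgn_on (S k) 2) * Z k l = Z k l * of_int (sgn_on (S l) 2)" if "k < d" "l < d" for k l
  proof -
    have "elem d 0 1 1 * elem d 1 2 1 = elem d 0 2 1 * (elem d 1 2 1 * elem d 0 1 1)"
      using elem_commutator[of 0 d 1 2 1 1] d by simp
    then show "of_int (sgn_on (S k) 1) * Z k l = of_int (sgn_on (S k) 2) * (Z k l * of_int (sgn_on (S l) 1))"
      using left[OF e[of 1 2], of 1 k l] left[OF SL_mult_closed[OF e[of 1 2] e[of 0 1]], of 2 k l]
        right[OF e[of 1 2], of 1 k l] that d by (simp add: Z_def)
    have "elem d 0 2 1 * elem d 1 2 1 = elem d 1 2 1 * elem d 0 2 1" by (rule elem_comm) (use d in auto)
    then show "of_int (sgn_on (S k) 2) * Z k l = Z k l * of_int (sgn_on (S l) 2)"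
      using left[OF e[of 1 2], of 2 k l] right[OF e[of 1 2], of 2 k l] that d by (simp add: Z_def)
  qed
  \<comment> \<open>\<open>e_12\<close> multiplies the sign at 1 by the sign at 2, so it swaps the
    characters 0 and 2 and fixes 1. In the same way \<open>e_21\<close> swaps 0 and 1 and fixes 2,
    which gives the shape of \<open>Y\<close>.\<close>
  have Z0: "Z 0 0 = 0" "Z 0 1 = 0" "Z 1 0 = 0" "Z 1 2 = 0" "Z 2 1 = 0" "Z 2 2 = 0"
    using Zrel[of 0 0] Zrel[of 0 1] Zrel[of 1 0] Zrel[of 1 2] Zrel[of 2 1] Zrel[of 2 2] d
    by (auto simp: sgS)
  have Yrel: "of_int (sgn_on (S k) 2) * Y k l = of_int (sgn_on (S k) 1) * (Y k l * of_int (sgn_on (S l) 2))"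
    "of_int (sgn_on (S k) 1) * Y k l = Y k l * of_int (sgn_on (S l) 1)" if "k < d" "l < d" for k l
  proof -
    have "elem d 0 2 1 * elem d 2 1 1 = elem d 0 1 1 * (elem d 2 1 1 * elem d 0 2 1)"
      using elem_commutator[of 0 d 2 1 1 1] d by simp
    then show "of_int (sgn_on (S k) 2) * Y k l = of_int (sgn_on (S k) 1) * (Y k l * of_int (sgn_on (S l) 2))"
      using left[OF e[of 2 1], of 2 k l] left[OF SL_mult_closed[OF e[of 2 1] e[of 0 2]], of 1 k l]
        right[OF e[of 2 1], of 2 k l] that d by (simp add: Y_def)
    have "elem d 0 1 1 * elem d 2 1 1 = elem d 2 1 1 * elem d 0 1 1" by (rule elem_comm) (use d in auto)
    then show "of_int (sgn_on (S k) 1) * Y k l = Y k l * of_int (sgn_on (S l) 1)"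
      using left[OF e[of 2 1], of 1 k l] right[OF e[of 2 1], of 1 k l] that d by (simp add: Y_def)
  qed
  have Y0: "Y 0 0 = 0" "Y 0 2 = 0" "Y 1 1 = 0" "Y 1 2 = 0" "Y 2 0 = 0" "Y 2 1 = 0"
    using Yrel[of 0 0] Yrel[of 0 2] Yrel[of 1 1] Yrel[of 1 2] Yrel[of 2 0] Yrel[of 2 1] d
    by (auto simp: sgS)
  have Zsq: "Z 0 2 * Z 2 0 = 1" "Z 1 1 * Z 1 1 = 1"
    using gsq[of 1 2 0 0] gsq[of 1 2 1 1] mult[OF e[of 1 2] e[of 1 2], of 0 0]
      mult[OF e[of 1 2] e[of 1 2], of 1 1] Z0 d by (auto simp: Z_def)
  have Ysq: "Y 0 1 * Y 1 0 = 1" "Y 2 2 * Y 2 2 = 1"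
    using gsq[of 2 1 0 0] gsq[of 2 1 2 2] mult[OF e[of 2 1] e[of 2 1], of 0 0]
      mult[OF e[of 2 1] e[of 2 1], of 2 2] Y0 d by (auto simp: Y_def)
  have Xsq: "X 0 0 * X 0 0 + X 0 1 * X 1 0 + X 0 2 * X 2 0 = 1"
    "X 1 0 * X 0 1 + X 1 1 * X 1 1 + X 1 2 * X 2 1 = 1"
    "X 0 0 * X 0 2 + X 0 1 * X 1 2 + X 0 2 * X 2 2 = 0"
    using gsq[of 1 0 0 0] gsq[of 1 0 1 1] gsq[of 1 0 0 2] mult[OF e[of 1 0] e[of 1 0], of 0 0]
      mult[OF e[of 1 0] e[of 1 0], of 1 1] mult[OF e[of 1 0] e[of 1 0], of 0 2] d by (auto simp: X_def)
  have XZ: "X k 0 * Z 0 l + X k 1 * Z 1 l + X k 2 * Z 2 l = Z k 0 * X 0 l + Z k 1 * X 1 l + Z k 2 * X 2 l"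
    if "k < d" "l < d" for k l
  proof -
    have "elem d 1 0 1 * elem d 1 2 1 = elem d 1 2 1 * elem d 1 0 1" by (rule elem_comm) (use d in auto)
    then show ?thesis using mult[OF e[of 1 0] e[of 1 2] that] mult[OF e[of 1 2] e[of 1 0] that]
      by (simp add: X_def Z_def)
  qed
  have Xu: "X k l * of_int (sgn_on (S l) 2) = Z k 0 * (of_int (sgn_on (S 0) 2) * X 0 l)
      + Z k 1 * (of_int (sgn_on (S 1) 2) * X 1 l) + Z k 2 * (of_int (sgn_on (S 2) 2) * X 2 l)"
    if "k < d" "l < d" for k l
  proof -
    have "elem d 1 0 1 * elem d 0 2 1 = elem d 1 2 1 * (elem d 0 2 1 * elem d 1 0 1)"
      using elem_commutator[of 1 d 0 2 1 1] d by simp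
    then show ?thesis
      using right[OF e[of 1 0], of 2 k l] left[OF e[of 1 0], of 2 _ l]
        mult[OF e[of 1 2] SL_mult_closed[OF e[of 0 2] e[of 1 0]] that] that d
      by (simp add: X_def Z_def)
  qed
  have r0: "X 0 0 = Z 0 2 * X 2 0" "X 0 1 = - (Z 0 2 * X 2 1)" "X 0 2 = Z 0 2 * X 2 2"
    and r1: "- X 1 0 = Z 1 1 * X 1 0" "X 1 1 = Z 1 1 * X 1 1" "- X 1 2 = Z 1 1 * X 1 2"
    using Xu[of 0 0] Xu[of 0 1] Xu[of 0 2] Xu[of 1 0] Xu[of 1 1] Xu[of 1 2] Z0 d by (auto simp: sgS)
  have c: "X 0 2 * Z 2 0 = Z 0 2 * X 2 0" "X 0 1 * Z 1 1 = Z 0 2 * X 2 1" "X 1 2 * Z 2 0 = Z 1 1 * X 1 0"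
    using XZ[of 0 0] XZ[of 0 1] XZ[of 1 0] Z0 d by auto
  have X22: "X 2 2 = X 0 0"
  proof -
    have "X 2 2 = (Z 0 2 * Z 2 0) * X 2 2" using Zsq by simp
    also have "\<dots> = X 0 2 * Z 2 0" unfolding r0(3) by simp
    finally show ?thesis using c(1) r0(1) by simp
  qed
  have C2: "X 0 2 * X 2 0 = X 0 0 * X 0 0" unfolding r0(3) X22 by (subst (3) r0(1)) simp
  show False
  \<comment> \<open>\<open>Z 1 1\<close> is the sign of \<open>e_12\<close> on the character it
    fixes. If it is 1, then \<open>X 1 0 = X 1 2 = 0\<close>, and the square of \<open>e_10\<close>
    being trivial makes \<open>X 0 0\<close> both nonzero and zero.\<close>
  proof (cases "Z 1 1 = 1")
    case True
    then have "X 1 0 = 0" "X 1 2 = 0" using r1 by auto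
    then have "2 * (X 0 0 * X 0 0) = 1" "X 0 0 * X 0 2 = 0" using Xsq C2 X22 by (auto simp: mult.commute)
    then have "X 0 0 = 0 \<or> X 0 2 = 0" "X 0 0 \<noteq> 0" by auto
    then have "X 0 2 = 0" by blast
    then show False using C2 \<open>X 0 0 \<noteq> 0\<close> by simp
  next
    case False
    then have y: "Z 1 1 = -1" using Zsq(2) by (metis square_eq_1_iff)
    then have X11: "X 1 1 = 0" using r1 by simp
    have X12: "X 1 2 = - (Z 0 2 * X 1 0)"
    proof -
      have "X 1 2 = X 1 2 * Z 2 0 * Z 0 2" using Zsq(1) by (simp add: mult.assoc mult.commute)
      then show ?thesis unfolding c(3) y by simp
    qed
    have xBE: "X 0 1 * X 1 0 = 1 / 2" "X 1 2 * X 2 1 = 1 / 2"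
      using Xsq(2) X11 X12 r0(2) by (auto simp: algebra_simps)
    then have C4: "X 0 0 * X 0 0 = 1 / 4" using Xsq(1) C2 by simp
    \<comment> \<open>The commutator relation reads \<open>?R = ?S * ?P\<close> with
      \<open>?S\<close> commuting with \<open>?P\<close>. As \<open>f ?S\<close> is an involution,
      \<open>?R\<close> and \<open>?P\<close> have equal squares under \<open>f\<close>; entry
      \<open>(1,0)\<close> of this is the missing equation.\<close>
    let ?P = "elem d 1 0 1 * elem d 2 1 1" and ?R = "elem d 2 1 1 * elem d 1 0 1" and ?S = "elem d 2 0 1"
    have cP: "?P \<in> carrier (SL d)" "?R \<in> carrier (SL d)" "?S \<in> carrier (SL d)"
      using e[of 1 0] e[of 2 1] e[of 2 0] SL_mult_closed by auto
    have RSP: "f ?R = f ?S * f ?P"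
      using elem_commutator[of 2 d 1 0 1 1] d f_mult[OF cP(3,1)] by simp
    have "?P * ?S = ?S * ?P"
      by (rule mult_commutes[where d = d]) (use d elem_comm[of 1 d 0 2 0 1 1] elem_comm[of 2 d 1 2 0 1 1] in auto)
    then have PS: "f ?P * f ?S = f ?S * f ?P" by (rule f_rel) (use cP in auto)
    have SS: "f ?S * f ?S = 1\<^sub>m d" using sq[of 2 0] f_mult[OF cP(3,3)] d by simp
    note fc = f_carrier[OF cP(1)] f_carrier[OF cP(3)]
    have "f ?R * f ?R = f ?S * ((f ?P * f ?S) * f ?P)"
      unfolding RSP using fc by (simp add: assoc_sq mult_sq)
    also have "\<dots> = (f ?S * f ?S) * (f ?P * f ?P)"
      unfolding PS using fc by (simp add: assoc_sq mult_sq)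
    also have "\<dots> = f ?P * f ?P" unfolding SS using fc by (simp add: mult_sq)
    finally have "f (?R * ?R) = f (?P * ?P)" using f_mult cP by simp
    then have gRP: "g (?R * ?R) 1 0 = g (?P * ?P) 1 0" using cong by metis
    have P: "g ?P k l = X k 0 * Y 0 l + X k 1 * Y 1 l + X k 2 * Y 2 l" if "k < d" "l < d" for k l
      using mult[OF e[of 1 0] e[of 2 1] that] by (simp add: X_def Y_def)
    have R: "g ?R k l = Y k 0 * X 0 l + Y k 1 * X 1 l + Y k 2 * X 2 l" if "k < d" "l < d" for k l
      using mult[OF e[of 2 1] e[of 1 0] that] by (simp add: X_def Y_def)
    define z zi h E where "z = Y 0 1" and "zi = Y 1 0" and "h = Y 2 2" and "E = X 1 0"
    have Pe: "g ?P 1 0 = 0" "g ?P 1 2 = X 1 2 * h" "g ?P 2 0 = X 2 1 * zi"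
      using P[of 1 0] P[of 1 2] P[of 2 0] Y0 X11 d by (auto simp: z_def zi_def h_def)
    have Re: "g ?R 1 0 = zi * X 0 0" "g ?R 0 0 = z * E" "g ?R 1 1 = zi * X 0 1" "g ?R 1 2 = zi * X 0 2"
      "g ?R 2 0 = h * X 2 0"
      using R[of 1 0] R[of 0 0] R[of 1 1] R[of 1 2] R[of 2 0] Y0 d by (auto simp: z_def zi_def h_def E_def)
    have "g (?P * ?P) 1 0 = X 1 2 * h * (X 2 1 * zi) + g ?P 1 1 * 0"
      using mult[OF cP(1,1), of 1 0] Pe d by simp
    also have "\<dots> = h * zi / 2" using xBE(2) by (simp add: field_simps)
    finally have e1: "g (?P * ?P) 1 0 = h * zi / 2" .
    have "g (?R * ?R) 1 0 = zi * X 0 0 * (z * E) + zi * X 0 1 * (zi * X 0 0) + zi * (X 0 2 * X 2 0) * h"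
      using mult[OF cP(2,2), of 1 0] Re d by (simp add: mult_ac)
    also have "\<dots> = zi * (X 0 0 * (z * E + zi * X 0 1) + h / 4)"
      unfolding C2 C4 by (simp add: algebra_simps)
    finally have "zi * (X 0 0 * (z * E + zi * X 0 1) + h / 4) = zi * (h / 2)" using e1 gRP by simp
    moreover have zz: "z * zi = 1" using Ysq(1) by (simp add: z_def zi_def)
    ultimately have k: "X 0 0 * (z * E + zi * X 0 1) = h / 4" by auto
    define s t where "s = z * E" and "t = zi * X 0 1"
    have st: "s * t = 1 / 2"
    proof -
      have "s * t = (z * zi) * (X 0 1 * X 1 0)" by (simp add: s_def t_def E_def mult_ac)
      then show ?thesis using zz xBE by simp
    qed
    have "(X 0 0 * X 0 0) * ((s + t) * (s + t)) = (X 0 0 * (s + t)) * (X 0 0 * (s + t))" by (simp add: mult_ac)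
    also have "\<dots> = (h * h) / 16" unfolding s_def t_def k by simp
    also have "h * h = 1" using Ysq(2) by (simp add: h_def)
    finally have "(s + t) * (s + t) = 1 / 4" unfolding C4 by simp
    \<comment> \<open>The negative discriminant shows up as a sum of two rational squares equal to
      \<open>-3/4\<close>.\<close>
    then have "s * s + t * t = 1 / 4 - 1" using st by (simp add: algebra_simps)
    moreover have "0 \<le> s * s" "0 \<le> t * t" by auto
    ultimately show False by linarith
  qed
qed

lemma flip_nontrivial: "f (flip d 0 1) \<noteq> 1\<^sub>m d"
  using flip_nontrivial_three flip_nontrivial_ge4 d3 by (cases "d = 3") auto

end

section \<open>Weights of pair type in dimension four\<close>

text \<open>Matrices of the quaternion units: by \<open>quat_quat\<close> they square to
  \<open>-1\<close>, anticommute and satisfy \<open>quat 1 * quat 2 = quat 3\<close>. The orders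
  \<open>3 2\<close>, \<open>1 3\<close>, \<open>2 1\<close> in the second factors fix the
  signs.\<close>

definition quat :: "nat \<Rightarrow> int mat" where
  "quat i = (if i = 1 then weyl 4 0 1 * weyl 4 3 2 else if i = 2 then weyl 4 0 2 * weyl 4 1 3 else weyl 4 0 3 * weyl 4 2 1)"

definition minus_one :: "int mat" where
  "minus_one = diag_of 4 (\<lambda>_. -1)"

lemma mat4_eqI:
  assumes "A \<in> carrier_mat 4 4" "B \<in> carrier_mat 4 4"
    and "\<And>r c. r \<in> {0,1,2,3} \<Longrightarrow> c \<in> {0,1,2,3} \<Longrightarrow> A $$ (r,c) = B $$ (r,c)"
  shows "A = B"
proof (rule eq_matI)
  have lt: "i < 4 \<Longrightarrow> i \<in> {0,1,2,3}" for i :: nat by auto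
  show "A $$ (i,j) = B $$ (i,j)" if "i < dim_row B" "j < dim_col B" for i j
    using assms that lt[of i] lt[of j] by auto
qed (use assms in auto)

lemma quat_carrier [simp]: "quat i \<in> carrier_mat 4 4"
  by (auto simp: quat_def intro!: mult_carrier_mat[of _ 4 4 _ 4])

lemma minus_one_carrier [simp]: "minus_one \<in> carrier_mat 4 4"
  by (simp add: minus_one_def)

lemma quat_SL: "quat i \<in> carrier (SL 4)"
  by (auto simp: quat_def intro!: SL_mult_closed weyl_SL)

lemma minus_one_flip: "minus_one = flip 4 0 1 * flip 4 2 3"
  unfolding minus_one_def flip_def diag_of_diag_of by (intro mat4_eqI) (auto simp: diag_of_def sgn_on_def)

lemma minus_one_SL: "minus_one \<in> carrier (SL 4)"
  unfolding minus_one_flip by (intro SL_mult_closed flip_SL) auto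

lemma minus_one_mult: "M \<in> carrier_mat 4 4 \<Longrightarrow> minus_one * M = mat 4 4 (\<lambda>(r,c). - M $$ (r,c))"
  unfolding minus_one_def by (subst diag_of_mult) auto

lemmas unfold4 = quat_def flip_def assoc_mult_mat[of _ 4 4 _ 4 _ 4] mult_carrier_mat[of _ 4 4 _ 4]
lemmas mult4 = weyl_mult minus_one_mult diag_of_mult elem_mult

text \<open>The relations hold up to \<open>minus_one\<close>, so after \<open>f\<close> kills
  \<open>-1\<close> sign matrices and quaternion units form one commuting family of
  involutions.\<close>

lemma quat_flip:
  "quat 1 * flip 4 0 1 = flip 4 0 1 * quat 1" "quat 1 * flip 4 0 2 = minus_one * (flip 4 0 2 * quat 1)"
  "quat 1 * flip 4 0 3 = minus_one * (flip 4 0 3 * quat 1)"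
  "quat 2 * flip 4 0 1 = minus_one * (flip 4 0 1 * quat 2)" "quat 2 * flip 4 0 2 = flip 4 0 2 * quat 2"
  "quat 2 * flip 4 0 3 = minus_one * (flip 4 0 3 * quat 2)"
  "quat 3 * flip 4 0 1 = minus_one * (flip 4 0 1 * quat 3)" "quat 3 * flip 4 0 2 = minus_one * (flip 4 0 2 * quat 3)"
  "quat 3 * flip 4 0 3 = flip 4 0 3 * quat 3"
  unfolding atomize_conj
  apply (intro conjI; simp add: unfold4)
  apply (simp_all add: mult4)
  apply (rule mat4_eqI, simp, simp, auto simp: weyl_index diag_of_def sgn_on_def)+
  done

lemma quat_quat:
  "quat 1 * quat 1 = minus_one * 1\<^sub>m 4" "quat 2 * quat 2 = minus_one * 1\<^sub>m 4" "quat 3 * quat 3 = minus_one * 1\<^sub>m 4"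
  "quat 1 * quat 2 = minus_one * (quat 2 * quat 1)" "quat 1 * quat 3 = minus_one * (quat 3 * quat 1)" "quat 2 * quat 3 = minus_one * (quat 3 * quat 2)"
  "quat 1 * quat 2 = quat 3"
  unfolding atomize_conj
  apply (intro conjI; simp add: unfold4)
  apply (simp_all add: mult4)
  apply (rule mat4_eqI, simp, simp, auto simp: weyl_index diag_of_def sgn_on_def)+
  done

lemma quat_weyl:
  "weyl 4 1 2 * quat 1 = minus_one * (quat 2 * weyl 4 1 2)" "weyl 4 1 2 * quat 2 = quat 1 * weyl 4 1 2"
  "weyl 4 1 2 * quat 3 = quat 3 * weyl 4 1 2" "weyl 4 2 3 * quat 1 = quat 1 * weyl 4 2 3"
  "weyl 4 2 3 * quat 2 = minus_one * (quat 3 * weyl 4 2 3)" "weyl 4 2 3 * quat 3 = quat 2 * weyl 4 2 3"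
  unfolding atomize_conj
  apply (intro conjI; simp add: unfold4)
  apply (simp_all add: mult4)
  apply (rule mat4_eqI, simp, simp, auto simp: weyl_index diag_of_def sgn_on_def)+
  done

text \<open>Conjugation by a quaternion unit moves \<open>e_02\<close> to \<open>e_13\<close> up to
  sign. A unit in the kernel thus identifies a matrix not commuting with \<open>e_23\<close> with
  one that does.\<close>

lemma quat_elem:
  "quat 1 * elem 4 0 2 1 = elem 4 1 3 (-1) * quat 1"
  "(quat 1 * flip 4 0 1) * elem 4 0 2 1 = elem 4 1 3 1 * (quat 1 * flip 4 0 1)"
  unfolding atomize_conj
  apply (intro conjI; simp add: unfold4)
  apply (simp_all add: mult4)
  apply (rule mat4_eqI, simp, simp, auto simp: weyl_index diag_of_def sgn_on_def)+
  done

text \<open>The case left over when a pair weight occurs: \<open>-1\<close> acts trivially on a pair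
  weight, and a nontrivial action elsewhere is excluded by counting in
  \<open>no_pair_type\<close>.\<close>

locale sl4_hom = sl_hom 4 f for f +
  assumes minus_one_trivial: "f minus_one = 1\<^sub>m 4"
begin

lemma flip_0_SL: "i \<in> {1,2,3} \<Longrightarrow> flip 4 0 i \<in> carrier (SL 4)"
  by (rule flip_SL) auto

lemma act_minus_one: "v \<in> carrier_vec 4 \<Longrightarrow> act minus_one v = v"
  by (simp add: act_def minus_one_trivial)

lemma act_rel_minus_one:
  assumes "A * B = C * D \<or> A * B = minus_one * (C * D)"
    "A \<in> carrier (SL 4)" "B \<in> carrier (SL 4)" "C \<in> carrier (SL 4)" "D \<in> carrier (SL 4)" "v \<in> carrier_vec 4"
  shows "act A (act B v) = act C (act D v)"
proof -
  have "act (A * B) v = act (C * D) v"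
    using assms(1) act_mult[OF minus_one_SL SL_mult_closed[OF assms(4,5)] assms(6)]
      act_minus_one[OF act_carrier[OF SL_mult_closed[OF assms(4,5)]]] by metis
  then show ?thesis using act_mult[OF assms(2,3,6)] act_mult[OF assms(4,5,6)] by simp
qed

lemma quat_sq:
  assumes "i \<in> {1,2,3}" "v \<in> carrier_vec 4"
  shows "act (quat i) (act (quat i) v) = v"
proof -
  have "act (quat i) (act (quat i) v) = act (1\<^sub>m 4) (act (1\<^sub>m 4) v)"
    by (rule act_rel_minus_one) (use assms quat_quat(1-3) quat_SL one_SL in auto)
  then show ?thesis using act_one assms(2) by simp
qed

lemma quat_comm:
  assumes "i \<in> {1,2,3}" "j \<in> {1,2,3}" "v \<in> carrier_vec 4"
  shows "act (quat i) (act (quat j) v) = act (quat j) (act (quat i) v)"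
proof -
  have lt: "act (quat i) (act (quat j) v) = act (quat j) (act (quat i) v)"
    if "i \<in> {1,2,3}" "j \<in> {1,2,3}" "i < j" for i j
    by (rule act_rel_minus_one) (use that assms(3) quat_quat(4-6) quat_SL in auto)
  show ?thesis using lt[of i j] lt[of j i] assms(1,2) by (cases i j rule: linorder_cases) auto
qed

lemma quat_flip_comm:
  assumes "i \<in> {1,2,3}" "j \<in> {1,2,3}" "v \<in> carrier_vec 4"
  shows "act (quat i) (act (flip 4 0 j) v) = act (flip 4 0 j) (act (quat i) v)"
  by (rule act_rel_minus_one) (use assms quat_flip flip_0_SL quat_SL in auto)

lemma flip_flip_comm:
  assumes "i \<in> {1,2,3}" "j \<in> {1,2,3}" "v \<in> carrier_vec 4"
  shows "act (flip 4 0 i) (act (flip 4 0 j) v) = act (flip 4 0 j) (act (flip 4 0 i) v)"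
  by (rule act_rel[OF flip_comm]) (use assms flip_0_SL in auto)

text \<open>The diagonal sign matrices and the \<open>quat i\<close> generate, modulo \<open>-1\<close>, the elementary abelian
  group of order 16 that is the product of the left and right quaternion units of \<open>SO(4)\<close>; \<open>(p,q)\<close>
  with \<open>p, q \<le> 3\<close> encodes a character of it.\<close>

definition v4_char :: "nat \<Rightarrow> nat \<Rightarrow> int" where
  "v4_char p i = (if p = 0 \<or> p = i then 1 else -1)"

definition char_vec :: "nat \<Rightarrow> nat \<Rightarrow> int vec \<Rightarrow> bool" where
  "char_vec p q v \<longleftrightarrow> v \<in> carrier_vec 4 \<and> v \<noteq> 0\<^sub>v 4 \<and>
    (\<forall>i\<in>{1,2,3}. act (flip 4 0 i) v = v4_char p i \<cdot>\<^sub>v v \<and> act (quat i) v = v4_char q i \<cdot>\<^sub>v v)"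

definition chars :: "(nat \<times> nat) set" where
  "chars = {(p,q). p \<le> 3 \<and> q \<le> 3 \<and> (\<exists>v. char_vec p q v)}"

lemma smult_cancel_vec:
  assumes "a \<cdot>\<^sub>v v = b \<cdot>\<^sub>v v" "v \<in> carrier_vec 4" "v \<noteq> 0\<^sub>v 4"
  shows "a = (b::int)"
proof -
  obtain r where r: "r < 4" "v $ r \<noteq> 0" using assms(2,3) by (metis carrier_vecD eq_vecI index_zero_vec)
  then have "a * v $ r = b * v $ r" using arg_cong[OF assms(1), of "\<lambda>w. w $ r"] assms(2) by simp
  then show ?thesis using r by simp
qed

lemma v4_char_surj:
  assumes "a1 = 1 \<or> a1 = -1" "a2 = 1 \<or> a2 = -1" "a3 = a1 * a2"
  obtains p where "p \<le> 3" "v4_char p 1 = a1" "v4_char p 2 = a2" "v4_char p 3 = a3"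
  using assms that[of 0] that[of 1] that[of 2] that[of 3] by (auto simp: v4_char_def)

text \<open>Makes a nontrivial involution visible in some character. It is applied to
  \<open>flip 4 0 1\<close>, to \<open>quat 1\<close> and to their product. Since \<open>-1\<close>
  acts trivially, the eigenvalues multiply like a character of two Klein four-groups, hence a label
  \<open>(p,q)\<close> exists.\<close>

lemma char_vec_exists:
  assumes A: "A \<in> carrier (SL 4)" "f A \<noteq> 1\<^sub>m 4" "\<And>v. v \<in> carrier_vec 4 \<Longrightarrow> act A (act A v) = v"
    and commt: "\<And>i v. i \<in> {1,2,3} \<Longrightarrow> v \<in> carrier_vec 4 \<Longrightarrow> act A (act (flip 4 0 i) v) = act (flip 4 0 i) (act A v)"
    and commz: "\<And>i v. i \<in> {1,2,3} \<Longrightarrow> v \<in> carrier_vec 4 \<Longrightarrow> act A (act (quat i) v) = act (quat i) (act A v)"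
  obtains p q v where "(p,q) \<in> chars" "char_vec p q v" "act A v = (-1) \<cdot>\<^sub>v v"
proof -
  let ?L = "(\<lambda>i. flip 4 0 i) ` {1,2,3} \<union> quat ` {1,2,3}"
  have L: "B \<in> ?L \<Longrightarrow> \<exists>i\<in>{1,2,3}. B = flip 4 0 i \<or> B = quat i" for B by blast
  have tsq: "act (flip 4 0 i) (act (flip 4 0 i) v) = v" if "i \<in> {1,2,3}" "v \<in> carrier_vec 4" for i v
    using flip_act_sq[of 0 i v] that by auto
  have comm: "act B (act C v) = act C (act B v)" if "B \<in> ?L" "C \<in> ?L" "v \<in> carrier_vec 4" for B C v
    using L[OF that(1)] L[OF that(2)] that(3) flip_flip_comm quat_flip_comm quat_comm by metis
  obtain v where v: "v \<in> carrier_vec 4" "v \<noteq> 0\<^sub>v 4" "act A v = - v"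
    and pm: "\<And>B. B \<in> ?L \<Longrightarrow> act B v = v \<or> act B v = - v"
  proof (rule joint_eigenvector_minus[of ?L A])
    show "finite ?L" "?L \<subseteq> carrier (SL 4)" using flip_0_SL quat_SL by auto
    show "act B (act B v) = v" if "B \<in> ?L" "v \<in> carrier_vec 4" for B v
      using L[OF that(1)] that(2) tsq quat_sq by metis
    show "act A (act B v) = act B (act A v)" if "B \<in> ?L" "v \<in> carrier_vec 4" for B v
      using L[OF that(1)] that(2) commt commz by metis
    show "act B (act C v) = act C (act B v)" if "B \<in> ?L" "C \<in> ?L" "v \<in> carrier_vec 4" for B C v
      by (rule comm[OF that])
    show "A \<in> carrier (SL 4)" "f A \<noteq> 1\<^sub>m 4" by (fact A)+
    show "act A (act A v) = v" if "v \<in> carrier_vec 4" for v by (rule A(3)[OF that])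
  qed (rule that)
  have sgn: "\<exists>a. act B v = a \<cdot>\<^sub>v v \<and> (a = 1 \<or> a = -1)" if "B \<in> ?L" for B
    using pm_smult[OF pm[OF that] v(1)] by (metis (full_types))
  have prod: "a3 = a1 * a2"
    if "act B v = a1 \<cdot>\<^sub>v v" "act C v = a2 \<cdot>\<^sub>v v" "act D v = a3 \<cdot>\<^sub>v v"
      "B * C = D \<or> B * C = minus_one * D" "B \<in> carrier (SL 4)" "C \<in> carrier (SL 4)" "D \<in> carrier (SL 4)"
    for B C D a1 a2 a3
  proof -
    have "D * 1\<^sub>m 4 = D" using SL_carrier_mat[OF that(7)] by simp
    then have "act B (act C v) = act D (act (1\<^sub>m 4) v)"
      by (intro act_rel_minus_one[OF _ that(5,6,7) one_SL v(1)]) (use that(4) in simp)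
    also have "act (1\<^sub>m 4) v = v" by (rule act_one[OF v(1)])
    finally have "a2 \<cdot>\<^sub>v (a1 \<cdot>\<^sub>v v) = a3 \<cdot>\<^sub>v v"
      unfolding that(2,3) act_smult[OF that(5) v(1)] that(1) .
    then have "a3 = a2 * a1" unfolding smult_smult_assoc by (rule smult_cancel_vec[OF _ v(1,2), symmetric])
    then show ?thesis by (simp add: mult.commute)
  qed
  have B: "flip 4 0 1 \<in> ?L" "flip 4 0 2 \<in> ?L" "flip 4 0 3 \<in> ?L" "quat 1 \<in> ?L" "quat 2 \<in> ?L" "quat 3 \<in> ?L" by auto
  obtain t1 where t1: "act (flip 4 0 1) v = t1 \<cdot>\<^sub>v v" "t1 = 1 \<or> t1 = -1" using sgn[OF B(1)] by blast
  obtain t2 where t2: "act (flip 4 0 2) v = t2 \<cdot>\<^sub>v v" "t2 = 1 \<or> t2 = -1" using sgn[OF B(2)] by blast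
  obtain t3 where t3: "act (flip 4 0 3) v = t3 \<cdot>\<^sub>v v" using sgn[OF B(3)] by blast
  obtain z1 where z1: "act (quat 1) v = z1 \<cdot>\<^sub>v v" "z1 = 1 \<or> z1 = -1" using sgn[OF B(4)] by blast
  obtain z2 where z2: "act (quat 2) v = z2 \<cdot>\<^sub>v v" "z2 = 1 \<or> z2 = -1" using sgn[OF B(5)] by blast
  obtain z3 where z3: "act (quat 3) v = z3 \<cdot>\<^sub>v v" using sgn[OF B(6)] by blast
  have "flip 4 0 1 * flip 4 0 2 = minus_one * flip 4 0 3"
    unfolding flip_def minus_one_def diag_of_diag_of by (rule mat4_eqI) (auto simp: diag_of_def sgn_on_def)
  then have "t3 = t1 * t2" using prod[OF t1(1) t2(1) t3] flip_0_SL by auto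
  then obtain p where p: "p \<le> 3" "v4_char p 1 = t1" "v4_char p 2 = t2" "v4_char p 3 = t3"
    by (rule v4_char_surj[OF t1(2) t2(2)])
  have "z3 = z1 * z2" using prod[OF z1(1) z2(1) z3] quat_SL quat_quat(7) by auto
  then obtain q where q: "q \<le> 3" "v4_char q 1 = z1" "v4_char q 2 = z2" "v4_char q 3 = z3"
    by (rule v4_char_surj[OF z1(2) z2(2)])
  have "char_vec p q v" unfolding char_vec_def using v p q t1 t2 t3 z1 z2 z3 by simp
  moreover have "act A v = (-1) \<cdot>\<^sub>v v" unfolding v(3) by (rule eq_vecI) auto
  ultimately show thesis using that[of p q v] p q by (auto simp: chars_def)
qed

text \<open>Distinct labels differ on some \<open>flip 4 0 i\<close> or \<open>quat i\<close>, so
  their vectors are independent in dimension four.\<close>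

lemma chars_card: "card chars \<le> 4" "finite chars"
proof -
  have "chars \<subseteq> {0..3} \<times> {0..3}" by (auto simp: chars_def)
  then show fin: "finite chars" using finite_subset by blast
  have "\<forall>e. \<exists>v. e \<in> chars \<longrightarrow> char_vec (fst e) (snd e) v" by (auto simp: chars_def)
  then obtain x where x: "\<forall>e. e \<in> chars \<longrightarrow> char_vec (fst e) (snd e) (x e)" by (rule choice[THEN exE])
  have v4_char_sep: "\<exists>i\<in>{1,2,3}. v4_char p i \<noteq> v4_char p' i" if "p \<le> 3" "p' \<le> 3" "p \<noteq> p'" for p p'
  proof -
    have "p = 0 \<or> p = 1 \<or> p = 2 \<or> p = 3" "p' = 0 \<or> p' = 1 \<or> p' = 2 \<or> p' = 3" using that by auto
    then show ?thesis using that(3) by (elim disjE) (simp_all add: v4_char_def)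
  qed
  show "card chars \<le> 4"
  proof (rule act_card_le[OF fin, of x])
    show "x e \<in> carrier_vec 4 \<and> x e \<noteq> 0\<^sub>v 4" if "e \<in> chars" for e
      using x that unfolding char_vec_def by blast
    fix e e' assume e: "e \<in> chars" "e' \<in> chars" "e \<noteq> e'"
    have le: "fst e \<le> 3" "snd e \<le> 3" "fst e' \<le> 3" "snd e' \<le> 3" using e by (auto simp: chars_def)
    show "\<exists>A \<in> carrier (SL 4). \<exists>\<chi>. (\<forall>m\<in>chars. act A (x m) = \<chi> m \<cdot>\<^sub>v x m) \<and> \<chi> e \<noteq> \<chi> e'"
    proof (cases "fst e = fst e'")
      case False
      then obtain i where i: "i \<in> {1,2,3}" "v4_char (fst e) i \<noteq> v4_char (fst e') i" using v4_char_sep[OF le(1,3)] by blast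
      then show ?thesis using x flip_0_SL
        by (intro bexI[of _ "flip 4 0 i"] exI[of _ "\<lambda>e. v4_char (fst e) i"]) (auto simp: char_vec_def)
    next
      case True
      then have "snd e \<noteq> snd e'" using e by (auto simp: prod_eq_iff)
      then obtain i where i: "i \<in> {1,2,3}" "v4_char (snd e) i \<noteq> v4_char (snd e') i" using v4_char_sep[OF le(2,4)] by blast
      then show ?thesis using x quat_SL
        by (intro bexI[of _ "quat i"] exI[of _ "\<lambda>e. v4_char (snd e) i"]) (auto simp: char_vec_def)
    qed
  qed
qed

text \<open>\<open>weyl 4 j k\<close> permutes the matrices \<open>flip 4 0 i\<close> and, up to
  \<open>-1\<close>, the \<open>quat i\<close> by the same transposition. So the symmetric group on
  1, 2, 3 acts diagonally on labels.\<close>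

lemma chars_transpose:
  assumes e: "(p,q) \<in> chars" and jk: "(j,k) = (1,2) \<or> (j,k) = (2,3)"
  shows "(transpose j k p, transpose j k q) \<in> chars"
proof -
  obtain v where v: "char_vec p q v" using e by (auto simp: chars_def)
  have jk': "j < 4" "k < 4" "j \<noteq> k" "0 < j" "0 < k" using jk by auto
  have w: "weyl 4 j k \<in> carrier (SL 4)" by (rule weyl_SL[OF jk'(3)])
  have vc: "v \<in> carrier_vec 4" "v \<noteq> 0\<^sub>v 4" using v by (auto simp: char_vec_def)
  have v4_char_tr: "v4_char (transpose j k m) i = v4_char m (transpose j k i)" for m i
  proof -
    have "transpose j k m = 0 \<longleftrightarrow> m = 0" using jk' by (auto simp: transpose_def)
    moreover have "transpose j k m = i \<longleftrightarrow> m = transpose j k i" by (metis transpose_involutory)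
    ultimately show ?thesis by (simp add: v4_char_def)
  qed
  have "char_vec (transpose j k p) (transpose j k q) (act (weyl 4 j k) v)"
    unfolding char_vec_def
  proof (intro conjI ballI)
    show "act (weyl 4 j k) v \<in> carrier_vec 4" by (rule act_carrier[OF w])
    show "act (weyl 4 j k) v \<noteq> 0\<^sub>v 4" by (rule act_nonzero[OF w vc])
    fix i :: nat assume i: "i \<in> {1,2,3}"
    let ?i = "transpose j k i"
    have i': "?i \<in> {1,2,3}" using i jk by (auto simp: transpose_def)
    have "weyl 4 j k * flip 4 0 ?i = flip 4 0 i * weyl 4 j k"
      using weyl_flip[OF jk'(1-3), of 0 ?i] jk' by simp
    then have "act (flip 4 0 i) (act (weyl 4 j k) v) = act (weyl 4 j k) (act (flip 4 0 ?i) v)"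
      by (intro act_rel_minus_one) (use w flip_0_SL[OF i] flip_0_SL[OF i'] vc in auto)
    also have "act (flip 4 0 ?i) v = v4_char p ?i \<cdot>\<^sub>v v" using v i' by (auto simp: char_vec_def)
    finally show "act (flip 4 0 i) (act (weyl 4 j k) v) = v4_char (transpose j k p) i \<cdot>\<^sub>v act (weyl 4 j k) v"
      using act_smult[OF w vc(1)] v4_char_tr by simp
    have tr: "transpose 1 2 1 = (2::nat)" "transpose 1 2 2 = (1::nat)" "transpose 1 2 3 = (3::nat)"
      "transpose 2 3 1 = (1::nat)" "transpose 2 3 2 = (3::nat)" "transpose 2 3 3 = (2::nat)"
      by (simp_all add: transpose_def)
    have "weyl 4 j k * quat ?i = quat i * weyl 4 j k \<or> weyl 4 j k * quat ?i = minus_one * (quat i * weyl 4 j k)"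
      using jk i by (elim disjE insertE emptyE Pair_inject; simp only: tr quat_weyl simp_thms)
    then have "act (weyl 4 j k) (act (quat ?i) v) = act (quat i) (act (weyl 4 j k) v)"
      by (intro act_rel_minus_one) (use w quat_SL vc in auto)
    moreover have "act (quat ?i) v = v4_char q ?i \<cdot>\<^sub>v v" using v i' by (auto simp: char_vec_def)
    ultimately show "act (quat i) (act (weyl 4 j k) v) = v4_char (transpose j k q) i \<cdot>\<^sub>v act (weyl 4 j k) v"
      using act_smult[OF w vc(1)] v4_char_tr by simp
  qed
  moreover have "transpose j k m \<le> 3" if "m \<le> 3" for m using jk that by (auto simp: transpose_def)
  ultimately show ?thesis using e by (auto simp: chars_def)
qed

lemma not_six:
  assumes "Y \<subseteq> chars" "card Y = 6"
  shows False
  using card_mono[OF chars_card(2) assms(1)] chars_card(1) assms(2) by simp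

lemma chars_orbit:
  assumes h: "h = (\<lambda>k. (k,0)) \<or> h = (\<lambda>k. (0,k)) \<or> h = (\<lambda>k. (k,k))"
    and k: "h k \<in> chars" "k \<in> {1,2,3}" and m: "m \<in> {1,2,3}"
  shows "h m \<in> chars"
proof -
  have s: "h (transpose i j k) \<in> chars" if "h k \<in> chars" "(i,j) = (1,2) \<or> (i,j) = (2,3)" for i j k
    using chars_transpose[OF _ that(2), of "fst (h k)" "snd (h k)"] that h by auto
  have "h 1 \<in> chars \<Longrightarrow> h 2 \<in> chars" "h 2 \<in> chars \<Longrightarrow> h 1 \<in> chars" "h 2 \<in> chars \<Longrightarrow> h 3 \<in> chars" "h 3 \<in> chars \<Longrightarrow> h 2 \<in> chars"
    using s[of 1 1 2] s[of 2 1 2] s[of 2 2 3] s[of 3 2 3] by simp_all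
  then show ?thesis using k m by auto
qed

text \<open>Two distinct nonzero labels have an orbit of six pairs, more than the four characters
  available.\<close>

lemma chars_diff: "(p,q) \<in> chars \<Longrightarrow> p = 0 \<or> q = 0 \<or> p = q"
proof (rule ccontr)
  assume e: "(p,q) \<in> chars" and ne: "\<not> (p = 0 \<or> q = 0 \<or> p = q)"
  have s: "(transpose j k p, transpose j k q) \<in> chars" if "(p,q) \<in> chars" "(j,k) = (1,2) \<or> (j,k) = (2,3)" for p q j k
    by (rule chars_transpose[OF that])
  have step: "(1,2) \<in> chars \<Longrightarrow> (2,1) \<in> chars" "(2,1) \<in> chars \<Longrightarrow> (3,1) \<in> chars" "(3,1) \<in> chars \<Longrightarrow> (3,2) \<in> chars"
    "(3,2) \<in> chars \<Longrightarrow> (2,3) \<in> chars" "(2,3) \<in> chars \<Longrightarrow> (1,3) \<in> chars" "(1,3) \<in> chars \<Longrightarrow> (1,2) \<in> chars"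
    using s[of 1 2 1 2] s[of 2 1 2 3] s[of 3 1 1 2] s[of 3 2 2 3] s[of 2 3 1 2] s[of 1 3 2 3] by simp_all
  have "p \<le> 3" "q \<le> 3" using e by (auto simp: chars_def)
  then have "p = 1 \<or> p = 2 \<or> p = 3" "q = 1 \<or> q = 2 \<or> q = 3" using ne by auto
  then have "(1,2) \<in> chars \<or> (2,1) \<in> chars \<or> (1,3) \<in> chars \<or> (3,1) \<in> chars \<or> (2,3) \<in> chars \<or> (3,2) \<in> chars"
    using e ne by (elim disjE) simp_all
  then have "{(1,2),(2,1),(1,3),(3,1),(2,3),(3,2)} \<subseteq> chars" using step by blast
  then show False by (rule not_six) simp
qed

text \<open>Each family is an orbit of three characters, and two of them would already give
  six.\<close>

lemma chars_two_orbits: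
  assumes "h = (\<lambda>k. (k,0)) \<or> h = (\<lambda>k. (0,k)) \<or> h = (\<lambda>k. (k,k))"
    "h' = (\<lambda>k. (k,0)) \<or> h' = (\<lambda>k. (0,k)) \<or> h' = (\<lambda>k. (k,k))"
    "h k \<in> chars" "k \<in> {1,2,3}" "h' k' \<in> chars" "k' \<in> {1,2,3}"
  shows "h = h'"
proof (rule ccontr)
  assume ne: "h \<noteq> h'"
  have "{h 1, h 2, h 3, h' 1, h' 2, h' 3} \<subseteq> chars"
    using chars_orbit[OF assms(1,3,4)] chars_orbit[OF assms(2,5,6)] by simp
  moreover have "card {h 1, h 2, h 3, h' 1, h' 2, h' 3} = 6"
    using assms(1,2) ne by (elim disjE) simp_all
  ultimately show False by (rule not_six)
qed

text \<open>Otherwise \<open>flip 4 0 1\<close>, \<open>quat 1\<close> and their product each act as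
  \<open>-1\<close> on some character, which requires labels with \<open>p \<noteq> 0\<close>, with
  \<open>q \<noteq> 0\<close> and with \<open>p \<noteq> q\<close>. Only one of the families
  \<open>(k,0)\<close>, \<open>(0,k)\<close>, \<open>(k,k)\<close> can occur with
  \<open>k \<noteq> 0\<close>, and each fails one requirement.\<close>

lemma trivial_quaternion: "f (quat 1) = 1\<^sub>m 4 \<or> f (quat 1 * flip 4 0 1) = 1\<^sub>m 4"
proof (rule ccontr)
  assume no: "\<not> ?thesis"
  have t1: "1 \<in> {1,2,3::nat}" by simp
  have zt: "quat 1 * flip 4 0 1 \<in> carrier (SL 4)" by (intro SL_mult_closed quat_SL flip_0_SL) simp
  have act_zt: "act (quat 1 * flip 4 0 1) v = act (quat 1) (act (flip 4 0 1) v)" if "v \<in> carrier_vec 4" for v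
    by (rule act_mult[OF quat_SL flip_0_SL[OF t1] that])
  note c = act_carrier[OF quat_SL] act_carrier[OF flip_0_SL]
  obtain p q v where 1: "(p,q) \<in> chars" "char_vec p q v" "act (flip 4 0 1) v = (-1) \<cdot>\<^sub>v v"
    by (rule char_vec_exists[OF flip_0_SL[OF t1]])
      (use flip_nontrivial flip_act_sq[of 0 1] flip_flip_comm quat_flip_comm in auto)
  obtain p' q' v' where 2: "(p',q') \<in> chars" "char_vec p' q' v'" "act (quat 1) v' = (-1) \<cdot>\<^sub>v v'"
    by (rule char_vec_exists[OF quat_SL[of 1]]) (use no quat_sq quat_comm quat_flip_comm in auto)
  obtain p'' q'' v'' where 3: "(p'',q'') \<in> chars" "char_vec p'' q'' v''" "act (quat 1 * flip 4 0 1) v'' = (-1) \<cdot>\<^sub>v v''"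
  proof (rule char_vec_exists[OF zt])
    show "f (quat 1 * flip 4 0 1) \<noteq> 1\<^sub>m 4" using no by blast
    show "act (quat 1 * flip 4 0 1) (act (quat 1 * flip 4 0 1) v) = v" if "v \<in> carrier_vec 4" for v
      using act_zt act_carrier[OF zt] quat_flip_comm[OF t1 t1] quat_sq[OF t1] flip_act_sq[of 0 1] that c(2)[OF t1] c(1) by simp
    show "act (quat 1 * flip 4 0 1) (act (flip 4 0 i) v) = act (flip 4 0 i) (act (quat 1 * flip 4 0 1) v)"
      if "i \<in> {1,2,3}" "v \<in> carrier_vec 4" for i v
      using act_zt c that flip_flip_comm[OF t1 that] quat_flip_comm[OF t1 that(1) c(2)[OF t1]] by simp
    show "act (quat 1 * flip 4 0 1) (act (quat i) v) = act (quat i) (act (quat 1 * flip 4 0 1) v)"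
      if "i \<in> {1,2,3}" "v \<in> carrier_vec 4" for i v
      using act_zt c that quat_flip_comm[OF that(1) t1 that(2), symmetric] quat_comm[OF t1 that(1) c(2)[OF t1]] by simp
  qed blast
  have ev: "act (flip 4 0 1) v = v4_char p 1 \<cdot>\<^sub>v v" "act (quat 1) v = v4_char q 1 \<cdot>\<^sub>v v" "v \<in> carrier_vec 4" "v \<noteq> 0\<^sub>v 4"
    if "char_vec p q v" for p q v using that by (auto simp: char_vec_def)
  have "v4_char p 1 = -1" using smult_cancel_vec[OF _ ev(3,4)[OF 1(2)]] ev(1)[OF 1(2)] 1(3) by metis
  then have p: "p \<noteq> 0" by (auto simp: v4_char_def split: if_splits)
  have "v4_char q' 1 = -1" using smult_cancel_vec[OF _ ev(3,4)[OF 2(2)]] ev(2)[OF 2(2)] 2(3) by metis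
  then have q': "q' \<noteq> 0" by (auto simp: v4_char_def split: if_splits)
  have "(v4_char q'' 1 * v4_char p'' 1) \<cdot>\<^sub>v v'' = (-1) \<cdot>\<^sub>v v''"
    using 3(3) act_zt[OF ev(3)[OF 3(2)]] ev[OF 3(2)] act_smult[OF quat_SL ev(3)[OF 3(2)]]
    by (simp add: smult_smult_assoc mult.commute)
  then have "v4_char q'' 1 * v4_char p'' 1 = -1" by (rule smult_cancel_vec[OF _ ev(3,4)[OF 3(2)]])
  then have pq'': "p'' \<noteq> q''" by (auto simp: v4_char_def split: if_splits)
  have le: "p \<le> 3" "q' \<le> 3" "p'' \<le> 3" "q'' \<le> 3" using 1 2 3 by (auto simp: chars_def)
  have in3: "m \<in> {1,2,3}" if "m \<noteq> 0" "m \<le> 3" for m :: nat using that by auto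
  have fne: "(\<lambda>k::nat. (k,0::nat)) \<noteq> (\<lambda>k. (0,k))" "(\<lambda>k::nat. (k,0::nat)) \<noteq> (\<lambda>k. (k,k))"
    "(\<lambda>k::nat. (0::nat,k)) \<noteq> (\<lambda>k. (k,k))"
    by (metis prod.inject zero_neq_one)+
  have no1: False if "(m,0) \<in> chars" "(0,n) \<in> chars" "m \<in> {1,2,3}" "n \<in> {1,2,3}" for m n
    using chars_two_orbits[of "\<lambda>k. (k,0)" "\<lambda>k. (0,k)" m n] that fne by blast
  have no2: False if "(m,0) \<in> chars" "(n,n) \<in> chars" "m \<in> {1,2,3}" "n \<in> {1,2,3}" for m n
    using chars_two_orbits[of "\<lambda>k. (k,0)" "\<lambda>k. (k,k)" m n] that fne by blast
  have no3: False if "(0,m) \<in> chars" "(n,n) \<in> chars" "m \<in> {1,2,3}" "n \<in> {1,2,3}" for m n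
    using chars_two_orbits[of "\<lambda>k. (0,k)" "\<lambda>k. (k,k)" m n] that fne by blast
  have A: "q = 0 \<or> q = p" using chars_diff[OF 1(1)] p by auto
  have B: "p' = 0 \<or> p' = q'" using chars_diff[OF 2(1)] q' by auto
  have C: "p'' = 0 \<or> q'' = 0" using chars_diff[OF 3(1)] pq'' by auto
  show False
  proof (cases "q = 0")
    case True
    then show False
      using no1[of p q'] no2[of p q'] 1(1) 2(1) B in3[OF p le(1)] in3[OF q' le(2)] by (cases "p' = 0") simp_all
  next
    case False
    then have pp: "(p,p) \<in> chars" using 1(1) A by simp
    show False
    proof (cases "p'' = 0")
      case True
      then show False using no3[of q'' p] 3(1) pp pq'' in3[OF p le(1)] in3[OF _ le(4)] by simp
    next
      case False
      then show False using no2[of p'' p] 3(1) C pp in3[OF p le(1)] in3[OF _ le(3)] by simp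
    qed
  qed
qed

text \<open>A quaternion unit in the kernel makes \<open>f(e_02)\<close> equal to the image of some
  \<open>e_13(a)\<close>, which commutes with \<open>f(e_23)\<close>; the commutator relation then
  kills \<open>e_03\<close>.\<close>

lemma contradiction: False
proof -
  have e: "elem 4 i j a \<in> carrier (SL 4)" if "i \<noteq> j" for i j a using that by simp
  have zt: "quat 1 * flip 4 0 1 \<in> carrier (SL 4)" by (intro SL_mult_closed quat_SL flip_0_SL) simp
  have one: "f (elem 4 0 2 1) = f (elem 4 1 3 a)"
    if "A * elem 4 0 2 1 = elem 4 1 3 a * A" "A \<in> carrier (SL 4)" "f A = 1\<^sub>m 4" for A a
    using f_rel[OF that(1,2) e e that(2)] that(3) by (simp add: left_mult_one_mat[of _ 4 4] right_mult_one_mat[of _ 4 4])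
  obtain a where a: "f (elem 4 0 2 1) = f (elem 4 1 3 a)"
    using trivial_quaternion one[OF quat_elem(1) quat_SL] one[OF quat_elem(2) zt] by blast
  have c23: "f (elem 4 1 3 a) * f (elem 4 2 3 1) = f (elem 4 2 3 1) * f (elem 4 1 3 a)"
    by (rule f_rel[OF elem_comm]) auto
  have "f (elem 4 0 2 1) * f (elem 4 2 3 1) = f (elem 4 0 3 1) * f (elem 4 2 3 1 * elem 4 0 2 1)"
    using elem_commutator[of 0 4 2 3 1 1] by (intro f_rel e SL_mult_closed) auto
  also have "f (elem 4 2 3 1 * elem 4 0 2 1) = f (elem 4 2 3 1) * f (elem 4 0 2 1)" by (rule f_mult) (auto intro: e)
  finally have "f (elem 4 0 3 1) * (f (elem 4 2 3 1) * f (elem 4 0 2 1)) = f (elem 4 2 3 1) * f (elem 4 0 2 1)"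
    using c23 unfolding a by simp
  then have "f (elem 4 0 3 1) = 1\<^sub>m 4"
    by (rule f_left_cancel) (auto intro!: e SL_mult_closed f_SL)
  then show False using elem_nontrivial[of 0 3] by simp
qed

end

context sl_hom
begin

text \<open>If \<open>f\<close> does not kill \<open>-1\<close>, there is a weight on which
  \<open>-1\<close> acts by \<open>-1\<close>. It has odd cardinality and so brings in all four
  singleton weights; the pair weight would be a fifth.\<close>

lemma no_pair_type:
  assumes d: "d = 4" and v: "weight S v" "S \<subseteq> {1..<d}" "card S = 2"
  shows False
proof (cases "f minus_one = 1\<^sub>m 4")
  case True
  interpret F: sl4_hom f
    using sl_hom_axioms True unfolding d sl4_hom_def sl4_hom_axioms_def by simp
  show False by (rule F.contradiction)
next
  case False
  have m: "minus_one \<in> carrier (SL d)" using minus_one_SL d by simp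
  have act_m: "act minus_one w = act (flip d 0 1) (act (flip d 2 3) w)" if "w \<in> carrier_vec d" for w
    using act_mult[OF _ _ that, of "flip d 0 1" "flip d 2 3"] flip_SL[of 0 d 1] flip_SL[of 2 d 3] minus_one_flip d by simp
  have mtyp: "act minus_one w = (sgn_on T 0 * sgn_on T 1 * (sgn_on T 2 * sgn_on T 3)) \<cdot>\<^sub>v w" if "weight T w" for T w
  proof -
    note w = weightD[OF that]
    have "act minus_one w = act (flip d 0 1) ((sgn_on T 2 * sgn_on T 3) \<cdot>\<^sub>v w)"
      using act_m[OF w(1)] w(3)[of 2 3] d by simp
    also have "\<dots> = (sgn_on T 2 * sgn_on T 3) \<cdot>\<^sub>v ((sgn_on T 0 * sgn_on T 1) \<cdot>\<^sub>v w)"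
      using act_smult[OF flip_SL[of 0 d 1] w(1)] w(3)[of 0 1] d by simp
    finally show ?thesis by (simp add: smult_smult_assoc mult.commute)
  qed
  have mc: "minus_one * flip d 0 j = flip d 0 j * minus_one" for j
    unfolding d minus_one_def flip_def diag_of_diag_of by (simp add: mult.commute)
  have m1: "minus_one * minus_one = 1\<^sub>m d"
    unfolding d minus_one_def diag_of_diag_of by (rule mat4_eqI) (auto simp: diag_of_def)
  have msq: "act minus_one (act minus_one v) = v" if "v \<in> carrier_vec d" for v
    using act_mult[OF m m that] m1 act_one[OF that] by simp
  obtain T w where wT: "weight T w" and T: "T \<subseteq> {1..<d}" and w3: "act minus_one w = - w"
    by (rule weight_exists[OF m _ msq mc]) (use False d in auto)
  note w = weightD(1,2)[OF wT] w3
  define e where "e = sgn_on T 0 * sgn_on T 1 * (sgn_on T 2 * sgn_on T 3)"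
  have "e \<noteq> 1"
  proof
    assume "e = 1"
    then have "w = - w" using mtyp[OF wT] w(3) by (simp add: e_def)
    then show False using vec_eq_uminus[OF w(1)] w(2) by blast
  qed
  have sub3: "R \<subseteq> {1,2,3::nat}" if "R \<subseteq> {1..<d}" for R using that d by auto
  have prod_card: "sgn_on R 0 * sgn_on R 1 * (sgn_on R 2 * sgn_on R 3) = (-1) ^ card R" if "R \<subseteq> {1,2,3}" for R
  proof -
    have "R \<in> Pow {1,2,3}" using that by simp
    then have "R = {} \<or> R = {1} \<or> R = {2} \<or> R = {3} \<or> R = {1,2} \<or> R = {1,3} \<or> R = {2,3} \<or> R = {1,2,3}"
      by (auto simp: Pow_insert)
    then show ?thesis by (elim disjE) (simp_all add: sgn_on_def)
  qed
  have "(-1::int) ^ card T \<noteq> 1" using \<open>e \<noteq> 1\<close> prod_card[OF sub3[OF T]] unfolding e_def by metis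
  then have "card T \<noteq> 2" "T \<noteq> {}" by (metis power2_eq_square mult_minus_left mult_minus_right minus_minus mult_1, metis card.empty power_0)
  then obtain x where x: "\<And>i. i < d \<Longrightarrow> weight {i} (x i)"
    using weight_singletons[OF wT T] by blast
  \<comment> \<open>Index 4 stands for the pair weight; \<open>minus_one\<close> separates it from
    the four singletons, which are separated from each other by sign matrices.\<close>
  let ?y = "\<lambda>i. if i < 4 then x i else v"
  let ?R = "\<lambda>i. if i < 4 then {i} else S"
  have y: "weight (?R i) (?y i)" for i using x v d by simp
  have "card {..<5::nat} \<le> d"
  proof (rule act_card_le[where x = ?y])
    show "?y i \<in> carrier_vec d \<and> ?y i \<noteq> 0\<^sub>v d" for i using weightD(1,2)[OF y[of i]] by simp
    fix i k :: nat assume ik: "i \<in> {..<5}" "k \<in> {..<5}" "i \<noteq> k"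
    show "\<exists>A \<in> carrier (SL d). \<exists>\<chi>. (\<forall>m\<in>{..<5}. act A (?y m) = \<chi> m \<cdot>\<^sub>v ?y m) \<and> \<chi> i \<noteq> \<chi> k"
    proof (cases "i < 4 \<and> k < 4")
      case True
      obtain n where n: "n < d" "n \<noteq> i" "n \<noteq> k" by (rule third_index[OF d3])
      have "flip d i n \<in> carrier (SL d)" using flip_SL True n d by simp
      moreover have "\<forall>m\<in>{..<5}. act (flip d i n) (?y m) = (sgn_on (?R m) i * sgn_on (?R m) n) \<cdot>\<^sub>v ?y m"
        using weightD(3)[OF y, of i n] True n d by blast
      moreover have "sgn_on (?R i) i * sgn_on (?R i) n \<noteq> sgn_on (?R k) i * sgn_on (?R k) n"
        using True n ik by (auto simp: sgn_on_def)
      ultimately show ?thesis by (intro bexI[of _ "flip d i n"] exI[of _ "\<lambda>m. sgn_on (?R m) i * sgn_on (?R m) n"]) blast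
    next
      case False
      let ?\<chi> = "\<lambda>m. sgn_on (?R m) 0 * sgn_on (?R m) 1 * (sgn_on (?R m) 2 * sgn_on (?R m) 3)"
      have S1: "sgn_on S 0 * sgn_on S 1 * (sgn_on S 2 * sgn_on S 3) = 1" using prod_card[OF sub3[OF v(2)]] v(3) by simp
      have "sgn_on {m} 0 * sgn_on {m} 1 * (sgn_on {m} 2 * sgn_on {m} 3) = -1" if "m < 4" for m
      proof -
        have "m = 0 \<or> m = 1 \<or> m = 2 \<or> m = 3" using that by auto
        then show ?thesis by (elim disjE) (simp_all add: sgn_on_def)
      qed
      then have "?\<chi> i \<noteq> ?\<chi> k" using False ik S1 by (cases "i < 4"; cases "k < 4") simp_all
      moreover have "\<forall>m\<in>{..<5}. act minus_one (?y m) = ?\<chi> m \<cdot>\<^sub>v ?y m" using mtyp[OF y] by blast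
      ultimately show ?thesis using m by (intro bexI[of _ minus_one] exI[of _ ?\<chi>]) blast+
    qed
  qed simp
  then show False using d by simp
qed

lemma conj_or_inv_transpose:
  "\<exists>P \<in> carrier (GL d). (\<forall>A \<in> carrier (SL d). f A = GL_conj d P A) \<or>
    (\<forall>A \<in> carrier (SL d). f A = GL_conj d P (inv_transpose d A))"
proof -
  have d1: "1 < d" using d3 by simp
  have t: "flip d 0 1 \<in> carrier (SL d)" by (rule flip_SL) (use d1 in auto)
  have sq: "act (flip d 0 1) (act (flip d 0 1) v) = v" if "v \<in> carrier_vec d" for v
    using flip_act_sq[of 0 1 v] d1 that by simp
  obtain S v where v: "weight S v" "S \<subseteq> {1..<d}" "act (flip d 0 1) v = - v"
    by (rule weight_exists[OF t flip_nontrivial sq flip_comm])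
  have "S \<noteq> {}"
  proof
    assume "S = {}"
    then have "v = - v" using weightD(3)[OF v(1), of 0 1] v(3) d1 by (simp add: sgn_on_def)
    then show False using vec_eq_uminus[OF weightD(1)[OF v(1)]] weightD(2)[OF v(1)] by blast
  qed
  note S = v(1,2) this
  have "\<not> (d = 4 \<and> card S = 2)" using S no_pair_type by blast
  from weight_singletons[OF S this] obtain x where "\<And>i. i < d \<Longrightarrow> weight {i} (x i)" by blast
  then show ?thesis by (rule conj_of_singletons)
qed

end

section \<open>Conjugations as automorphisms, and the conclusion\<close>

lemma GL_conj_iso:
  assumes P: "P \<in> carrier (GL d)"
  shows "GL_conj d P \<in> iso (SL d) (SL d)"
proof -
  interpret G: group "GL d" by (rule group_GL)
  let ?K = "inv\<^bsub>GL d\<^esub> P"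
  have K: "?K \<in> carrier (GL d)" using P by simp
  have c: "P \<in> carrier_mat d d" "?K \<in> carrier_mat d d" using P K by (auto simp: carrier_GL)
  have PK: "P * ?K = 1\<^sub>m d" "?K * P = 1\<^sub>m d" using G.r_inv[OF P] G.l_inv[OF P] by simp_all
  \<comment> \<open>Only the product of the determinants matters for staying in \<open>SL d\<close>;
    \<open>det P\<close> itself may be \<open>-1\<close>.\<close>
  have det: "det P * det ?K = 1" using det_mult[OF c] PK by simp
  have closed: "R * A * R' \<in> carrier (SL d)"
    if "A \<in> carrier (SL d)" "R \<in> carrier_mat d d" "R' \<in> carrier_mat d d" "det R * det R' = 1" for A R R'
    using that by (auto simp: SL_simps(1) det_mult[of _ d] mult_carrier_mat[of _ d d _ d])
  have cancel: "R * (R' * A * R) * R' = A"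
    if A: "A \<in> carrier (SL d)" and R: "R \<in> carrier_mat d d" "R' \<in> carrier_mat d d" "R * R' = 1\<^sub>m d" for A R R'
  proof -
    note a = SL_carrier_mat[OF A]
    have "R * (R' * A * R) * R' = R * (R' * (A * (R * R')))"
      using a R(1,2) by (simp add: assoc_mult_mat[of _ d d _ d _ d] mult_carrier_mat[of _ d d _ d])
    also have "\<dots> = R * (R' * A)" using a R(3) by simp
    also have "\<dots> = R * R' * A" by (rule assoc_mult_mat[OF R(1,2) a, symmetric])
    finally show ?thesis using a R(3) by simp
  qed
  show ?thesis
  proof (rule isoI)
    show "GL_conj d P \<in> hom (SL d) (SL d)"
    proof (rule homI)
      fix A B assume A: "A \<in> carrier (SL d)" and B: "B \<in> carrier (SL d)"
      show "GL_conj d P A \<in> carrier (SL d)" unfolding GL_conj_def by (rule closed[OF A c det])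
      note a = SL_carrier_mat[OF A] SL_carrier_mat[OF B]
      have "P * A * ?K * (P * B * ?K) = P * A * (?K * P) * B * ?K"
        using a c by (simp add: assoc_mult_mat[of _ d d _ d _ d] mult_carrier_mat[of _ d d _ d])
      also have "\<dots> = P * (A * B) * ?K"
        unfolding PK using a c by (simp add: assoc_mult_mat[of _ d d _ d _ d] mult_carrier_mat[of _ d d _ d] right_mult_one_mat[of _ d d])
      finally show "GL_conj d P (A \<otimes>\<^bsub>SL d\<^esub> B) = GL_conj d P A \<otimes>\<^bsub>SL d\<^esub> GL_conj d P B"
        by (simp add: GL_conj_def)
    qed
    show "bij_betw (GL_conj d P) (carrier (SL d)) (carrier (SL d))"
    proof (rule bij_betw_byWitness[where f' = "\<lambda>A. ?K * A * P"])
      show "\<forall>A \<in> carrier (SL d). ?K * GL_conj d P A * P = A"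
        unfolding GL_conj_def using cancel[of _ ?K P] c PK by blast
      show "\<forall>A \<in> carrier (SL d). GL_conj d P (?K * A * P) = A"
        unfolding GL_conj_def using cancel[of _ P ?K] c PK by blast
      show "GL_conj d P ` carrier (SL d) \<subseteq> carrier (SL d)"
        unfolding GL_conj_def using closed[OF _ c det] by blast
      show "(\<lambda>A. ?K * A * P) ` carrier (SL d) \<subseteq> carrier (SL d)"
        using closed[OF _ c(2,1)] det by (auto simp: mult.commute)
    qed
  qed
qed

theorem theorem5:
  fixes d :: nat
  assumes "d \<ge> 3"
  shows "(\<forall>f \<in> hom (SL d) (SL d).
            (\<exists>A \<in> carrier (SL d). f A \<noteq> \<one>\<^bsub>SL d\<^esub>) \<longrightarrow> f \<in> iso (SL d) (SL d)) \<and>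
         (\<forall>f \<in> iso (SL d) (SL d). \<exists>P \<in> carrier (GL d).
            (\<forall>A \<in> carrier (SL d). f A = GL_conj d P A) \<or>
            (\<forall>A \<in> carrier (SL d). f A = GL_conj d P (inv_transpose d A)))"
proof (intro conjI ballI impI)
  fix f assume f: "f \<in> hom (SL d) (SL d)" "\<exists>A \<in> carrier (SL d). f A \<noteq> \<one>\<^bsub>SL d\<^esub>"
  then interpret sl_hom d f using assms by unfold_locales auto
  obtain P where P: "P \<in> carrier (GL d)"
    and c: "(\<forall>A \<in> carrier (SL d). f A = GL_conj d P A) \<or> (\<forall>A \<in> carrier (SL d). f A = GL_conj d P (inv_transpose d A))"
    using conj_or_inv_transpose by blast
  have "GL_conj d P \<circ> inv_transpose d \<in> iso (SL d) (SL d)"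
    by (rule iso_set_trans[OF inv_transpose_iso GL_conj_iso[OF P]])
  then have "\<exists>h \<in> iso (SL d) (SL d). \<forall>A \<in> carrier (SL d). f A = h A"
    using c
  proof (elim disjE)
    assume "\<forall>A \<in> carrier (SL d). f A = GL_conj d P A"
    then show ?thesis using GL_conj_iso[OF P] by blast
  qed (intro bexI[of _ "GL_conj d P \<circ> inv_transpose d"], simp_all)
  then obtain h where h: "h \<in> iso (SL d) (SL d)" "\<And>A. A \<in> carrier (SL d) \<Longrightarrow> f A = h A" by blast
  \<comment> \<open>\<open>f\<close> and \<open>h\<close> are known to agree only on the carrier, so
    bijectivity is transferred there instead of equating the functions.\<close>
  then have "bij_betw f (carrier (SL d)) (carrier (SL d))"
    unfolding iso_def using bij_betw_cong[of "carrier (SL d)" f h] by auto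
  then show "f \<in> iso (SL d) (SL d)" using f(1) by (simp add: iso_def)
next
  fix f assume f: "f \<in> iso (SL d) (SL d)"
  have inj: "inj_on f (carrier (SL d))" and hom: "f \<in> hom (SL d) (SL d)"
    using f by (auto simp: iso_def bij_betw_def)
  have S: "elem d 0 1 1 \<in> carrier (SL d)" by simp
  have S1: "1\<^sub>m d \<in> carrier (SL d)" by (simp add: SL_simps(1))
  \<comment> \<open>Injectivity is needed only to see that \<open>f\<close> moves one element away
    from the identity.\<close>
  have "(elem d 0 1 1) $$ (0,1) \<noteq> 1\<^sub>m d $$ (0,1)" using assms by simp
  then have "elem d 0 1 1 \<noteq> 1\<^sub>m d" by metis
  moreover have "f (1\<^sub>m d) = 1\<^sub>m d" using hom_one[OF hom group_SL group_SL] by simp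
  ultimately have "f (elem d 0 1 1) \<noteq> 1\<^sub>m d" using inj_onD[OF inj _ S S1] by metis
  then interpret sl_hom d f using assms hom S by unfold_locales auto
  show "\<exists>P \<in> carrier (GL d). (\<forall>A \<in> carrier (SL d). f A = GL_conj d P A) \<or>
    (\<forall>A \<in> carrier (SL d). f A = GL_conj d P (inv_transpose d A))"
    by (rule conj_or_inv_transpose)
qed

end
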